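(* Let $k\ge1$ and let $T(\widetilde A)$ be a partially symmetric, bounded, positive invertible operator on $l^2_{2k}$ generated by $\widetilde A\in L^\infty_{2k\times 2k}$. For $n\in\mathbb N$ let $d_1^{(n)}\le\cdots\le d_{nk}^{(n)}$ be the symplectic eigenvalues of $T_n(\widetilde A)$, let $\mathcal D_n=\{d_1^{(n)},\dots,d_{nk}^{(n)}\}$, and let $\mathcal D=\bigcup_{n}\mathcal D_n$. For $1\le j\le k$ let $\mathcal R_j$ be the essential range of the function $\theta\mapsto d_j(\widetilde A(\theta))$ on $[-\pi,\pi]$, and let $\mathcal R=\bigcup_{j=1}^k\mathcal R_j$. Then $\mathcal D$ is dense in $\mathcal R$, in the sense that $\mathcal R\subseteq\overline{\mathcal D}$. Further, for each $\delta>0$, let $$X_\delta=[\mathfrak m_{\widetilde A},\|\widetilde A\|]\setminus\mathcal B(\mathcal R,\delta),$$ and let $c_n(X_\delta)$ be the cardinality of $\{j\in\{1,\dots,nk\}: d_j^{(n)}\in X_\delta\}$. Then $$\lim_{n\to\infty}\frac{c_n(X_\delta)}{n}=0 .$$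
   Context: $L^\infty_{2k\times 2k}$ is the set of measurable functions $\widetilde A$ from $[-\pi,\pi]$ to the complex $2k\times 2k$ matrices with essentially bounded entries and $\widetilde A(-\pi)=\widetilde A(\pi)$; $\|\widetilde A\|=\operatorname{ess\,sup}_\theta\|\widetilde A(\theta)\|$ (operator norm). The Fourier coefficients of $\widetilde A$ are $A_n=\frac1{2\pi}\int_{-\pi}^{\pi}\widetilde A(\theta)e^{-\imath n\theta}d\theta$, $n\in\mathbb Z$. $l^2_{2k}$ is the Hilbert space of square summable sequences $(x_0,x_1,\dots)$ with $x_i\in\mathbb C^{2k}$. $T(\widetilde A)=[A_{i-j}]_{i,j=0}^\infty$ is the block Toeplitz operator on $l^2_{2k}$ generated by $\widetilde A$, and $T_n(\widetilde A)=[A_{i-j}]_{i,j=0}^{n-1}$. $T(\widetilde A)$ is partially symmetric if every $A_n$ is real and $A_{-n}=A_n$ for all $n\in\mathbb N$. An operator $T$ is positive invertible if it is Hermitian, $\langle x,Tx\rangle>0$ for all $x\neq0$, and $T$ is invertible (with bounded inverse). Under these hypotheses $T_n(\widetilde A)$ is real positive definite for every $n$, and $\widetilde A(\theta)$ is real positive definite for almost every $\theta$. Let $J_2=\begin{bmatrix}0&1\\-1&0\end{bmatrix}$ and $J_{2m}=J_2\oplus\cdots\oplus J_2$ ($m$ times). A real $2m\times 2m$ matrix $M$ is symplectic if $M^TJ_{2m}M=J_{2m}$. By Williamson's theorem, for every real positive definite $2m\times 2m$ matrix $B$ there is a symplectic $M$ with $MBM^T=d_1(B)I_2\oplus\cdots\oplus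 d_m(B)I_2$, where $0<d_1(B)\le\cdots\le d_m(B)$ are uniquely determined by $B$ (the symplectic eigenvalues of $B$). $\mathfrak m_{\widetilde A}=\operatorname{ess\,inf}_{\theta\in[-\pi,\pi]}d_1(\widetilde A(\theta))$. The essential range of a measurable real function $g$ on $[-\pi,\pi]$ is the set of $x\in\mathbb R$ such that $\{t:|g(t)-x|<\epsilon\}$ has positive Lebesgue measure for every $\epsilon>0$. For $X\subseteq\mathbb R$, $\mathcal B(X,\delta)=\{x\in\mathbb R:|x-s|<\delta\text{ for some }s\in X\}$. *)

theory Defs
  imports
    "HOL-Probability.Essential_Supremum"
    "Jordan_Normal_Form.Matrix"
begin

section \<open>Matrix-valued symbols on the circle\<close>

abbreviation circle_measure :: "real measure"
  where "circle_measure \<equiv> lebesgue_on {-pi..pi}"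

definition vec_norm2 :: "complex vec \<Rightarrow> real"
  where "vec_norm2 v = sqrt (\<Sum>i<dim_vec v. (cmod (v $ i))\<^sup>2)"

definition mat_op_norm :: "complex mat \<Rightarrow> real"
  where "mat_op_norm M =
    Sup {vec_norm2 (M *\<^sub>v v) | v. v \<in> carrier_vec (dim_col M) \<and> vec_norm2 v \<le> 1}"

definition Linf_mat :: "nat \<Rightarrow> (real \<Rightarrow> complex mat) set"
  where "Linf_mat N = {A.
    (\<forall>\<theta>\<in>{-pi..pi}. A \<theta> \<in> carrier_mat N N) \<and>
    (\<forall>a<N. \<forall>b<N. (\<lambda>\<theta>. A \<theta> $$ (a, b)) \<in> borel_measurable circle_measure \<and>
       (\<exists>C. AE \<theta> in circle_measure. cmod (A \<theta> $$ (a, b)) \<le> C)) \<and>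
    A (-pi) = A pi}"

definition Linf_norm :: "(real \<Rightarrow> complex mat) \<Rightarrow> ereal"
  where "Linf_norm A = esssup circle_measure (\<lambda>\<theta>. ereal (mat_op_norm (A \<theta>)))"

definition ess_inf :: "(real \<Rightarrow> real) \<Rightarrow> ereal"
  where "ess_inf g = - esssup circle_measure (\<lambda>\<theta>. - ereal (g \<theta>))"

definition essential_range :: "(real \<Rightarrow> real) \<Rightarrow> real set"
  where "essential_range g =
    {x. \<forall>\<epsilon>>0. emeasure lebesgue {t \<in> {-pi..pi}. \<bar>g t - x\<bar> < \<epsilon>} > 0}"

definition fourier_coeff :: "nat \<Rightarrow> (real \<Rightarrow> complex mat) \<Rightarrow> int \<Rightarrow> complex mat"
  where "fourier_coeff N A n = mat N N (\<lambda>(a, b).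
    (1 / (2 * pi)) *
      (LINT \<theta>|circle_measure. A \<theta> $$ (a, b) * exp (- \<i> * of_int n * of_real \<theta>)))"

definition partially_symmetric :: "nat \<Rightarrow> (real \<Rightarrow> complex mat) \<Rightarrow> bool"
  where "partially_symmetric N A \<longleftrightarrow>
    (\<forall>n. \<forall>a<N. \<forall>b<N. fourier_coeff N A n $$ (a, b) \<in> \<real>) \<and>
    (\<forall>n::nat. fourier_coeff N A (- int n) = fourier_coeff N A (int n))"


section \<open>Block sequences and block Toeplitz operators\<close>

definition l2 :: "nat \<Rightarrow> (nat \<Rightarrow> complex vec) set"
  where "l2 N = {x. (\<forall>i. x i \<in> carrier_vec N) \<and> summable (\<lambda>i. (vec_norm2 (x i))\<^sup>2)}"

(* Conjugate-linear in the first argument: v \<bullet>c w conjugates w. *)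
definition l2_inner :: "(nat \<Rightarrow> complex vec) \<Rightarrow> (nat \<Rightarrow> complex vec) \<Rightarrow> complex"
  where "l2_inner x y = (\<Sum>i. y i \<bullet>c x i)"

definition l2_norm :: "(nat \<Rightarrow> complex vec) \<Rightarrow> real"
  where "l2_norm x = sqrt (\<Sum>i. (vec_norm2 (x i))\<^sup>2)"

definition l2_bounded_op :: "nat \<Rightarrow> ((nat \<Rightarrow> complex vec) \<Rightarrow> (nat \<Rightarrow> complex vec)) \<Rightarrow> bool"
  where "l2_bounded_op N T \<longleftrightarrow>
    (\<forall>x\<in>l2 N. T x \<in> l2 N) \<and>
    (\<forall>x\<in>l2 N. \<forall>y\<in>l2 N. T (\<lambda>i. x i + y i) = (\<lambda>i. T x i + T y i)) \<and>
    (\<forall>c. \<forall>x\<in>l2 N. T (\<lambda>i. c \<cdot>\<^sub>v x i) = (\<lambda>i. c \<cdot>\<^sub>v T x i)) \<and>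
    (\<exists>C. \<forall>x\<in>l2 N. l2_norm (T x) \<le> C * l2_norm x)"

definition l2_hermitian :: "nat \<Rightarrow> ((nat \<Rightarrow> complex vec) \<Rightarrow> (nat \<Rightarrow> complex vec)) \<Rightarrow> bool"
  where "l2_hermitian N T \<longleftrightarrow> (\<forall>x\<in>l2 N. \<forall>y\<in>l2 N. l2_inner x (T y) = l2_inner (T x) y)"

definition l2_invertible :: "nat \<Rightarrow> ((nat \<Rightarrow> complex vec) \<Rightarrow> (nat \<Rightarrow> complex vec)) \<Rightarrow> bool"
  where "l2_invertible N T \<longleftrightarrow>
    (\<exists>S. l2_bounded_op N S \<and> (\<forall>x\<in>l2 N. S (T x) = x \<and> T (S x) = x))"

definition l2_positive_invertible ::
    "nat \<Rightarrow> ((nat \<Rightarrow> complex vec) \<Rightarrow> (nat \<Rightarrow> complex vec)) \<Rightarrow> bool"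
  where "l2_positive_invertible N T \<longleftrightarrow>
    l2_hermitian N T \<and>
    (\<forall>x\<in>l2 N. x \<noteq> (\<lambda>_. 0\<^sub>v N) \<longrightarrow> l2_inner x (T x) \<in> \<real> \<and> 0 < Re (l2_inner x (T x))) \<and>
    l2_invertible N T"

(* The series converge absolutely for x in l2 N, since the entries of the Fourier
   coefficients of a bounded symbol are square summable. *)
definition toeplitz_op ::
    "nat \<Rightarrow> (real \<Rightarrow> complex mat) \<Rightarrow> (nat \<Rightarrow> complex vec) \<Rightarrow> (nat \<Rightarrow> complex vec)"
  where "toeplitz_op N A x = (\<lambda>i. vec N (\<lambda>a.
    \<Sum>j. (fourier_coeff N A (int i - int j) *\<^sub>v x j) $ a))"

(* Row index i * N + a is row a of block row i; columns likewise. *)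
definition toeplitz_mat :: "nat \<Rightarrow> (real \<Rightarrow> complex mat) \<Rightarrow> nat \<Rightarrow> complex mat"
  where "toeplitz_mat N A n = mat (n * N) (n * N) (\<lambda>(r, s).
    fourier_coeff N A (int (r div N) - int (s div N)) $$ (r mod N, s mod N))"


section \<open>Symplectic eigenvalues\<close>

definition J2 :: "real mat"
  where "J2 = mat_of_rows_list 2 [[0, 1], [-1, 0]]"

(* The standard symplectic form of size 2m. *)
definition symp_form :: "nat \<Rightarrow> real mat"
  where "symp_form m = diag_block_mat (replicate m J2)"

definition symplectic :: "nat \<Rightarrow> real mat \<Rightarrow> bool"
  where "symplectic m M \<longleftrightarrow>
    M \<in> carrier_mat (2 * m) (2 * m) \<and> transpose_mat M * symp_form m * M = symp_form m"

definition williamson_form :: "real mat \<Rightarrow> real list \<Rightarrow> bool"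
  where "williamson_form B ds \<longleftrightarrow>
    B \<in> carrier_mat (2 * length ds) (2 * length ds) \<and> sorted ds \<and> (\<forall>d\<in>set ds. 0 < d) \<and>
    (\<exists>M. symplectic (length ds) M \<and>
      M * B * transpose_mat M = diag_block_mat (map (\<lambda>d. d \<cdot>\<^sub>m 1\<^sub>m 2) ds))"

(* d_j(B) for j = 1, ..., m, where B is a real positive definite 2m x 2m matrix. *)
definition symp_eig :: "real mat \<Rightarrow> nat \<Rightarrow> real"
  where "symp_eig B j = (THE ds. williamson_form B ds) ! (j - 1)"

(* Symbol values and truncations have type complex mat. They are real (the former almost
   everywhere) when the Toeplitz operator is partially symmetric, so that taking entrywise
   real parts is only a change of type. *)
abbreviation re_mat :: "complex mat \<Rightarrow> real mat"
  where "re_mat M \<equiv> map_mat Re M"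

definition symbol_eig :: "(real \<Rightarrow> complex mat) \<Rightarrow> nat \<Rightarrow> real \<Rightarrow> real"
  where "symbol_eig A j \<theta> = symp_eig (re_mat (A \<theta>)) j"

definition trunc_eig :: "nat \<Rightarrow> (real \<Rightarrow> complex mat) \<Rightarrow> nat \<Rightarrow> nat \<Rightarrow> real"
  where "trunc_eig k A n j = symp_eig (re_mat (toeplitz_mat (2 * k) A n)) j"

definition trunc_spectrum :: "nat \<Rightarrow> (real \<Rightarrow> complex mat) \<Rightarrow> real set"
  where "trunc_spectrum k A = (\<Union>n\<in>{1..}. {trunc_eig k A n j | j. j \<in> {1..n * k}})"

definition symbol_range :: "nat \<Rightarrow> (real \<Rightarrow> complex mat) \<Rightarrow> real set"
  where "symbol_range k A = (\<Union>j\<in>{1..k}. essential_range (symbol_eig A j))"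

definition open_nbhd :: "real set \<Rightarrow> real \<Rightarrow> real set"
  where "open_nbhd X \<delta> = {x. \<exists>s\<in>X. \<bar>x - s\<bar> < \<delta>}"

definition outlier_set :: "nat \<Rightarrow> (real \<Rightarrow> complex mat) \<Rightarrow> real \<Rightarrow> real set"
  where "outlier_set k A \<delta> =
    {x. ess_inf (symbol_eig A 1) \<le> ereal x \<and> ereal x \<le> Linf_norm A}
      - open_nbhd (symbol_range k A) \<delta>"

definition outlier_count :: "nat \<Rightarrow> (real \<Rightarrow> complex mat) \<Rightarrow> nat \<Rightarrow> real set \<Rightarrow> nat"
  where "outlier_count k A n X = card {j \<in> {1..n * k}. trunc_eig k A n j \<in> X}"

end

theory Submission
  imports Defs "Jordan_Normal_Form.Determinant"
begin

text \<open>Up to sign, twice the sum of the powers \<open>d\<^sup>2\<^sup>q\<close> of the symplectic eigenvalues \<open>d\<close> of \<open>B\<close> is the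
  trace of \<open>(J B)\<^sup>2\<^sup>q\<close>. Since \<open>J\<close> is block diagonal, \<open>J T\<^sub>n(A)\<close> is the truncated block Toeplitz matrix
  of the symbol \<open>J A\<close>, and the trace of a power of such a truncation, divided by \<open>n\<close>, converges to the
  mean of the trace of that power of the symbol: away from the two ends, truncating a shifted column
  costs little in mean square. All eigenvalues lie in a fixed bounded interval, so Weierstrass
  approximation in \<open>d\<^sup>2\<close> turns the convergence of these moments into the limit distribution of the
  symplectic eigenvalues. A bump function near a point of the essential range and a function that
  vanishes on the essential ranges but not on the outliers then give the two claims.\<close>

section \<open>Trigonometric polynomials on the circle\<close>

text \<open>The matrices \<open>J B\<close> are in general not normal, so nothing is compared
  eigenvalue by eigenvalue: traces are polynomial in the entries and see only the multiset. The
  spectrum of \<open>J B\<close> consists of \<open>i d\<close> and \<open>-i d\<close>, so odd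
  powers have trace zero and only even moments carry information; as every \<open>d\<close> is
  positive, functions of \<open>d\<^sup>2\<close> lose nothing. The symbol is merely bounded and
  measurable. Truncation and multiplication fail to commute by an error that need not be small in
  operator norm; it is small only in mean square over the columns, which is all that a normalised
  trace needs. \<open>symp_eig\<close> is a definite description, so existence and uniqueness of the
  Williamson form come before any statement on symplectic eigenvalues. Existence rests on
  coercivity, which passes from the operator to all truncations with one constant and from these to
  the symbol almost everywhere; uniqueness follows from the trace identity itself. Measurability of
  the single functions \<open>symbol_eig A j\<close>, up to a null set, is recovered from the
  moments too.\<close>

lemma circle_finite_measure: "finite_measure circle_measure"
  by (rule finite_measure_lebesgue_on) auto

lemma circle_measure_total: "measure circle_measure (space circle_measure) = 2 * pi"
  by (simp add: measure_restrict_space)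

definition bounded_fun :: "(real \<Rightarrow> complex) \<Rightarrow> bool" where
  "bounded_fun f \<longleftrightarrow> f \<in> borel_measurable circle_measure \<and> (\<exists>C. AE \<theta> in circle_measure. cmod (f \<theta>) \<le> C)"

definition chr :: "int \<Rightarrow> real \<Rightarrow> complex" where
  "chr l \<theta> = cis (of_int l * \<theta>)"

definition avg :: "(real \<Rightarrow> complex) \<Rightarrow> complex" where
  "avg f = complex_of_real (1 / (2 * pi)) * (LINT \<theta>|circle_measure. f \<theta>)"

text \<open>The square of the L2 norm for normalised Lebesgue measure. Keeping the square avoids
  roots; the price is the factor 2 in \<open>sqn_add\<close>, which replaces the triangle
  inequality.\<close>

definition sqn :: "(real \<Rightarrow> complex) \<Rightarrow> real" where
  "sqn f = (1 / (2 * pi)) * (LINT \<theta>|circle_measure. (cmod (f \<theta>))\<^sup>2)"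

definition coef :: "(real \<Rightarrow> complex) \<Rightarrow> int \<Rightarrow> complex" where
  "coef f l = avg (\<lambda>\<theta>. f \<theta> * cnj (chr l \<theta>))"

text \<open>Orthogonal projection onto the span of the characters of frequency 0, ..., n - 1. The
  window is one-sided because block row \<open>i < n\<close> of a truncation corresponds to
  frequency \<open>i\<close>.\<close>

definition proj :: "nat \<Rightarrow> (real \<Rightarrow> complex) \<Rightarrow> real \<Rightarrow> complex" where
  "proj n f \<theta> = (\<Sum>l<n. coef f (int l) * chr (int l) \<theta>)"

lemma cmod_chr [simp]: "cmod (chr l \<theta>) = 1"
  by (simp add: chr_def)

lemma chr_mult: "chr a \<theta> * chr b \<theta> = chr (a + b) \<theta>"
  by (simp add: chr_def cis_mult ring_distribs)

lemma cnj_chr: "cnj (chr a \<theta>) = chr (- a) \<theta>"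
  by (simp add: chr_def cis_cnj)

lemma chr_0: "chr 0 = (\<lambda>\<theta>. 1)"
  by (auto simp: chr_def)

lemma bounded_funE:
  assumes "bounded_fun f"
  obtains C where "C > 0" "AE \<theta> in circle_measure. cmod (f \<theta>) \<le> C" "f \<in> borel_measurable circle_measure"
proof -
  obtain C where "AE \<theta> in circle_measure. cmod (f \<theta>) \<le> C" using assms by (auto simp: bounded_fun_def)
  then have "AE \<theta> in circle_measure. cmod (f \<theta>) \<le> max C 1" by auto
  then show ?thesis using that[of "max C 1"] assms by (auto simp: bounded_fun_def)
qed

lemma bounded_fun_integrable: "bounded_fun f \<Longrightarrow> integrable circle_measure f"
  by (metis bounded_funE finite_measure.integrable_const_bound[OF circle_finite_measure])

lemma bounded_fun_meas: "bounded_fun f \<Longrightarrow> f \<in> borel_measurable circle_measure"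
  by (simp add: bounded_fun_def)

lemma bounded_fun_const [simp]: "bounded_fun (\<lambda>\<theta>. c)"
  by (auto simp: bounded_fun_def)

lemma bounded_fun_continuous:
  assumes "continuous_on UNIV f" shows "bounded_fun f"
proof -
  have 1: "f \<in> borel_measurable circle_measure"
    using assms by (intro continuous_imp_measurable_on_sets_lebesgue) (auto intro: continuous_on_subset)
  have "compact (f ` {-pi..pi})" by (rule compact_continuous_image) (use assms continuous_on_subset in auto)
  then obtain C where "\<forall>x\<in>f ` {-pi..pi}. cmod x \<le> C" using compact_imp_bounded bounded_iff by blast
  then have "AE \<theta> in circle_measure. cmod (f \<theta>) \<le> C" by (intro AE_I2) auto
  with 1 show ?thesis by (auto simp: bounded_fun_def)
qed

lemma chr_continuous: "continuous_on S (chr l)"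
  unfolding chr_def by (intro continuous_intros)

lemma bounded_fun_chr [simp]: "bounded_fun (chr l)"
  by (rule bounded_fun_continuous[OF chr_continuous])

lemma bounded_fun_add [intro]: assumes "bounded_fun f" "bounded_fun g" shows "bounded_fun (\<lambda>\<theta>. f \<theta> + g \<theta>)"
proof -
  obtain C where C: "AE \<theta> in circle_measure. cmod (f \<theta>) \<le> C" "f \<in> borel_measurable circle_measure" using assms(1) by (rule bounded_funE)
  obtain D where D: "AE \<theta> in circle_measure. cmod (g \<theta>) \<le> D" "g \<in> borel_measurable circle_measure" using assms(2) by (rule bounded_funE)
  have "AE \<theta> in circle_measure. cmod (f \<theta> + g \<theta>) \<le> C + D"
    using C(1) D(1) by eventually_elim (metis add_mono norm_triangle_le)
  then show ?thesis using C(2) D(2) unfolding bounded_fun_def by auto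
qed

lemma bounded_fun_mult [intro]: assumes "bounded_fun f" "bounded_fun g" shows "bounded_fun (\<lambda>\<theta>. f \<theta> * g \<theta>)"
proof -
  obtain C where C: "C > 0" "AE \<theta> in circle_measure. cmod (f \<theta>) \<le> C" "f \<in> borel_measurable circle_measure" using assms(1) by (rule bounded_funE)
  obtain D where D: "AE \<theta> in circle_measure. cmod (g \<theta>) \<le> D" "g \<in> borel_measurable circle_measure" using assms(2) by (rule bounded_funE)
  have "AE \<theta> in circle_measure. cmod (f \<theta> * g \<theta>) \<le> C * D"
    using C(2) D(1) by eventually_elim (use C(1) in \<open>auto simp: norm_mult intro!: mult_mono\<close>)
  then show ?thesis using C(3) D(2) unfolding bounded_fun_def by auto
qed

lemma bounded_fun_cnj [intro]: "bounded_fun f \<Longrightarrow> bounded_fun (\<lambda>\<theta>. cnj (f \<theta>))"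
  unfolding bounded_fun_def
  using measurable_compose[OF _ borel_measurable_continuous_onI[OF continuous_on_cnj[OF continuous_on_id]]] by auto

lemma bounded_fun_uminus [intro]: "bounded_fun f \<Longrightarrow> bounded_fun (\<lambda>\<theta>. - f \<theta>)"
  unfolding bounded_fun_def by auto

lemma bounded_fun_diff [intro]: "bounded_fun f \<Longrightarrow> bounded_fun g \<Longrightarrow> bounded_fun (\<lambda>\<theta>. f \<theta> - g \<theta>)"
  using bounded_fun_add[of f "\<lambda>\<theta>. - g \<theta>"] by auto

lemma bounded_fun_sum [intro]: "(\<And>i. i \<in> I \<Longrightarrow> bounded_fun (f i)) \<Longrightarrow> bounded_fun (\<lambda>\<theta>. \<Sum>i\<in>I. f i \<theta>)"
  by (induction I rule: infinite_finite_induct) auto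

lemma bounded_fun_proj [intro]: "bounded_fun (proj n f)"
  unfolding proj_def by (intro bounded_fun_sum bounded_fun_mult) auto

lemma bounded_fun_cmod_sq:
  assumes "bounded_fun f" shows "integrable circle_measure (\<lambda>\<theta>. (cmod (f \<theta>))\<^sup>2)"
proof -
  have "integrable circle_measure (\<lambda>\<theta>. f \<theta> * cnj (f \<theta>))" using assms bounded_fun_integrable by blast
  from integrable_norm[OF this] show ?thesis by (simp add: norm_mult power2_eq_square)
qed

lemma avg_add: "bounded_fun f \<Longrightarrow> bounded_fun g \<Longrightarrow> avg (\<lambda>\<theta>. f \<theta> + g \<theta>) = avg f + avg g"
  by (simp add: avg_def bounded_fun_integrable ring_distribs)

lemma avg_diff: "bounded_fun f \<Longrightarrow> bounded_fun g \<Longrightarrow> avg (\<lambda>\<theta>. f \<theta> - g \<theta>) = avg f - avg g"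
  by (simp add: avg_def bounded_fun_integrable ring_distribs)

lemma avg_cmult: "avg (\<lambda>\<theta>. c * f \<theta>) = c * avg f"
  by (simp add: avg_def)

lemma avg_sum: "(\<And>i. i \<in> I \<Longrightarrow> bounded_fun (f i)) \<Longrightarrow> avg (\<lambda>\<theta>. \<Sum>i\<in>I. f i \<theta>) = (\<Sum>i\<in>I. avg (f i))"
  by (simp add: avg_def bounded_fun_integrable sum_distrib_left Bochner_Integration.integral_sum)

lemma avg_cnj: "avg (\<lambda>\<theta>. cnj (f \<theta>)) = cnj (avg f)"
  by (simp add: avg_def)

lemma avg_const: "avg (\<lambda>\<theta>. c) = c"
  using circle_measure_total by (simp add: avg_def scaleR_conv_of_real)

lemma sqn_avg: "complex_of_real (sqn f) = avg (\<lambda>\<theta>. f \<theta> * cnj (f \<theta>))"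
proof -
  have "(LINT \<theta>|circle_measure. f \<theta> * cnj (f \<theta>)) = (LINT \<theta>|circle_measure. complex_of_real ((cmod (f \<theta>))\<^sup>2))"
    by (simp only: complex_norm_square)
  also have "\<dots> = complex_of_real (LINT \<theta>|circle_measure. (cmod (f \<theta>))\<^sup>2)"
    by (rule integral_complex_of_real)
  finally show ?thesis by (simp add: avg_def sqn_def)
qed

lemma sqn_nonneg [simp]: "0 \<le> sqn f"
  by (simp add: sqn_def)

lemma sqn_mono:
  assumes "AE \<theta> in circle_measure. (cmod (f \<theta>))\<^sup>2 \<le> g \<theta>" "bounded_fun f" "integrable circle_measure g"
  shows "sqn f \<le> (1 / (2 * pi)) * (LINT \<theta>|circle_measure. g \<theta>)"
  unfolding sqn_def using integral_mono_AE[OF bounded_fun_cmod_sq[OF assms(2)] assms(3,1)]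
  by (intro mult_left_mono) auto

lemma cmod_add_sq_le: "(cmod (x + y))\<^sup>2 \<le> 2 * (cmod x)\<^sup>2 + 2 * (cmod y)\<^sup>2"
proof -
  have "(cmod (x + y))\<^sup>2 \<le> (cmod x + cmod y)\<^sup>2" by (intro power_mono norm_triangle_ineq) auto
  also have "\<dots> \<le> 2 * (cmod x)\<^sup>2 + 2 * (cmod y)\<^sup>2"
    using sum_squares_ge_zero[of "cmod x - cmod y" 0] by (simp add: power2_eq_square algebra_simps)
  finally show ?thesis .
qed

lemma sqn_add: assumes "bounded_fun f" "bounded_fun g"
  shows "sqn (\<lambda>\<theta>. f \<theta> + g \<theta>) \<le> 2 * sqn f + 2 * sqn g"
proof -
  have "sqn (\<lambda>\<theta>. f \<theta> + g \<theta>) \<le> (1 / (2 * pi)) * (LINT \<theta>|circle_measure. 2 * (cmod (f \<theta>))\<^sup>2 + 2 * (cmod (g \<theta>))\<^sup>2)"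
    by (rule sqn_mono) (use cmod_add_sq_le assms bounded_fun_cmod_sq in auto)
  also have "\<dots> = 2 * sqn f + 2 * sqn g"
    using assms by (simp add: sqn_def bounded_fun_cmod_sq field_simps)
  finally show ?thesis .
qed

lemma sqn_cmult: "sqn (\<lambda>\<theta>. c * f \<theta>) = (cmod c)\<^sup>2 * sqn f"
  by (simp add: sqn_def norm_mult power_mult_distrib)

lemma sqn_chr_mult: "sqn (\<lambda>\<theta>. f \<theta> * chr l \<theta>) = sqn f"
  by (simp add: sqn_def norm_mult)

lemma sqn_mult_le: assumes "AE \<theta> in circle_measure. cmod (s \<theta>) \<le> C" "bounded_fun s" "bounded_fun f"
  shows "sqn (\<lambda>\<theta>. s \<theta> * f \<theta>) \<le> C\<^sup>2 * sqn f"
proof -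
  have "sqn (\<lambda>\<theta>. s \<theta> * f \<theta>) \<le> (1 / (2 * pi)) * (LINT \<theta>|circle_measure. C\<^sup>2 * (cmod (f \<theta>))\<^sup>2)"
  proof (rule sqn_mono)
    show "AE \<theta> in circle_measure. (cmod (s \<theta> * f \<theta>))\<^sup>2 \<le> C\<^sup>2 * (cmod (f \<theta>))\<^sup>2"
      using assms(1) by eventually_elim (auto simp: norm_mult power_mult_distrib intro!: mult_right_mono power_mono)
  qed (use assms bounded_fun_cmod_sq in auto)
  then show ?thesis by (simp add: sqn_def field_simps)
qed

lemma sqn_sum_le:
  assumes "finite I" "\<And>i. i \<in> I \<Longrightarrow> bounded_fun (f i)"
  shows "sqn (\<lambda>\<theta>. \<Sum>i\<in>I. f i \<theta>) \<le> card I * (\<Sum>i\<in>I. sqn (f i))"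
proof -
  have *: "(cmod (\<Sum>i\<in>I. f i \<theta>))\<^sup>2 \<le> card I * (\<Sum>i\<in>I. (cmod (f i \<theta>))\<^sup>2)" for \<theta>
  proof -
    have "(cmod (\<Sum>i\<in>I. f i \<theta>))\<^sup>2 \<le> (\<Sum>i\<in>I. cmod (f i \<theta>))\<^sup>2" by (intro power_mono norm_sum) auto
    also have "\<dots> \<le> (\<Sum>i\<in>I. (cmod (f i \<theta>))\<^sup>2) * card I" by (rule sum_squared_le_sum_of_squares)
    finally show ?thesis by (simp add: mult.commute)
  qed
  have "sqn (\<lambda>\<theta>. \<Sum>i\<in>I. f i \<theta>) \<le> (1 / (2 * pi)) * (LINT \<theta>|circle_measure. card I * (\<Sum>i\<in>I. (cmod (f i \<theta>))\<^sup>2))"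
    by (rule sqn_mono) (use * assms bounded_fun_cmod_sq in auto)
  also have "\<dots> = card I * (\<Sum>i\<in>I. sqn (f i))"
    using assms by (simp add: sqn_def bounded_fun_cmod_sq Bochner_Integration.integral_sum sum_divide_distrib[symmetric])
  finally show ?thesis .
qed

lemma avg_chr: "avg (chr l) = (if l = 0 then 1 else 0)"
proof (cases "l = 0")
  case True then show ?thesis using avg_const[of 1] by (simp add: chr_0)
next
  case False
  let ?F = "\<lambda>\<theta>. chr l \<theta> / (\<i> * of_int l)"
  have "(chr l has_integral (?F pi - ?F (-pi))) {-pi..pi}"
  proof (rule fundamental_theorem_of_calculus)
    show "(?F has_vector_derivative chr l x) (at x within {-pi..pi})" for x
    proof -
      have "((\<lambda>\<theta>. exp (\<i> * of_int l * complex_of_real \<theta>) / (\<i> * of_int l)) has_vector_derivative exp (\<i> * of_int l * complex_of_real x)) (at x within {-pi..pi})"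
      proof (rule has_vector_derivative_real_field[where f = "\<lambda>z. exp (\<i> * of_int l * z) / (\<i> * of_int l)"])
        show "((\<lambda>z. exp (\<i> * of_int l * z) / (\<i> * of_int l)) has_field_derivative exp (\<i> * of_int l * complex_of_real x)) (at (complex_of_real x))"
          using False by (auto intro!: derivative_eq_intros)
      qed
      then show ?thesis by (simp add: chr_def[abs_def] cis_conv_exp mult.assoc)
    qed
  qed auto
  moreover have "chr l pi = chr l (-pi)"
    by (simp add: chr_def complex_eq_iff sin_npi_int mult.commute[of _ pi])
  ultimately have "(chr l has_integral 0) {-pi..pi}" by simp
  then have "integral\<^sup>L circle_measure (chr l) = 0"
    by (subst lebesgue_integral_eq_integral) (auto intro: bounded_fun_integrable)
  then show ?thesis using False by (simp add: avg_def)
qed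

lemma coef_chr: "coef (chr m) l = (if l = m then 1 else 0)"
  using avg_chr[of "m - l"] by (simp add: coef_def cnj_chr chr_mult)

lemma coef_shift: "coef (\<lambda>\<theta>. f \<theta> * chr m \<theta>) l = coef f (l - m)"
  by (simp add: coef_def cnj_chr mult.assoc chr_mult)

lemma coef_add: "bounded_fun f \<Longrightarrow> bounded_fun g \<Longrightarrow> coef (\<lambda>\<theta>. f \<theta> + g \<theta>) l = coef f l + coef g l"
  unfolding coef_def by (subst avg_add[symmetric]) (auto simp: ring_distribs intro!: bounded_fun_mult bounded_fun_cnj)

lemma coef_diff: "bounded_fun f \<Longrightarrow> bounded_fun g \<Longrightarrow> coef (\<lambda>\<theta>. f \<theta> - g \<theta>) l = coef f l - coef g l"
  unfolding coef_def by (subst avg_diff[symmetric]) (auto simp: ring_distribs intro!: bounded_fun_mult bounded_fun_cnj)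

lemma coef_cmult: "coef (\<lambda>\<theta>. c * f \<theta>) l = c * coef f l"
  unfolding coef_def by (subst avg_cmult[symmetric]) (auto simp: mult.assoc)

lemma coef_sum: "(\<And>i. i \<in> I \<Longrightarrow> bounded_fun (f i)) \<Longrightarrow> coef (\<lambda>\<theta>. \<Sum>i\<in>I. f i \<theta>) l = (\<Sum>i\<in>I. coef (f i) l)"
  unfolding coef_def by (subst avg_sum[symmetric]) (auto simp: sum_distrib_right intro!: bounded_fun_mult bounded_fun_cnj)

lemma coef_proj: "coef (proj n f) m = (if 0 \<le> m \<and> m < int n then coef f m else 0)"
proof -
  have "coef (proj n f) m = (\<Sum>l<n. coef f (int l) * coef (chr (int l)) m)"
    unfolding proj_def by (subst coef_sum) (auto simp: coef_cmult)
  also have "\<dots> = (\<Sum>l<n. if l = nat m \<and> 0 \<le> m then coef f m else 0)"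
    by (rule sum.cong) (auto simp: coef_chr)
  also have "\<dots> = (if 0 \<le> m \<and> m < int n then coef f m else 0)"
    by (cases "0 \<le> m") (auto simp: nat_less_iff)
  finally show ?thesis .
qed

lemma proj_add: "bounded_fun f \<Longrightarrow> bounded_fun g \<Longrightarrow> proj n (\<lambda>\<theta>. f \<theta> + g \<theta>) \<theta> = proj n f \<theta> + proj n g \<theta>"
  by (simp add: proj_def coef_add sum.distrib ring_distribs)

lemma proj_cmult: "proj n (\<lambda>\<theta>. c * f \<theta>) \<theta> = c * proj n f \<theta>"
  by (simp add: proj_def coef_cmult sum_distrib_left mult.assoc)

lemma avg_mult_cnj_proj:
  assumes "bounded_fun f"
  shows "avg (\<lambda>\<theta>. f \<theta> * cnj (proj n g \<theta>)) = (\<Sum>l<n. coef f (int l) * cnj (coef g (int l)))"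
proof -
  have "avg (\<lambda>\<theta>. f \<theta> * cnj (proj n g \<theta>)) = avg (\<lambda>\<theta>. \<Sum>l<n. cnj (coef g (int l)) * (f \<theta> * cnj (chr (int l) \<theta>)))"
    by (simp add: proj_def sum_distrib_left algebra_simps)
  also have "\<dots> = (\<Sum>l<n. cnj (coef g (int l)) * coef f (int l))"
    by (subst avg_sum) (use assms in \<open>auto simp: avg_cmult coef_def intro!: bounded_fun_mult bounded_fun_cnj\<close>)
  finally show ?thesis by (simp add: mult.commute)
qed

lemma sqn_proj: "sqn (proj n f) = (\<Sum>l<n. (cmod (coef f (int l)))\<^sup>2)"
proof -
  have "complex_of_real (sqn (proj n f)) = (\<Sum>l<n. coef f (int l) * cnj (coef f (int l)))"
    unfolding sqn_avg by (subst avg_mult_cnj_proj) (auto simp: coef_proj)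
  also have "\<dots> = complex_of_real (\<Sum>l<n. (cmod (coef f (int l)))\<^sup>2)"
    by (simp only: complex_norm_square of_real_sum)
  finally show ?thesis using of_real_eq_iff by blast
qed

text \<open>Pythagoras: both mixed averages equal \<open>sqn (proj n f)\<close>. It makes
  \<open>proj n\<close> and its complement contractions.\<close>

lemma sqn_diff_proj:
  assumes f: "bounded_fun f" shows "sqn (\<lambda>\<theta>. f \<theta> - proj n f \<theta>) = sqn f - sqn (proj n f)"
proof -
  have bc: "bounded_fun (proj n f)" by auto
  have 1: "avg (\<lambda>\<theta>. f \<theta> * cnj (proj n f \<theta>)) = complex_of_real (sqn (proj n f))"
    using f by (simp only: avg_mult_cnj_proj sqn_proj complex_norm_square of_real_sum)
  have 2: "avg (\<lambda>\<theta>. proj n f \<theta> * cnj (f \<theta>)) = complex_of_real (sqn (proj n f))"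
    using avg_cnj[of "\<lambda>\<theta>. f \<theta> * cnj (proj n f \<theta>)"] 1 by (simp add: mult.commute)
  have "complex_of_real (sqn (\<lambda>\<theta>. f \<theta> - proj n f \<theta>)) =
    avg (\<lambda>\<theta>. f \<theta> * cnj (f \<theta>) - f \<theta> * cnj (proj n f \<theta>) - (proj n f \<theta> * cnj (f \<theta>) - proj n f \<theta> * cnj (proj n f \<theta>)))"
    unfolding sqn_avg by (simp add: algebra_simps)
  also have "\<dots> = avg (\<lambda>\<theta>. f \<theta> * cnj (f \<theta>)) - avg (\<lambda>\<theta>. f \<theta> * cnj (proj n f \<theta>)) - (avg (\<lambda>\<theta>. proj n f \<theta> * cnj (f \<theta>)) - avg (\<lambda>\<theta>. proj n f \<theta> * cnj (proj n f \<theta>)))"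
    using f bc by (simp add: avg_diff bounded_fun_mult bounded_fun_cnj bounded_fun_diff)
  also have "\<dots> = complex_of_real (sqn f - sqn (proj n f))"
    unfolding 1 2 sqn_avg[symmetric] by simp
  finally show ?thesis using of_real_eq_iff by blast
qed

lemma sqn_proj_le: "bounded_fun f \<Longrightarrow> sqn (proj n f) \<le> sqn f"
  using sqn_diff_proj[of f n] sqn_nonneg[of "\<lambda>\<theta>. f \<theta> - proj n f \<theta>"] by linarith

lemma sqn_diff_proj_le: "bounded_fun f \<Longrightarrow> sqn (\<lambda>\<theta>. f \<theta> - proj n f \<theta>) \<le> sqn f"
  using sqn_diff_proj[of f n] sqn_nonneg[of "proj n f"] by linarith

text \<open>Bessel for a single frequency: multiplication by \<open>chr (- l)\<close> moves
  frequency \<open>l\<close> to 0, the only one that \<open>proj 1\<close> keeps.\<close>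

lemma coef_sq_le: assumes "bounded_fun f" shows "(cmod (coef f l))\<^sup>2 \<le> sqn f"
proof -
  let ?g = "\<lambda>\<theta>. f \<theta> * chr (- l) \<theta>"
  have "sqn (proj 1 ?g) \<le> sqn ?g" using assms by (intro sqn_proj_le bounded_fun_mult) auto
  then show ?thesis by (simp add: sqn_proj coef_shift sqn_chr_mult)
qed

section \<open>Density of the trigonometric polynomials in mean square\<close>

inductive trig_poly :: "(real \<Rightarrow> complex) \<Rightarrow> bool" where
  trig_poly_chr: "trig_poly (chr l)"
| trig_poly_cmult: "trig_poly f \<Longrightarrow> trig_poly (\<lambda>\<theta>. c * f \<theta>)"
| trig_poly_add: "trig_poly f \<Longrightarrow> trig_poly g \<Longrightarrow> trig_poly (\<lambda>\<theta>. f \<theta> + g \<theta>)"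

lemma trig_poly_continuous: "trig_poly f \<Longrightarrow> continuous_on S f"
  by (induction rule: trig_poly.induct) (auto intro!: continuous_intros chr_continuous)

lemma trig_poly_bounded: "trig_poly f \<Longrightarrow> bounded_fun f"
  by (rule bounded_fun_continuous[OF trig_poly_continuous])

lemma trig_poly_chr_mult: "trig_poly f \<Longrightarrow> trig_poly (\<lambda>\<theta>. chr l \<theta> * f \<theta>)"
proof (induction rule: trig_poly.induct)
  case (trig_poly_chr m) then show ?case using trig_poly.trig_poly_chr[of "l + m"] by (simp add: chr_mult)
next
  case (trig_poly_cmult f c) then show ?case
    using trig_poly.trig_poly_cmult[of _ c] by (fastforce simp: mult.left_commute)
next
  case (trig_poly_add f g) then show ?case using trig_poly.trig_poly_add by (simp add: distrib_left)
qed

lemma trig_poly_mult: "trig_poly f \<Longrightarrow> trig_poly g \<Longrightarrow> trig_poly (\<lambda>\<theta>. f \<theta> * g \<theta>)"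
proof (induction arbitrary: g rule: trig_poly.induct)
  case (trig_poly_chr m) then show ?case by (rule trig_poly_chr_mult)
next
  case (trig_poly_cmult f c) then show ?case
    using trig_poly.trig_poly_cmult[of "\<lambda>\<theta>. f \<theta> * g \<theta>" c] by (simp add: mult.assoc)
next
  case (trig_poly_add f h) then show ?case using trig_poly.trig_poly_add by (simp add: distrib_right)
qed

lemma trig_poly_const: "trig_poly (\<lambda>\<theta>. c)"
  using trig_poly_cmult[OF trig_poly_chr[of 0], of c] by (simp add: chr_0)

text \<open>On the circle a linear functional of the plane is a combination of cosine and sine,
  hence of \<open>chr 1\<close> and \<open>chr (-1)\<close>. This turns Stone-Weierstrass on the
  unit circle into approximation by \<open>trig_poly\<close>.\<close>

lemma real_polynomial_function_cis_trig_poly: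
  assumes "real_polynomial_function p"
  shows "trig_poly (\<lambda>\<theta>. complex_of_real (p (cis \<theta>)))"
  using assms
proof (induction rule: real_polynomial_function.induct)
  case (linear f)
  have "complex_of_real (f (cis \<theta>)) = (complex_of_real (f 1) - \<i> * f \<i>) / 2 * chr 1 \<theta> + (complex_of_real (f 1) + \<i> * f \<i>) / 2 * chr (-1) \<theta>" for \<theta>
  proof -
    have "cis \<theta> = cos \<theta> *\<^sub>R 1 + sin \<theta> *\<^sub>R \<i>" by (simp add: complex_eq_iff)
    then have "f (cis \<theta>) = cos \<theta> * f 1 + sin \<theta> * f \<i>"
      using linear by (simp add: linear_add linear_scale bounded_linear.linear del: scaleR_complex.ctr)
    then show ?thesis by (simp add: chr_def complex_eq_iff field_simps)
  qed
  then show ?case by (simp only:) (intro trig_poly_add trig_poly_cmult trig_poly_chr)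
next
  case (const c) then show ?case by (rule trig_poly_const)
qed (auto intro: trig_poly_add trig_poly_mult)

lemma trig_poly_dense_real:
  fixes g :: "real \<Rightarrow> real"
  assumes g: "continuous_on {-pi..pi} g" and per: "g (-pi) = g pi" and "e > 0"
  obtains p where "trig_poly p" "\<And>\<theta>. \<theta> \<in> {-pi..pi} \<Longrightarrow> cmod (complex_of_real (g \<theta>) - p \<theta>) < e"
proof -
  define S where "S = cis ` {-pi..pi}"
  have S: "compact S" unfolding S_def by (intro compact_continuous_image continuous_intros) auto
  define h where "h = (\<lambda>z. g (Arg z))"
  have h: "h (cis \<theta>) = g \<theta>" if "\<theta> \<in> {-pi..pi}" for \<theta>
  proof (cases "\<theta> = -pi")
    case True
    \<comment> \<open>\<open>Arg\<close> takes the value \<open>pi\<close> at -1, so the left end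
      point is reached only through \<open>per\<close>.\<close>
    have "cis (-pi) = -1" by (simp add: complex_eq_iff)
    moreover have "Arg (-1) = pi" by (rule Arg_unique[of 1]) (auto simp: exp_pi_i')
    ultimately show ?thesis using True per by (simp add: h_def)
  next
    case False
    then have "Arg (cis \<theta>) = \<theta>" using that by (intro Arg_unique[of 1]) (auto simp: cis_conv_exp)
    then show ?thesis by (simp add: h_def)
  qed
  \<comment> \<open>\<open>Arg\<close> jumps at -1, so \<open>h\<close> is not a composition of
    continuous maps. Instead, preimages of closed sets are images under \<open>cis\<close> of
    compact sets, hence closed.\<close>
  have "continuous_on S h"
    unfolding continuous_on_closed_vimage[OF compact_imp_closed[OF S]]
  proof (intro allI impI)
    fix B :: "real set" assume "closed B"
    then have "closed (g -` B \<inter> {-pi..pi})" using g continuous_on_closed_vimage[of "{-pi..pi}" g] by auto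
    then have "compact (g -` B \<inter> {-pi..pi})" by (simp add: compact_eq_bounded_closed bounded_Int)
    then have "compact (cis ` (g -` B \<inter> {-pi..pi}))" by (intro compact_continuous_image continuous_intros)
    moreover have "h -` B \<inter> S = cis ` (g -` B \<inter> {-pi..pi})" unfolding S_def using h by auto
    ultimately show "closed (h -` B \<inter> S)" by (simp add: compact_imp_closed)
  qed
  from Stone_Weierstrass_real_polynomial_function[OF S this \<open>e > 0\<close>]
  obtain q where q: "real_polynomial_function q" "\<And>z. z \<in> S \<Longrightarrow> \<bar>h z - q z\<bar> < e" by blast
  show ?thesis
  proof (rule that[OF real_polynomial_function_cis_trig_poly[OF q(1)]])
    fix \<theta> :: real assume "\<theta> \<in> {-pi..pi}"
    then show "cmod (complex_of_real (g \<theta>) - complex_of_real (q (cis \<theta>))) < e"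
      using q(2)[of "cis \<theta>"] h[of \<theta>] by (simp add: S_def flip: of_real_diff)
  qed
qed

lemma trig_poly_dense_complex:
  fixes g :: "real \<Rightarrow> complex"
  assumes g: "continuous_on {-pi..pi} g" and per: "g (-pi) = g pi" and "e > 0"
  obtains p where "trig_poly p" "\<And>\<theta>. \<theta> \<in> {-pi..pi} \<Longrightarrow> cmod (g \<theta> - p \<theta>) < e"
proof -
  obtain p where p: "trig_poly p" "\<And>\<theta>. \<theta> \<in> {-pi..pi} \<Longrightarrow> cmod (complex_of_real (Re (g \<theta>)) - p \<theta>) < e / 2"
    using trig_poly_dense_real[of "\<lambda>\<theta>. Re (g \<theta>)" "e / 2"] g per \<open>e > 0\<close> by (auto intro: continuous_intros)
  obtain q where q: "trig_poly q" "\<And>\<theta>. \<theta> \<in> {-pi..pi} \<Longrightarrow> cmod (complex_of_real (Im (g \<theta>)) - q \<theta>) < e / 2"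
    using trig_poly_dense_real[of "\<lambda>\<theta>. Im (g \<theta>)" "e / 2"] g per \<open>e > 0\<close> by (auto intro: continuous_intros)
  show ?thesis
  proof (rule that[OF trig_poly_add[OF p(1) trig_poly_cmult[OF q(1)]]])
    fix \<theta> assume t: "\<theta> \<in> {-pi..pi}"
    have "g \<theta> - (p \<theta> + \<i> * q \<theta>) = (complex_of_real (Re (g \<theta>)) - p \<theta>) + \<i> * (complex_of_real (Im (g \<theta>)) - q \<theta>)"
      by (simp add: complex_eq_iff)
    then have "cmod (g \<theta> - (p \<theta> + \<i> * q \<theta>)) \<le> cmod (complex_of_real (Re (g \<theta>)) - p \<theta>) + cmod (complex_of_real (Im (g \<theta>)) - q \<theta>)"
      by (metis norm_triangle_ineq norm_mult norm_ii mult_1)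
    then show "cmod (g \<theta> - (p \<theta> + \<i> * q \<theta>)) < e" using p(2)[OF t] q(2)[OF t] by simp
  qed
qed

lemma sqn_tendsto_0:
  assumes "\<And>m. bounded_fun (f m)" "\<And>m. AE \<theta> in circle_measure. cmod (f m \<theta>) \<le> C"
    and "AE \<theta> in circle_measure. (\<lambda>m. f m \<theta>) \<longlonglongrightarrow> 0"
  shows "(\<lambda>m. sqn (f m)) \<longlonglongrightarrow> 0"
proof -
  have "(\<lambda>m. LINT \<theta>|circle_measure. (cmod (f m \<theta>))\<^sup>2) \<longlonglongrightarrow> (LINT \<theta>|circle_measure. 0)"
  proof (rule integral_dominated_convergence[where w = "\<lambda>_. C\<^sup>2"])
    show "AE \<theta> in circle_measure. (\<lambda>m. (cmod (f m \<theta>))\<^sup>2) \<longlonglongrightarrow> 0"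
      using assms(3) by eventually_elim (auto intro!: tendsto_eq_intros)
    show "AE \<theta> in circle_measure. norm ((cmod (f m \<theta>))\<^sup>2) \<le> C\<^sup>2" for m
      using assms(2)[of m] by eventually_elim (auto intro!: power_mono)
    show "integrable circle_measure (\<lambda>_. C\<^sup>2)" using circle_finite_measure by (simp add: finite_measure.integrable_const)
    show "(\<lambda>\<theta>. (cmod (f m \<theta>))\<^sup>2) \<in> borel_measurable circle_measure" for m
      using bounded_fun_cmod_sq[OF assms(1)] by blast
  qed auto
  then show ?thesis using tendsto_mult_left[of _ 0 sequentially "1 / (2 * pi)"] by (simp add: sqn_def)
qed

lemma circle_AE_negligible:
  assumes "negligible N" shows "AE \<theta> in circle_measure. \<theta> \<notin> N"
proof -
  have "AE \<theta> in lebesgue. \<theta> \<notin> N" using assms by (simp add: negligible_iff_null_sets AE_not_in)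
  then show ?thesis by (subst AE_restrict_space_iff) (auto elim: eventually_mono)
qed

lemma continuous_dense:
  assumes "bounded_fun f" "e > 0"
  obtains g where "continuous_on {-pi..pi} g" "g (-pi) = g pi" "bounded_fun g" "sqn (\<lambda>\<theta>. f \<theta> - g \<theta>) < e"
proof -
  obtain C where C: "C > 0" "AE \<theta> in circle_measure. cmod (f \<theta>) \<le> C" "f \<in> borel_measurable circle_measure"
    using assms(1) by (rule bounded_funE)
  then have "f measurable_on {-pi..pi}" by (simp add: measurable_on_iff_borel_measurable)
  then obtain N g where N: "negligible N" and g: "\<And>n. continuous_on UNIV (g n)"
    and lim: "\<And>x. x \<notin> N \<Longrightarrow> (\<lambda>n. g n x) \<longlonglongrightarrow> (if x \<in> {-pi..pi} then f x else 0)"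
    unfolding measurable_on_def by blast
  \<comment> \<open>Radial retraction onto the disc of radius \<open>C\<close>. It fixes almost all
    values of \<open>f\<close> and gives the approximants the common bound that dominated
    convergence needs.\<close>
  define cl where "cl = (\<lambda>z::complex. of_real (C / max C (cmod z)) * z)"
  \<comment> \<open>The last factor is 0 at both end points, which forces periodicity, and 1 from
    some \<open>n\<close> on at every interior point, so it does not disturb the limit.\<close>
  define h where "h = (\<lambda>n \<theta>. cl (g n \<theta>) * of_real (max 0 (min 1 (real n * (pi - \<bar>\<theta>\<bar>)))))"
  have clc: "continuous_on UNIV cl"
    unfolding cl_def using C(1) by (auto intro!: continuous_intros)
  have cl_le: "cmod (cl z) \<le> C" for z
    using C(1) by (cases "cmod z \<le> C") (auto simp: cl_def norm_mult norm_divide max_def field_simps)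
  have h_c: "continuous_on UNIV (h n)" for n
    unfolding h_def by (intro continuous_intros continuous_on_compose2[OF clc g]) auto
  have h_le: "cmod (h n \<theta>) \<le> C" for n \<theta>
  proof -
    have "cmod (h n \<theta>) \<le> cmod (cl (g n \<theta>)) * 1"
      unfolding h_def norm_mult by (intro mult_left_mono) auto
    then show ?thesis using cl_le[of "g n \<theta>"] by simp
  qed
  have h_per: "h n (-pi) = h n pi" for n by (simp add: h_def)
  have "(\<lambda>n. sqn (\<lambda>\<theta>. f \<theta> - h n \<theta>)) \<longlonglongrightarrow> 0"
  proof (rule sqn_tendsto_0[where C = "2 * C"])
    show "bounded_fun (\<lambda>\<theta>. f \<theta> - h n \<theta>)" for n
      using assms(1) bounded_fun_continuous[OF h_c] by auto
    show "AE \<theta> in circle_measure. cmod (f \<theta> - h n \<theta>) \<le> 2 * C" for n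
      using C(2) by eventually_elim (smt (verit) h_le norm_triangle_ineq4)
    have "negligible (N \<union> {-pi, pi})" using N by simp
    from circle_AE_negligible[OF this] have 1: "AE \<theta> in circle_measure. \<theta> \<notin> N \<union> {-pi, pi}" .
    have 2: "AE \<theta> in circle_measure. \<theta> \<in> {-pi..pi}" by (rule AE_I2) simp
    show "AE \<theta> in circle_measure. (\<lambda>n. f \<theta> - h n \<theta>) \<longlonglongrightarrow> 0"
      using 1 2 C(2)
    proof eventually_elim
      case (elim \<theta>)
      have 1: "(\<lambda>n. g n \<theta>) \<longlonglongrightarrow> f \<theta>" using lim[of \<theta>] elim by auto
      have "cl (f \<theta>) = f \<theta>" using elim C(1) by (simp add: cl_def)
      then have 2: "(\<lambda>n. cl (g n \<theta>)) \<longlonglongrightarrow> f \<theta>"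
        using continuous_on_tendsto_compose[OF clc 1] by simp
      have pos: "pi - \<bar>\<theta>\<bar> > 0" using elim by auto
      then obtain n0 where n0: "real n0 * (pi - \<bar>\<theta>\<bar>) > 1" using reals_Archimedean3 by blast
      have "eventually (\<lambda>n. complex_of_real (max 0 (min 1 (real n * (pi - \<bar>\<theta>\<bar>)))) = 1) sequentially"
        using eventually_ge_at_top[of n0]
      proof eventually_elim
        case (elim n)
        have "real n * (pi - \<bar>\<theta>\<bar>) \<ge> real n0 * (pi - \<bar>\<theta>\<bar>)" using elim pos by (intro mult_right_mono) auto
        then show ?case using n0 by simp
      qed
      then have 3: "(\<lambda>n. complex_of_real (max 0 (min 1 (real n * (pi - \<bar>\<theta>\<bar>))))) \<longlonglongrightarrow> 1"
        by (rule tendsto_eventually)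
      have "(\<lambda>n. h n \<theta>) \<longlonglongrightarrow> f \<theta> * 1" unfolding h_def by (intro tendsto_mult 2 3)
      then show ?case using tendsto_diff[OF tendsto_const, of "\<lambda>n. h n \<theta>" "f \<theta>" sequentially "f \<theta>"] by simp
    qed
  qed
  then have "eventually (\<lambda>n. sqn (\<lambda>\<theta>. f \<theta> - h n \<theta>) < e) sequentially"
    using \<open>e > 0\<close> by (rule order_tendstoD)
  then obtain n where n: "sqn (\<lambda>\<theta>. f \<theta> - h n \<theta>) < e" by (meson eventually_sequentially order_refl)
  show ?thesis
    by (rule that[of "h n"]) (use n h_per continuous_on_subset[OF h_c] bounded_fun_continuous[OF h_c] in auto)
qed

theorem trig_poly_dense:
  assumes "bounded_fun f" "e > 0"
  obtains p where "trig_poly p" "sqn (\<lambda>\<theta>. f \<theta> - p \<theta>) < e"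
proof -
  obtain g where g: "continuous_on {-pi..pi} g" "g (-pi) = g pi" "bounded_fun g" "sqn (\<lambda>\<theta>. f \<theta> - g \<theta>) < e / 4"
    using continuous_dense[OF assms(1), of "e / 4"] assms(2) by auto
  \<comment> \<open>A uniform error \<open>d\<close> costs \<open>e / 8\<close> in
    \<open>sqn\<close>; \<open>sqn_add\<close> then gives at most
    \<open>2 * (e / 4) + 2 * (e / 8) < e\<close>.\<close>
  define d where "d = sqrt (e / 8)"
  have d: "d > 0" "d\<^sup>2 = e / 8" using assms(2) by (auto simp: d_def)
  obtain p where p: "trig_poly p" "\<And>\<theta>. \<theta> \<in> {-pi..pi} \<Longrightarrow> cmod (g \<theta> - p \<theta>) < d"
    using trig_poly_dense_complex[OF g(1,2) d(1)] by blast
  have bp: "bounded_fun p" using p(1) by (rule trig_poly_bounded)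
  have "sqn (\<lambda>\<theta>. g \<theta> - p \<theta>) \<le> (1 / (2 * pi)) * (LINT \<theta>|circle_measure. d\<^sup>2)"
  proof (rule sqn_mono)
    show "AE \<theta> in circle_measure. (cmod (g \<theta> - p \<theta>))\<^sup>2 \<le> d\<^sup>2"
      by (rule AE_I2, rule power_mono, rule less_imp_le, rule p(2)) auto
  qed (use g bp circle_finite_measure in \<open>auto simp: finite_measure.integrable_const\<close>)
  also have "\<dots> = e / 8" using circle_measure_total d by simp
  finally have "sqn (\<lambda>\<theta>. g \<theta> - p \<theta>) \<le> e / 8" .
  then have "sqn (\<lambda>\<theta>. (f \<theta> - g \<theta>) + (g \<theta> - p \<theta>)) < e"
    using sqn_add[of "\<lambda>\<theta>. f \<theta> - g \<theta>" "\<lambda>\<theta>. g \<theta> - p \<theta>"] g bp assms by fastforce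
  then show ?thesis using that[OF p(1)] by simp
qed

text \<open>The mean, over the columns \<open>i < n\<close>, of what \<open>s * chr i\<close> loses
  outside the window 0, ..., n - 1. Columns near the ends may lose a fixed amount for every
  \<open>n\<close>; only the mean tends to 0.\<close>

definition mean_defect :: "(real \<Rightarrow> complex) \<Rightarrow> nat \<Rightarrow> real" where
  "mean_defect s n = (\<Sum>i<n. sqn (\<lambda>\<theta>. s \<theta> * chr (int i) \<theta> - proj n (\<lambda>\<theta>. s \<theta> * chr (int i) \<theta>) \<theta>)) / real n"

lemma mean_defect_nonneg: "mean_defect s n \<ge> 0"
  unfolding mean_defect_def by (intro divide_nonneg_nonneg sum_nonneg) auto

lemma mean_defect_le: assumes "bounded_fun s" shows "mean_defect s n \<le> sqn s"
proof (cases "n = 0")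
  case False
  have "(\<Sum>i<n. sqn (\<lambda>\<theta>. s \<theta> * chr (int i) \<theta> - proj n (\<lambda>\<theta>. s \<theta> * chr (int i) \<theta>) \<theta>)) \<le> (\<Sum>i<n. sqn s)"
  proof (rule sum_mono)
    fix i
    have "bounded_fun (\<lambda>\<theta>. s \<theta> * chr (int i) \<theta>)" using assms by auto
    from sqn_diff_proj_le[OF this]
    show "sqn (\<lambda>\<theta>. s \<theta> * chr (int i) \<theta> - proj n (\<lambda>\<theta>. s \<theta> * chr (int i) \<theta>) \<theta>) \<le> sqn s" by (simp add: sqn_chr_mult)
  qed
  then show ?thesis using False by (simp add: mean_defect_def field_simps)
qed (simp add: mean_defect_def)

lemma mean_defect_add:
  assumes "bounded_fun s" "bounded_fun t"
  shows "mean_defect (\<lambda>\<theta>. s \<theta> + t \<theta>) n \<le> 2 * mean_defect s n + 2 * mean_defect t n"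
proof -
  have "sqn (\<lambda>\<theta>. (s \<theta> + t \<theta>) * chr (int i) \<theta> - proj n (\<lambda>\<theta>. (s \<theta> + t \<theta>) * chr (int i) \<theta>) \<theta>)
    \<le> 2 * sqn (\<lambda>\<theta>. s \<theta> * chr (int i) \<theta> - proj n (\<lambda>\<theta>. s \<theta> * chr (int i) \<theta>) \<theta>)
      + 2 * sqn (\<lambda>\<theta>. t \<theta> * chr (int i) \<theta> - proj n (\<lambda>\<theta>. t \<theta> * chr (int i) \<theta>) \<theta>)" for i
  proof -
    let ?s = "\<lambda>\<theta>. s \<theta> * chr (int i) \<theta>" and ?t = "\<lambda>\<theta>. t \<theta> * chr (int i) \<theta>"
    have b: "bounded_fun ?s" "bounded_fun ?t" using assms by auto
    have "(\<lambda>\<theta>. (s \<theta> + t \<theta>) * chr (int i) \<theta> - proj n (\<lambda>\<theta>. (s \<theta> + t \<theta>) * chr (int i) \<theta>) \<theta>)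
      = (\<lambda>\<theta>. (?s \<theta> - proj n ?s \<theta>) + (?t \<theta> - proj n ?t \<theta>))"
      using b by (simp add: distrib_right proj_add algebra_simps)
    then show ?thesis
      using sqn_add[of "\<lambda>\<theta>. ?s \<theta> - proj n ?s \<theta>" "\<lambda>\<theta>. ?t \<theta> - proj n ?t \<theta>"]
        bounded_fun_diff[OF b(1) bounded_fun_proj] bounded_fun_diff[OF b(2) bounded_fun_proj] by simp
  qed
  then have "(\<Sum>i<n. sqn (\<lambda>\<theta>. (s \<theta> + t \<theta>) * chr (int i) \<theta> - proj n (\<lambda>\<theta>. (s \<theta> + t \<theta>) * chr (int i) \<theta>) \<theta>))
    \<le> (\<Sum>i<n. 2 * sqn (\<lambda>\<theta>. s \<theta> * chr (int i) \<theta> - proj n (\<lambda>\<theta>. s \<theta> * chr (int i) \<theta>) \<theta>)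
      + 2 * sqn (\<lambda>\<theta>. t \<theta> * chr (int i) \<theta> - proj n (\<lambda>\<theta>. t \<theta> * chr (int i) \<theta>) \<theta>))"
    by (rule sum_mono)
  then show ?thesis
    unfolding mean_defect_def by (simp add: sum.distrib sum_distrib_left[symmetric] divide_right_mono add_divide_distrib[symmetric])
qed

lemma mean_defect_cmult: "mean_defect (\<lambda>\<theta>. c * s \<theta>) n = (cmod c)\<^sup>2 * mean_defect s n"
proof -
  have "(\<lambda>\<theta>. c * s \<theta> * chr (int i) \<theta> - proj n (\<lambda>\<theta>. c * s \<theta> * chr (int i) \<theta>) \<theta>)
    = (\<lambda>\<theta>. c * (s \<theta> * chr (int i) \<theta> - proj n (\<lambda>\<theta>. s \<theta> * chr (int i) \<theta>) \<theta>))" for i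
    by (simp add: mult.assoc proj_cmult right_diff_distrib)
  then show ?thesis by (simp add: mean_defect_def sqn_cmult sum_distrib_left[symmetric])
qed

text \<open>Multiplication by \<open>chr m\<close> is a shift: each column is kept or lost
  completely, and at most \<open>|m|\<close> of them leave the window, at its upper end for
  \<open>m \<ge> 0\<close> and at its lower end otherwise.\<close>

lemma mean_defect_chr: "mean_defect (chr m) n \<le> real_of_int \<bar>m\<bar> / real n"
proof -
  have "sqn (\<lambda>\<theta>. chr m \<theta> * chr (int i) \<theta> - proj n (\<lambda>\<theta>. chr m \<theta> * chr (int i) \<theta>) \<theta>)
    = (if m + int i \<in> {0..<int n} then 0 else 1)" for i
  proof -
    have "sqn (chr (m + int i)) = 1" using circle_measure_total by (simp add: sqn_def)
    moreover have "sqn (proj n (chr (m + int i))) = (\<Sum>l<n. if l = nat (m + int i) \<and> 0 \<le> m + int i then 1 else 0)"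
      unfolding sqn_proj by (rule sum.cong) (auto simp: coef_chr)
    moreover have "\<dots> = (if m + int i \<in> {0..<int n} then 1 else 0)"
      by (cases "0 \<le> m + int i") (auto simp: nat_less_iff)
    ultimately show ?thesis by (simp add: chr_mult sqn_diff_proj)
  qed
  then have "(\<Sum>i<n. sqn (\<lambda>\<theta>. chr m \<theta> * chr (int i) \<theta> - proj n (\<lambda>\<theta>. chr m \<theta> * chr (int i) \<theta>) \<theta>))
    = (\<Sum>i<n. if m + int i \<in> {0..<int n} then 0 else 1)" by simp
  also have "\<dots> = real (card {i. i < n \<and> m + int i \<notin> {0..<int n}})"
    by (simp add: sum.If_cases Int_def lessThan_def Compl_eq)
  also have "\<dots> \<le> real_of_int \<bar>m\<bar>"
  proof -
    have "{i. i < n \<and> m + int i \<notin> {0..<int n}} \<subseteq> (if m \<ge> 0 then {n - nat m..<n} else {..<nat (-m)})" by auto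
    then have "card {i. i < n \<and> m + int i \<notin> {0..<int n}} \<le> card (if m \<ge> 0 then {n - nat m..<n} else {..<nat (-m)})"
      by (intro card_mono) auto
    also have "\<dots> \<le> nat \<bar>m\<bar>" by auto
    finally show ?thesis by linarith
  qed
  finally show ?thesis by (simp add: mean_defect_def divide_right_mono)
qed

lemma mean_defect_trig_poly: "trig_poly p \<Longrightarrow> mean_defect p \<longlonglongrightarrow> 0"
proof (induction rule: trig_poly.induct)
  case (trig_poly_chr l)
  have "(\<lambda>n. real_of_int \<bar>l\<bar> / real n) \<longlonglongrightarrow> 0" by (rule lim_const_over_n)
  then show ?case by (rule tendsto_sandwich[rotated 3]) (auto simp: mean_defect_nonneg mean_defect_chr simp del: of_int_abs)
next
  case (trig_poly_cmult f c)
  then show ?case using tendsto_mult_left[of _ 0] by (force simp: mean_defect_cmult[abs_def])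
next
  case (trig_poly_add f g)
  then have "(\<lambda>n. 2 * mean_defect f n + 2 * mean_defect g n) \<longlonglongrightarrow> 0"
    by (auto intro!: tendsto_eq_intros)
  from trig_poly_add.hyps show ?case
    by (intro tendsto_sandwich[OF _ _ tendsto_const \<open>(\<lambda>n. 2 * mean_defect f n + 2 * mean_defect g n) \<longlonglongrightarrow> 0\<close>])
      (auto simp: mean_defect_nonneg mean_defect_add trig_poly_bounded)
qed

text \<open>\<open>mean_defect_le\<close> bounds the defect by \<open>sqn\<close> uniformly in
  \<open>n\<close>, so mean square density carries the limit from trigonometric polynomials to all
  bounded measurable functions.\<close>

theorem mean_defect_tendsto_0:
  assumes "bounded_fun s" shows "mean_defect s \<longlonglongrightarrow> 0"
proof (rule LIMSEQ_I)
  fix e :: real assume "e > 0"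
  then obtain p where p: "trig_poly p" "sqn (\<lambda>\<theta>. s \<theta> - p \<theta>) < e / 4"
    using trig_poly_dense[OF assms, of "e / 4"] by auto
  have bp: "bounded_fun p" using p(1) by (rule trig_poly_bounded)
  from mean_defect_trig_poly[OF p(1)] \<open>e > 0\<close> obtain n0 where n0: "\<And>n. n \<ge> n0 \<Longrightarrow> mean_defect p n < e / 4"
    by (metis order_tendstoD(2) eventually_sequentially zero_less_divide_iff zero_less_numeral)
  have "norm (mean_defect s n - 0) < e" if "n \<ge> n0" for n
  proof -
    have "mean_defect (\<lambda>\<theta>. (s \<theta> - p \<theta>) + p \<theta>) n \<le> 2 * mean_defect (\<lambda>\<theta>. s \<theta> - p \<theta>) n + 2 * mean_defect p n"
      using assms bp by (intro mean_defect_add) auto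
    moreover have "mean_defect (\<lambda>\<theta>. s \<theta> - p \<theta>) n < e / 4"
      using mean_defect_le[OF bounded_fun_diff[OF assms bp], of n] p(2) by linarith
    ultimately show ?thesis using n0[OF that] mean_defect_nonneg[of s n] by simp
  qed
  then show "\<exists>no. \<forall>n\<ge>no. norm (mean_defect s n - 0) < e" by blast
qed

section \<open>Traces of powers of block Toeplitz matrices\<close>

text \<open>Powers of index functions instead of \<open>mat\<close>: no carrier conditions arise,
  and entries may depend on \<open>\<theta>\<close>.\<close>

primrec mpow :: "nat \<Rightarrow> (nat \<Rightarrow> nat \<Rightarrow> 'a::comm_ring_1) \<Rightarrow> nat \<Rightarrow> nat \<Rightarrow> nat \<Rightarrow> 'a" where
  "mpow N X 0 = (\<lambda>a b. if a = b then 1 else 0)"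
| "mpow N X (Suc q) = (\<lambda>a b. \<Sum>c<N. X a c * mpow N X q c b)"

lemma sum_blocks:
  fixes f :: "nat \<Rightarrow> 'a::comm_monoid_add"
  shows "(\<Sum>r<n * N. f r) = (\<Sum>i<n. \<Sum>a<N. f (i * N + a))"
proof -
  have "(\<Sum>r<n * N. f r) = (\<Sum>i<n. sum f {i * N..<i * N + N})" by (rule sum.nat_group[symmetric])
  also have "\<dots> = (\<Sum>i<n. \<Sum>a<N. f (i * N + a))"
  proof (rule sum.cong[OF refl])
    fix i
    show "sum f {i * N..<i * N + N} = (\<Sum>a<N. f (i * N + a))"
      by (rule sum.reindex_bij_witness[where i = "\<lambda>a. i * N + a" and j = "\<lambda>r. r - i * N"]) auto
  qed
  finally show ?thesis .
qed

lemma bounded_fun_mpow: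
  assumes "\<And>a b. a < N \<Longrightarrow> b < N \<Longrightarrow> bounded_fun (F a b)" "a < N"
  shows "bounded_fun (\<lambda>\<theta>. mpow N (\<lambda>a b. F a b \<theta>) q a b)"
  using assms(2)
proof (induction q arbitrary: a)
  case 0 show ?case by simp
next
  case (Suc q) then show ?case using assms(1) by (auto intro!: bounded_fun_sum bounded_fun_mult)
qed

text \<open>There is no size parameter: the truncation of order \<open>n\<close> is the corner of
  size \<open>n * N\<close>, so one function serves all \<open>n\<close>.\<close>

definition block_toeplitz :: "nat \<Rightarrow> (nat \<Rightarrow> nat \<Rightarrow> real \<Rightarrow> complex) \<Rightarrow> nat \<Rightarrow> nat \<Rightarrow> complex" where
  "block_toeplitz N F r s = coef (F (r mod N) (s mod N)) (int (r div N) - int (s div N))"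

lemma block_toeplitz_index:
  "a < N \<Longrightarrow> b < N \<Longrightarrow> block_toeplitz N F (i * N + a) (j * N + b) = coef (F a b) (int i - int j)"
  by (simp add: block_toeplitz_def)

text \<open>The column of the \<open>q\<close>-th power of the truncation that belongs to \<open>chr i\<close> in component \<open>b\<close>,
  written as a vector of trigonometric polynomials.\<close>

primrec toeplitz_column :: "nat \<Rightarrow> (nat \<Rightarrow> nat \<Rightarrow> real \<Rightarrow> complex) \<Rightarrow> nat \<Rightarrow> nat \<Rightarrow> nat \<Rightarrow> nat \<Rightarrow> nat \<Rightarrow> real \<Rightarrow> complex" where
  "toeplitz_column N F n i b 0 = (\<lambda>a. if a = b then chr (int i) else (\<lambda>\<theta>. 0))"
| "toeplitz_column N F n i b (Suc q) = (\<lambda>a. proj n (\<lambda>\<theta>. \<Sum>c<N. F a c \<theta> * toeplitz_column N F n i b q c \<theta>))"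

lemma coef_0: "coef (\<lambda>\<theta>. 0) l = 0"
  by (simp add: coef_def avg_const)

lemma bounded_fun_toeplitz_column: "bounded_fun (toeplitz_column N F n i b q a)"
  by (cases q) auto

lemma proj_proj: "proj n (proj n f) = proj n f"
proof
  fix \<theta>
  have "proj n (proj n f) \<theta> = (\<Sum>l<n. coef (proj n f) (int l) * chr (int l) \<theta>)" by (rule proj_def)
  also have "\<dots> = (\<Sum>l<n. coef f (int l) * chr (int l) \<theta>)" by (rule sum.cong) (auto simp: coef_proj)
  also have "\<dots> = proj n f \<theta>" by (rule proj_def[symmetric])
  finally show "proj n (proj n f) \<theta> = proj n f \<theta>" .
qed

lemma proj_toeplitz_column:
  assumes "i < n" shows "proj n (toeplitz_column N F n i b q a) = toeplitz_column N F n i b q a"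
proof (cases q)
  case 0
  have "proj n (chr (int i)) \<theta> = chr (int i) \<theta>" for \<theta>
  proof -
    have "proj n (chr (int i)) \<theta> = (\<Sum>l<n. if l = i then chr (int i) \<theta> else 0)"
      unfolding proj_def by (rule sum.cong) (auto simp: coef_chr)
    then show ?thesis using assms by simp
  qed
  then show ?thesis using 0 by (auto simp: proj_def coef_0)
qed (simp add: proj_proj)

text \<open>Multiplying by the symbol and then projecting is the truncated Toeplitz matrix acting on
  Fourier coefficients. By \<open>proj_toeplitz_column\<close> each column is a finite sum of
  characters, so the product expands without any question of convergence.\<close>

lemma coef_toeplitz_column:
  assumes F: "\<And>a b. a < N \<Longrightarrow> b < N \<Longrightarrow> bounded_fun (F a b)" and "i < n" "b < N" "l < n" "a < N"
  shows "coef (toeplitz_column N F n i b q a) (int l) = mpow (n * N) (block_toeplitz N F) q (l * N + a) (i * N + b)"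
  using assms(4,5)
proof (induction q arbitrary: l a)
  case 0
  have "l * N + a = i * N + b \<longleftrightarrow> l = i \<and> a = b"
  proof
    assume e: "l * N + a = i * N + b"
    have "(l * N + a) div N = l" "(i * N + b) div N = i" using 0 assms(3) by auto
    then show "l = i \<and> a = b" using e by auto
  qed auto
  then show ?case by (auto simp: coef_chr coef_0)
next
  case (Suc q)
  let ?U = "toeplitz_column N F n i b q"
  have "coef (toeplitz_column N F n i b (Suc q) a) (int l) = coef (\<lambda>\<theta>. \<Sum>c<N. F a c \<theta> * ?U c \<theta>) (int l)"
    using Suc.prems by (simp add: coef_proj)
  also have "\<dots> = (\<Sum>c<N. coef (\<lambda>\<theta>. F a c \<theta> * ?U c \<theta>) (int l))"
    using F Suc.prems by (intro coef_sum bounded_fun_mult bounded_fun_toeplitz_column) auto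
  also have "\<dots> = (\<Sum>c<N. \<Sum>m<n. coef (F a c) (int l - int m) * coef (?U c) (int m))"
  proof (rule sum.cong[OF refl])
    fix c assume "c \<in> {..<N}"
    then have Fc: "bounded_fun (F a c)" using F Suc.prems by auto
    have "(\<lambda>\<theta>. F a c \<theta> * ?U c \<theta>) = (\<lambda>\<theta>. F a c \<theta> * proj n (?U c) \<theta>)" by (simp add: proj_toeplitz_column[OF assms(2)])
    also have "\<dots> = (\<lambda>\<theta>. \<Sum>m<n. coef (?U c) (int m) * (F a c \<theta> * chr (int m) \<theta>))"
      by (simp add: proj_def sum_distrib_left mult.left_commute)
    finally have "coef (\<lambda>\<theta>. F a c \<theta> * ?U c \<theta>) (int l) = coef (\<lambda>\<theta>. \<Sum>m<n. coef (?U c) (int m) * (F a c \<theta> * chr (int m) \<theta>)) (int l)" by simp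
    also have "\<dots> = (\<Sum>m<n. coef (\<lambda>\<theta>. coef (?U c) (int m) * (F a c \<theta> * chr (int m) \<theta>)) (int l))"
      using Fc by (intro coef_sum bounded_fun_mult) auto
    also have "\<dots> = (\<Sum>m<n. coef (F a c) (int l - int m) * coef (?U c) (int m))"
      by (intro sum.cong refl) (subst coef_cmult, subst coef_shift, rule mult.commute)
    finally show "coef (\<lambda>\<theta>. F a c \<theta> * ?U c \<theta>) (int l) = (\<Sum>m<n. coef (F a c) (int l - int m) * coef (?U c) (int m))" .
  qed
  also have "\<dots> = (\<Sum>m<n. \<Sum>c<N. coef (F a c) (int l - int m) * coef (?U c) (int m))"
    by (rule sum.swap)
  also have "\<dots> = (\<Sum>m<n. \<Sum>c<N. block_toeplitz N F (l * N + a) (m * N + c) * mpow (n * N) (block_toeplitz N F) q (m * N + c) (i * N + b))"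
    using Suc.IH Suc.prems by (intro sum.cong refl) (auto simp: block_toeplitz_index)
  also have "\<dots> = mpow (n * N) (block_toeplitz N F) (Suc q) (l * N + a) (i * N + b)"
    by (simp add: sum_blocks)
  finally show ?case .
qed

text \<open>The comparison is with the untruncated column, the power of the symbol times
  \<open>chr i\<close>. Each further factor adds two errors: the previous one, multiplied by bounded
  entries and contracted by \<open>proj n\<close>, and the truncation loss of the exact product,
  whose mean is a \<open>mean_defect\<close>.\<close>

lemma toeplitz_column_error:
  assumes F: "\<And>a b. a < N \<Longrightarrow> b < N \<Longrightarrow> bounded_fun (F a b)" and "b < N" "a < N"
  shows "(\<lambda>n. (\<Sum>i<n. sqn (\<lambda>\<theta>. toeplitz_column N F n i b q a \<theta> - mpow N (\<lambda>a b. F a b \<theta>) q a b * chr (int i) \<theta>)) / real n) \<longlonglongrightarrow> 0"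
  using assms(3)
proof (induction q arbitrary: a)
  case 0
  have "toeplitz_column N F n i b 0 a \<theta> - mpow N (\<lambda>a b. F a b \<theta>) 0 a b * chr (int i) \<theta> = 0" for n i \<theta> by simp
  then show ?case by (simp add: sqn_def)
next
  case (Suc q)
  define W where "W = (\<lambda>n i c \<theta>. toeplitz_column N F n i b q c \<theta> - mpow N (\<lambda>a b. F a b \<theta>) q c b * chr (int i) \<theta>)"
  define s where "s = (\<lambda>\<theta>. mpow N (\<lambda>a b. F a b \<theta>) (Suc q) a b)"
  have s_app: "mpow N (\<lambda>a b. F a b \<theta>) (Suc q) a b = s \<theta>" for \<theta> by (simp only: s_def)
  have bs: "bounded_fun s" unfolding s_def by (rule bounded_fun_mpow[where F = F]) (use F Suc.prems in auto)
  have bW: "bounded_fun (W n i c)" if "c < N" for n i c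
    unfolding W_def using bounded_fun_mpow[where F = F, OF F that]
    by (intro bounded_fun_diff bounded_fun_mult bounded_fun_toeplitz_column) auto
  have "\<forall>c. \<exists>C. c < N \<longrightarrow> (AE \<theta> in circle_measure. cmod (F a c \<theta>) \<le> C)"
    using F Suc.prems by (auto simp: bounded_fun_def)
  then obtain C where C: "\<And>c. c < N \<Longrightarrow> AE \<theta> in circle_measure. cmod (F a c \<theta>) \<le> C c" by metis
  have bound: "sqn (\<lambda>\<theta>. toeplitz_column N F n i b (Suc q) a \<theta> - s \<theta> * chr (int i) \<theta>)
      \<le> 2 * (N * (\<Sum>c<N. (C c)\<^sup>2 * sqn (W n i c))) + 2 * sqn (\<lambda>\<theta>. s \<theta> * chr (int i) \<theta> - proj n (\<lambda>\<theta>. s \<theta> * chr (int i) \<theta>) \<theta>)" for n i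
  proof -
    let ?se = "\<lambda>\<theta>. s \<theta> * chr (int i) \<theta>"
    let ?FW = "\<lambda>\<theta>. \<Sum>c<N. F a c \<theta> * W n i c \<theta>"
    have bse: "bounded_fun ?se" using bs by auto
    have bFW: "bounded_fun ?FW" using F Suc.prems bW by (intro bounded_fun_sum bounded_fun_mult) auto
    have "(\<Sum>c<N. F a c \<theta> * toeplitz_column N F n i b q c \<theta>) = ?FW \<theta> + ?se \<theta>" for \<theta>
      by (simp add: W_def s_def right_diff_distrib sum_subtractf sum_distrib_right mult.assoc)
    then have "toeplitz_column N F n i b (Suc q) a = proj n (\<lambda>\<theta>. ?FW \<theta> + ?se \<theta>)" by simp
    then have eq: "(\<lambda>\<theta>. toeplitz_column N F n i b (Suc q) a \<theta> - ?se \<theta>) = (\<lambda>\<theta>. proj n ?FW \<theta> + (-1) * (?se \<theta> - proj n ?se \<theta>))"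
      using proj_add[OF bFW bse] by auto
    have "sqn (\<lambda>\<theta>. toeplitz_column N F n i b (Suc q) a \<theta> - ?se \<theta>) \<le> 2 * sqn (proj n ?FW) + 2 * sqn (\<lambda>\<theta>. (-1) * (?se \<theta> - proj n ?se \<theta>))"
      unfolding eq by (rule sqn_add) (use bse in \<open>auto intro!: bounded_fun_diff\<close>)
    also have "sqn (\<lambda>\<theta>. (-1) * (?se \<theta> - proj n ?se \<theta>)) = sqn (\<lambda>\<theta>. ?se \<theta> - proj n ?se \<theta>)"
      by (subst sqn_cmult) simp
    also have "sqn (proj n ?FW) \<le> sqn ?FW" by (rule sqn_proj_le[OF bFW])
    also have "sqn ?FW \<le> card {..<N} * (\<Sum>c<N. sqn (\<lambda>\<theta>. F a c \<theta> * W n i c \<theta>))"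
      by (rule sqn_sum_le) (use F Suc.prems bW in auto)
    also have "(\<Sum>c<N. sqn (\<lambda>\<theta>. F a c \<theta> * W n i c \<theta>)) \<le> (\<Sum>c<N. (C c)\<^sup>2 * sqn (W n i c))"
      by (intro sum_mono sqn_mult_le) (use F Suc.prems bW C in auto)
    finally show ?thesis by (simp add: mult_left_mono)
  qed
  have lim: "(\<lambda>n. 2 * (N * (\<Sum>c<N. (C c)\<^sup>2 * ((\<Sum>i<n. sqn (W n i c)) / real n))) + 2 * mean_defect s n) \<longlonglongrightarrow> 2 * (N * (\<Sum>c<N. (C c)\<^sup>2 * 0)) + 2 * 0"
    using Suc.IH bs unfolding W_def
    by (intro tendsto_add tendsto_mult tendsto_sum tendsto_const mean_defect_tendsto_0) auto
  show ?case
  proof (rule tendsto_sandwich[OF _ _ tendsto_const])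
    show "(\<lambda>n. 2 * (N * (\<Sum>c<N. (C c)\<^sup>2 * ((\<Sum>i<n. sqn (W n i c)) / real n))) + 2 * mean_defect s n) \<longlonglongrightarrow> 0"
      using lim by simp
    show "\<forall>\<^sub>F n in sequentially. (\<Sum>i<n. sqn (\<lambda>\<theta>. toeplitz_column N F n i b (Suc q) a \<theta> - mpow N (\<lambda>a b. F a b \<theta>) (Suc q) a b * chr (int i) \<theta>)) / real n
      \<le> 2 * (N * (\<Sum>c<N. (C c)\<^sup>2 * ((\<Sum>i<n. sqn (W n i c)) / real n))) + 2 * mean_defect s n"
    proof (intro always_eventually allI)
      fix n
      have "(\<Sum>i<n. sqn (\<lambda>\<theta>. toeplitz_column N F n i b (Suc q) a \<theta> - s \<theta> * chr (int i) \<theta>))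
        \<le> (\<Sum>i<n. 2 * (N * (\<Sum>c<N. (C c)\<^sup>2 * sqn (W n i c))) + 2 * sqn (\<lambda>\<theta>. s \<theta> * chr (int i) \<theta> - proj n (\<lambda>\<theta>. s \<theta> * chr (int i) \<theta>) \<theta>))"
        by (rule sum_mono) (rule bound)
      also have "\<dots> = 2 * (N * (\<Sum>c<N. (C c)\<^sup>2 * (\<Sum>i<n. sqn (W n i c)))) + 2 * (\<Sum>i<n. sqn (\<lambda>\<theta>. s \<theta> * chr (int i) \<theta> - proj n (\<lambda>\<theta>. s \<theta> * chr (int i) \<theta>) \<theta>))"
        using sum.swap[of "\<lambda>i c. (C c)\<^sup>2 * sqn (W n i c)" "{..<N}" "{..<n}"]
        by (simp add: sum.distrib sum_distrib_left[symmetric])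
      finally have "(\<Sum>i<n. sqn (\<lambda>\<theta>. toeplitz_column N F n i b (Suc q) a \<theta> - s \<theta> * chr (int i) \<theta>)) / real n \<le> \<dots> / real n"
        by (rule divide_right_mono) simp
      then show "(\<Sum>i<n. sqn (\<lambda>\<theta>. toeplitz_column N F n i b (Suc q) a \<theta> - mpow N (\<lambda>a b. F a b \<theta>) (Suc q) a b * chr (int i) \<theta>)) / real n
      \<le> 2 * (N * (\<Sum>c<N. (C c)\<^sup>2 * ((\<Sum>i<n. sqn (W n i c)) / real n))) + 2 * mean_defect s n"
        unfolding s_app by (simp del: toeplitz_column.simps add: mean_defect_def add_divide_distrib sum_divide_distrib[symmetric])
    qed
  qed (auto intro!: always_eventually divide_nonneg_nonneg sum_nonneg)
qed

text \<open>At frequency \<open>i\<close> the untruncated column \<open>i\<close> has the zeroth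
  Fourier coefficient of the power of the symbol, the same for every \<open>i\<close>.
  Cauchy-Schwarz turns the mean square error of the columns into an error of the averaged
  diagonal.\<close>

theorem block_toeplitz_moment:
  assumes F: "\<And>a b. a < N \<Longrightarrow> b < N \<Longrightarrow> bounded_fun (F a b)"
  shows "(\<lambda>n. (\<Sum>r<n * N. mpow (n * N) (block_toeplitz N F) q r r) / of_nat n)
    \<longlonglongrightarrow> avg (\<lambda>\<theta>. \<Sum>b<N. mpow N (\<lambda>a b. F a b \<theta>) q b b)"
proof -
  let ?m = "\<lambda>b. avg (\<lambda>\<theta>. mpow N (\<lambda>a b. F a b \<theta>) q b b)"
  have bm: "bounded_fun (\<lambda>\<theta>. mpow N (\<lambda>a b. F a b \<theta>) q b b)" if "b < N" for b
    by (rule bounded_fun_mpow[where F = F]) (use F that in auto)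
  have one: "(\<lambda>n. (\<Sum>i<n. mpow (n * N) (block_toeplitz N F) q (i * N + b) (i * N + b)) / of_nat n) \<longlonglongrightarrow> ?m b"
    if b: "b < N" for b
  proof -
    define z where "z = (\<lambda>n i. mpow (n * N) (block_toeplitz N F) q (i * N + b) (i * N + b) - ?m b)"
    define w where "w = (\<lambda>n i. sqn (\<lambda>\<theta>. toeplitz_column N F n i b q b \<theta> - mpow N (\<lambda>a b. F a b \<theta>) q b b * chr (int i) \<theta>))"
    have zw: "(cmod (z n i))\<^sup>2 \<le> w n i" if "i < n" for n i
    proof -
      have "coef (\<lambda>\<theta>. mpow N (\<lambda>a b. F a b \<theta>) q b b * chr (int i) \<theta>) (int i) = ?m b"
        by (simp add: coef_shift) (simp add: coef_def chr_0)
      then have "z n i = coef (\<lambda>\<theta>. toeplitz_column N F n i b q b \<theta> - mpow N (\<lambda>a b. F a b \<theta>) q b b * chr (int i) \<theta>) (int i)"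
        using coef_toeplitz_column[OF F, where i = i and n = n and b = b and l = i and a = b and q = q] that b bm[OF b]
        by (subst coef_diff) (auto simp: z_def bounded_fun_toeplitz_column)
      then show ?thesis unfolding w_def using bm[OF b]
        by (simp only:) (intro coef_sq_le bounded_fun_diff bounded_fun_mult bounded_fun_toeplitz_column bounded_fun_chr bm[OF b])
    qed
    have est: "cmod ((\<Sum>i<n. z n i) / of_nat n) \<le> sqrt ((\<Sum>i<n. w n i) / real n)" for n
    proof (cases "n = 0")
      case False
      have "(cmod (\<Sum>i<n. z n i))\<^sup>2 \<le> (\<Sum>i<n. cmod (z n i))\<^sup>2" by (intro power_mono norm_sum) auto
      also have "\<dots> \<le> (\<Sum>i<n. (cmod (z n i))\<^sup>2) * real (card {..<n})" by (rule sum_squared_le_sum_of_squares)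
      also have "\<dots> \<le> (\<Sum>i<n. w n i) * real n" by (auto intro!: mult_right_mono sum_mono zw)
      finally have "(cmod (\<Sum>i<n. z n i) / real n)\<^sup>2 \<le> (\<Sum>i<n. w n i) / real n"
        using False by (simp add: power_divide field_simps power2_eq_square)
      then show ?thesis by (simp add: norm_divide real_le_rsqrt)
    qed simp
    have "(\<lambda>n. (\<Sum>i<n. w n i) / real n) \<longlonglongrightarrow> 0"
      unfolding w_def by (rule toeplitz_column_error) (use F b in auto)
    from tendsto_real_sqrt[OF this] have "(\<lambda>n. sqrt ((\<Sum>i<n. w n i) / real n)) \<longlonglongrightarrow> 0" by simp
    then have "(\<lambda>n. (\<Sum>i<n. z n i) / of_nat n) \<longlonglongrightarrow> 0"
      by (rule Lim_null_comparison[OF always_eventually, rotated]) (rule allI, rule est)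
    then have "(\<lambda>n. (\<Sum>i<n. z n i) / of_nat n + ?m b) \<longlonglongrightarrow> 0 + ?m b" by (intro tendsto_add tendsto_const)
    then have "(\<lambda>n. (\<Sum>i<n. z n i) / of_nat n + ?m b) \<longlonglongrightarrow> ?m b" by simp
    then show ?thesis
    proof (rule Lim_transform_eventually)
      show "\<forall>\<^sub>F n in sequentially. (\<Sum>i<n. z n i) / of_nat n + ?m b = (\<Sum>i<n. mpow (n * N) (block_toeplitz N F) q (i * N + b) (i * N + b)) / of_nat n"
        using eventually_gt_at_top[of 0] by eventually_elim (simp add: z_def sum_subtractf diff_divide_distrib)
    qed
  qed
  have "(\<lambda>n. \<Sum>b<N. (\<Sum>i<n. mpow (n * N) (block_toeplitz N F) q (i * N + b) (i * N + b)) / of_nat n) \<longlonglongrightarrow> (\<Sum>b<N. ?m b)"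
    by (intro tendsto_sum one) simp
  moreover have "(\<Sum>b<N. (\<Sum>i<n. mpow (n * N) (block_toeplitz N F) q (i * N + b) (i * N + b)) / of_nat n)
    = (\<Sum>r<n * N. mpow (n * N) (block_toeplitz N F) q r r) / of_nat n" for n
    by (subst sum_divide_distrib[symmetric], subst sum.swap, subst sum_blocks) (rule refl)
  moreover have "(\<Sum>b<N. ?m b) = avg (\<lambda>\<theta>. \<Sum>b<N. mpow N (\<lambda>a b. F a b \<theta>) q b b)"
    using bm by (subst avg_sum) auto
  ultimately show ?thesis by simp
qed

section \<open>The symplectic form\<close>

definition jf :: "nat \<Rightarrow> nat \<Rightarrow> 'a::comm_ring_1" where
  "jf a b = (if even a \<and> b = Suc a then 1 else if odd a \<and> Suc b = a then -1 else 0)"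

text \<open>\<open>J\<close> is a signed permutation matrix; this is its permutation, an involution
  swapping the two indices of each pair. Products with \<open>J\<close> thereby lose their sum, see
  \<open>sum_jf_left\<close>.\<close>

definition partner :: "nat \<Rightarrow> nat" where
  "partner a = (if even a then Suc a else a - 1)"

lemma partner_partner [simp]: "partner (partner a) = a"
  by (auto simp: partner_def)

lemma partner_less: "a < 2 * m \<Longrightarrow> partner a < 2 * m"
  by (auto simp: partner_def elim!: evenE)

lemma partner_div: "partner a div 2 = a div 2"
  by (auto simp: partner_def elim!: evenE oddE)

lemma even_partner: "even (partner a) \<longleftrightarrow> odd a"
  by (auto simp: partner_def elim!: oddE)

lemma jf_partner: "jf a b = (if b = partner a then (-1) ^ a else 0)"
  by (auto simp: jf_def partner_def)

lemma jf_swap: "jf b a = - jf a b"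
  by (auto simp: jf_def)

lemma jf_nonzero_div: "jf a b \<noteq> 0 \<Longrightarrow> a div 2 = b div 2"
  by (auto simp: jf_partner partner_div split: if_splits)

lemma sum_jf_left:
  fixes f :: "nat \<Rightarrow> 'a::comm_ring_1"
  assumes "a < 2 * m" shows "(\<Sum>c<2 * m. jf a c * f c) = (-1) ^ a * f (partner a)"
proof -
  have "(\<Sum>c<2 * m. jf a c * f c) = (\<Sum>c<2 * m. if c = partner a then (-1) ^ a * f c else 0)"
    by (rule sum.cong) (auto simp: jf_partner)
  then show ?thesis using partner_less[OF assms] by simp
qed

lemma diag_block_mat_index:
  assumes "\<forall>M\<in>set Ms. M \<in> carrier_mat 2 2" "a < 2 * length Ms" "b < 2 * length Ms"
  shows "diag_block_mat Ms $$ (a, b) = (if a div 2 = b div 2 then (Ms ! (a div 2)) $$ (a mod 2, b mod 2) else 0)"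
  using assms
proof (induction Ms arbitrary: a b)
  case Nil then show ?case by simp
next
  case (Cons M Ms)
  have M: "dim_row M = 2" "dim_col M = 2" using Cons.prems by auto
  have l: "sum_list (map dim_row Ms) = 2 * length Ms" "sum_list (map dim_col Ms) = 2 * length Ms"
    using Cons.prems(1) by (induction Ms) auto
  have B: "dim_row (diag_block_mat Ms) = 2 * length Ms" "dim_col (diag_block_mat Ms) = 2 * length Ms"
    by (simp_all add: dim_diag_block_mat l)
  have small: "x < 2 \<Longrightarrow> x div 2 = 0 \<and> x mod 2 = x" for x :: nat by simp
  have big: "\<not> x < 2 \<Longrightarrow> x div 2 = Suc ((x - 2) div 2) \<and> x mod 2 = (x - 2) mod 2" for x :: nat by presburger
  consider "a < 2" "b < 2" | "a < 2" "\<not> b < 2" | "\<not> a < 2" "b < 2" | "\<not> a < 2" "\<not> b < 2" by blast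
  then show ?case
  proof cases
    case 4
    then have "diag_block_mat (M # Ms) $$ (a, b) = diag_block_mat Ms $$ (a - 2, b - 2)"
      using Cons.prems by (simp add: Let_def M B)
    also have "\<dots> = (if (a - 2) div 2 = (b - 2) div 2 then (Ms ! ((a - 2) div 2)) $$ ((a - 2) mod 2, (b - 2) mod 2) else 0)"
      using Cons.prems 4 by (intro Cons.IH) auto
    finally show ?thesis by (simp only: big[OF 4(1)] big[OF 4(2)] nth_Cons_Suc nat.inject)
  next
    case 1
    then show ?thesis using Cons.prems small[OF 1(1)] small[OF 1(2)] by (simp add: Let_def M B)
  next
    case 2
    then have e: "(a div 2 = b div 2) \<longleftrightarrow> False" by presburger
    show ?thesis unfolding e if_False using Cons.prems 2 by (simp add: Let_def M B)
  next
    case 3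
    then have e: "(a div 2 = b div 2) \<longleftrightarrow> False" by presburger
    show ?thesis unfolding e if_False using Cons.prems 3 by (simp add: Let_def M B)
  qed
qed

lemma J2_carrier: "J2 \<in> carrier_mat 2 2"
  by (simp add: J2_def mat_of_rows_list_def numeral_2_eq_2)

lemma symp_form_carrier [simp]: "symp_form m \<in> carrier_mat (2 * m) (2 * m)"
proof -
  have "dim_row J2 = 2" "dim_col J2 = 2" using J2_carrier by auto
  then show ?thesis
    unfolding symp_form_def by (intro carrier_matI) (simp_all add: dim_diag_block_mat sum_list_replicate)
qed

lemma symp_form_dim [simp]: "dim_row (symp_form m) = 2 * m" "dim_col (symp_form m) = 2 * m"
  using symp_form_carrier[of m] by (simp_all only: carrier_mat_def mem_Collect_eq)

lemma symp_form_index: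
  assumes "a < 2 * m" "b < 2 * m" shows "symp_form m $$ (a, b) = jf a b"
proof -
  have "symp_form m $$ (a, b) = (if a div 2 = b div 2 then J2 $$ (a mod 2, b mod 2) else 0)"
    unfolding symp_form_def using assms J2_carrier by (subst diag_block_mat_index) auto
  also have "\<dots> = jf a b"
  proof (cases "a div 2 = b div 2")
    case True
    define i where "i = a div 2"
    have "a = 2 * i \<or> a = Suc (2 * i)" "b = 2 * i \<or> b = Suc (2 * i)" using True unfolding i_def by presburger+
    then show ?thesis
      by (elim disjE) (simp_all add: J2_def mat_of_rows_list_def jf_def)
  qed (use jf_nonzero_div[of a b] in auto)
  finally show ?thesis .
qed

lemma williamson_diag_carrier: "diag_block_mat (map (\<lambda>d. d \<cdot>\<^sub>m 1\<^sub>m 2) ds) \<in> carrier_mat (2 * length ds) (2 * length ds)"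
proof -
  have "sum_list (map dim_row (map (\<lambda>d. d \<cdot>\<^sub>m 1\<^sub>m 2) ds)) = 2 * length ds"
    "sum_list (map dim_col (map (\<lambda>d. d \<cdot>\<^sub>m 1\<^sub>m 2) ds)) = 2 * length ds"
    by (simp_all add: o_def sum_list_triv)
  then show ?thesis by (intro carrier_matI) (simp_all only: dim_diag_block_mat)
qed

lemma williamson_diag_index:
  fixes ds :: "real list"
  assumes "a < 2 * length ds" "b < 2 * length ds"
  shows "diag_block_mat (map (\<lambda>d. d \<cdot>\<^sub>m 1\<^sub>m 2) ds) $$ (a, b) = (if a = b then ds ! (a div 2) else 0)"
proof -
  have "a div 2 < length ds" using assms by auto
  moreover have "a div 2 = b div 2 \<Longrightarrow> a mod 2 = b mod 2 \<Longrightarrow> a = b" by presburger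
  ultimately show ?thesis using assms by (subst diag_block_mat_index) auto
qed

section \<open>Existence of the Williamson form\<close>

definition bil :: "nat \<Rightarrow> (nat \<Rightarrow> nat \<Rightarrow> real) \<Rightarrow> (nat \<Rightarrow> real) \<Rightarrow> (nat \<Rightarrow> real) \<Rightarrow> real" where
  "bil n B x y = (\<Sum>a<n. \<Sum>b<n. x a * B a b * y b)"

lemma bil_add_left: "bil n B (\<lambda>a. x a + y a) z = bil n B x z + bil n B y z"
  by (simp add: bil_def sum.distrib distrib_right)

lemma bil_add_right: "bil n B z (\<lambda>a. x a + y a) = bil n B z x + bil n B z y"
  by (simp add: bil_def sum.distrib distrib_left)

lemma bil_scale_left: "bil n B (\<lambda>a. t * x a) y = t * bil n B x y"
  by (simp add: bil_def sum_distrib_left mult.assoc)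

lemma bil_scale_right: "bil n B x (\<lambda>a. t * y a) = t * bil n B x y"
  by (simp add: bil_def sum_distrib_left mult_ac)

lemma bil_diff_right: "bil n B z (\<lambda>a. x a - y a) = bil n B z x - bil n B z y"
  by (simp add: bil_def sum_subtractf right_diff_distrib)

lemma bil_sum_right: "bil n B z (\<lambda>a. \<Sum>r<(k::nat). f r a) = (\<Sum>r<k. bil n B z (f r))"
proof (induction k)
  case 0 then show ?case by (simp add: bil_def)
next
  case (Suc k) then show ?case using bil_add_right[of n B z "\<lambda>a. \<Sum>r<k. f r a" "f k"] by simp
qed

lemma bil_swap: "bil n B x y = bil n (\<lambda>a b. B b a) y x"
  unfolding bil_def by (subst sum.swap) (simp add: mult_ac)

lemma bil_jf_swap: "bil n jf x y = - bil n jf y x"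
  proof -
  have "(\<lambda>a b. jf b a :: real) = (\<lambda>a b. - jf a b)" by (intro ext) (rule jf_swap)
  then have "bil n jf x y = bil n (\<lambda>a b. - jf a b) y x" by (subst bil_swap) simp
  then show ?thesis by (simp add: bil_def sum_negf)
qed

lemma bil_continuous: "continuous_on UNIV (\<lambda>p. bil n B (fst p) (snd p))"
proof -
  have "continuous_on UNIV (\<lambda>p::(nat \<Rightarrow> real) \<times> (nat \<Rightarrow> real). fst p a)" "continuous_on UNIV (\<lambda>p::(nat \<Rightarrow> real) \<times> (nat \<Rightarrow> real). snd p a)" for a
    by (rule continuous_on_compose2[OF continuous_on_product_coordinates, of UNIV],
        rule continuous_on_fst continuous_on_snd, rule continuous_on_id, simp)+
  then show ?thesis unfolding bil_def by (intro continuous_intros) auto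
qed

lemma bil_continuous_right: "continuous_on UNIV (\<lambda>y. bil n B x y)"
  unfolding bil_def by (intro continuous_intros) auto

lemma bil_continuous_diag: "continuous_on UNIV (\<lambda>y. bil n B y y)"
  unfolding bil_def by (intro continuous_intros) auto

text \<open>Vectors are functions on all of \<open>nat\<close>, so compactness comes from Tychonoff,
  with the coordinates from \<open>n\<close> on pinned to 0.\<close>

lemma compact_box_fun: "compact {x::nat \<Rightarrow> real. \<forall>a. \<bar>x a\<bar> \<le> (if a < n then R else 0)}"
proof -
  have "compactin (product_topology (\<lambda>i::nat. (euclidean::real topology)) UNIV) (\<Pi>\<^sub>E a\<in>UNIV. {- (if a < n then R else 0)..(if a < n then R else 0)})"
    by (subst compactin_PiE) auto
  then have "compact (\<Pi>\<^sub>E a\<in>(UNIV::nat set). {- (if a < n then R else 0)..(if a < n then R else (0::real))})"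
    by (simp add: euclidean_product_topology)
  also have "(\<Pi>\<^sub>E a\<in>(UNIV::nat set). {- (if a < n then R else 0)..(if a < n then R else (0::real))}) = {x. \<forall>a. \<bar>x a\<bar> \<le> (if a < n then R else 0)}"
    by (auto simp: PiE_def Pi_def abs_le_iff)
  finally show ?thesis .
qed

lemma underdetermined_solution:
  fixes e :: "nat \<Rightarrow> nat \<Rightarrow> real"
  assumes "k < n"
  obtains w where "\<forall>a\<ge>n. w a = 0" "\<exists>a<n. w a \<noteq> 0" "\<And>r. r < k \<Longrightarrow> (\<Sum>a<n. e r a * w a) = 0"
proof -
  \<comment> \<open>Zero rows pad the \<open>k\<close> equations to a square matrix; row
    \<open>k\<close> vanishes, and with it every term of the determinant.\<close>
  define E where "E = mat n n (\<lambda>(r, a). if r < k then e r a else 0)"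
  have E: "E \<in> carrier_mat n n" by (simp add: E_def)
  have "det E = 0"
  proof -
    have "det E = (\<Sum>p | p permutes {0..<n}. signof p * (\<Prod>i = 0..<n. E $$ (i, p i)))" by (rule det_def'[OF E])
    also have "\<dots> = 0"
    proof (rule sum.neutral, intro ballI)
      fix p assume "p \<in> {p. p permutes {0..<n}}"
      then have "p k < n" using assms permutes_in_image[of p "{0..<n}" k] by auto
      then have "E $$ (k, p k) = 0" using assms by (simp add: E_def)
      then have "(\<Prod>i = 0..<n. E $$ (i, p i)) = 0" using assms by (intro prod_zero) auto
      then show "signof p * (\<Prod>i = 0..<n. E $$ (i, p i)) = 0" by simp
    qed
    finally show ?thesis .
  qed
  then obtain v where v: "v \<in> carrier_vec n" "v \<noteq> 0\<^sub>v n" "E *\<^sub>v v = 0\<^sub>v n"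
    using det_0_iff_vec_prod_zero[OF E] by auto
  define w where "w = (\<lambda>a. if a < n then v $ a else 0)"
  show ?thesis
  proof (rule that[of w])
    show "\<exists>a<n. w a \<noteq> 0" using v by (auto simp: w_def vec_eq_iff)
    fix r assume r: "r < k"
    have "(E *\<^sub>v v) $ r = (\<Sum>a<n. e r a * w a)"
      using r assms v(1) by (simp add: E_def scalar_prod_def w_def atLeast0LessThan)
    then show "(\<Sum>a<n. e r a * w a) = 0" using v(3) r assms by simp
  qed (simp add: w_def)
qed

text \<open>Both sides agree at \<open>t = 0\<close>, so their slopes there,
  \<open>2 * \<nu> * k\<close> and 0, have to agree as well.\<close>

lemma tangent_line_zero:
  fixes \<nu> k b :: real
  assumes "\<And>t. (\<nu> + t * k)\<^sup>2 \<le> \<nu>\<^sup>2 * (1 + t\<^sup>2 * b)" "\<nu> > 0" "b \<ge> 0"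
  shows "k = 0"
proof (rule ccontr)
  assume k: "k \<noteq> 0"
  \<comment> \<open>The test point is \<open>t = s * k\<close>; this \<open>s\<close> is small
    enough that the quadratic term on the right is at most half of the linear term
    \<open>2 * \<nu> * s * k\<^sup>2\<close> on the left.\<close>
  define s where "s = 1 / (\<nu> * b + 1)"
  have s: "s > 0" "s * (\<nu> * b) < 1" using assms by (auto simp: s_def field_simps add_pos_nonneg)
  have "(\<nu> + s * k * k)\<^sup>2 \<le> \<nu>\<^sup>2 * (1 + (s * k)\<^sup>2 * b)" by (rule assms(1))
  then have "2 * \<nu> * s * k\<^sup>2 + (s * k * k)\<^sup>2 \<le> \<nu> * (s * (\<nu> * b)) * s * k\<^sup>2"
    by (simp add: power2_eq_square algebra_simps)
  also have "\<dots> \<le> \<nu> * 1 * s * k\<^sup>2"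
    using s assms by (intro mult_right_mono mult_left_mono) auto
  finally have "\<nu> * s * k\<^sup>2 + (s * k * k)\<^sup>2 \<le> 0" by simp
  moreover have "\<nu> * s * k\<^sup>2 > 0" using s assms k by simp
  ultimately show False by (smt (verit) zero_le_power2)
qed

text \<open>Positive definiteness with an explicit constant: \<open>c\<close> bounds the unit sphere
  of the form coordinatewise, which yields compactness, and the Toeplitz operator hands positivity
  down in just this shape.\<close>

locale coercive_form =
  fixes m :: nat and B :: "nat \<Rightarrow> nat \<Rightarrow> real" and c :: real
  assumes sym: "\<And>a b. a < 2 * m \<Longrightarrow> b < 2 * m \<Longrightarrow> B a b = B b a"
    and c_pos: "c > 0"
    and coercive: "\<And>x. c * (\<Sum>a<2 * m. (x a)\<^sup>2) \<le> bil (2 * m) B x x"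
begin

abbreviation "\<beta> \<equiv> bil (2 * m) B"
abbreviation "\<kappa> \<equiv> bil (2 * m) jf"

lemma beta_sym: "\<beta> x y = \<beta> y x"
  by (subst bil_swap) (auto simp: bil_def sym intro!: sum.cong)

lemma beta_nonneg: "\<beta> x x \<ge> 0"
  using coercive[of x] c_pos by (smt (verit) mult_nonneg_nonneg sum_nonneg zero_le_power2)

lemma beta_pos: assumes "a < 2 * m" "x a \<noteq> 0" shows "\<beta> x x > 0"
proof -
  have "(x a)\<^sup>2 \<le> (\<Sum>a<2 * m. (x a)\<^sup>2)" using assms by (intro member_le_sum) auto
  moreover have "(x a)\<^sup>2 > 0" using assms by simp
  ultimately have "0 < c * (\<Sum>a<2 * m. (x a)\<^sup>2)" using c_pos by (intro mult_pos_pos) linarith+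
  then show ?thesis using coercive[of x] by linarith
qed

lemma beta_zero: assumes "\<beta> x x = 0" shows "\<kappa> x y = 0" "\<kappa> y x = 0"
proof -
  have "x a = 0" if "a < 2 * m" for a using beta_pos[OF that] assms by fastforce
  then show "\<kappa> x y = 0" "\<kappa> y x = 0" by (auto simp: bil_def)
qed

text \<open>Coordinates from \<open>2 * m\<close> on are set to 0, since \<open>\<beta>\<close> does
  not see them and the unit sphere would not be compact otherwise.\<close>

definition compl :: "nat \<Rightarrow> (nat \<Rightarrow> nat \<Rightarrow> real) \<Rightarrow> (nat \<Rightarrow> real) set" where
  "compl k u = {w. (\<forall>a\<ge>2 * m. w a = 0) \<and> (\<forall>r<k. \<beta> (u r) w = 0)}"

lemma compl_combination:
  assumes "x \<in> compl k u" "y \<in> compl k u" shows "(\<lambda>a. s * x a + t * y a) \<in> compl k u"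
  using assms by (auto simp: compl_def bil_add_right bil_scale_right)

definition unit_compl :: "nat \<Rightarrow> (nat \<Rightarrow> nat \<Rightarrow> real) \<Rightarrow> (nat \<Rightarrow> real) set" where
  "unit_compl k u = {w \<in> compl k u. \<beta> w w = 1}"

lemma compact_unit_compl: "compact (unit_compl k u)"
proof -
  let ?R = "sqrt (1 / c)"
  let ?Q = "{x::nat \<Rightarrow> real. \<forall>a. \<bar>x a\<bar> \<le> (if a < 2 * m then ?R else 0)}"
  have "unit_compl k u = ?Q \<inter> (\<Inter>r<k. {w. \<beta> (u r) w = 0}) \<inter> {w. \<beta> w w = 1}"
  proof -
    have "\<bar>w a\<bar> \<le> ?R" if "\<beta> w w = 1" "a < 2 * m" for w a
    proof -
      have "(w a)\<^sup>2 \<le> (\<Sum>a<2 * m. (w a)\<^sup>2)" using that by (intro member_le_sum) auto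
      also have "\<dots> \<le> 1 / c" using coercive[of w] that c_pos by (simp add: field_simps)
      finally show ?thesis by (metis real_sqrt_abs real_sqrt_le_mono)
    qed
    then show ?thesis by (auto simp: unit_compl_def compl_def not_less split: if_splits)
  qed
  moreover have "closed (\<Inter>r<k. {w. \<beta> (u r) w = 0})"
    by (intro closed_INT ballI closed_Collect_eq bil_continuous_right continuous_intros)
  moreover have "closed {w. \<beta> w w = 1}"
    by (intro closed_Collect_eq bil_continuous_diag continuous_intros)
  ultimately show ?thesis by (simp only:) (intro compact_Int_closed compact_box_fun)
qed

lemma unit_complI:
  assumes "w \<in> compl k u" "\<beta> w w > 0" shows "(\<lambda>a. 1 / sqrt (\<beta> w w) * w a) \<in> unit_compl k u"
proof -
  have "(\<lambda>a. 1 / sqrt (\<beta> w w) * w a + 0 * w a) \<in> compl k u" by (rule compl_combination[OF assms(1,1)])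
  moreover have "\<beta> (\<lambda>a. 1 / sqrt (\<beta> w w) * w a) (\<lambda>a. 1 / sqrt (\<beta> w w) * w a) = 1"
    unfolding bil_scale_left bil_scale_right using assms(2) by simp
  ultimately show ?thesis by (simp only: unit_compl_def mem_Collect_eq mult_zero_left add_0_right simp_thms)
qed

text \<open>The Williamson basis is built greedily: each new pair maximises \<open>\<kappa>\<close> on the \<open>\<beta>\<close>-unit sphere of
  the \<open>\<beta>\<close>-complement of the previous vectors, and the first order conditions make the complement of
  the enlarged family \<open>\<kappa>\<close>-orthogonal to it as well. The maxima decrease; they are the reciprocals of
  the symplectic eigenvalues.\<close>

definition partial_frame :: "nat \<Rightarrow> (nat \<Rightarrow> nat \<Rightarrow> real) \<Rightarrow> (nat \<Rightarrow> real) \<Rightarrow> bool" where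
  "partial_frame p u \<nu> \<longleftrightarrow>
    (\<forall>r<2 * p. \<forall>s<2 * p. \<beta> (u r) (u s) = (if r = s then 1 else 0)) \<and>
    (\<forall>r<2 * p. \<forall>s<2 * p. \<kappa> (u r) (u s) = jf r s * \<nu> (r div 2)) \<and>
    (\<forall>r<2 * p. \<forall>a\<ge>2 * m. u r a = 0) \<and>
    (\<forall>r<2 * p. \<forall>w\<in>compl (2 * p) u. \<kappa> (u r) w = 0) \<and>
    (\<forall>r<p. \<nu> r > 0 \<and> (\<forall>x\<in>unit_compl (2 * p) u. \<forall>y\<in>unit_compl (2 * p) u. \<kappa> x y \<le> \<nu> r)) \<and>
    (\<forall>r s. r < s \<longrightarrow> s < p \<longrightarrow> \<nu> s \<le> \<nu> r)"

text \<open>Fewer than \<open>2 * m\<close> linear conditions leave a nonzero \<open>w\<close> in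
  the complement, and \<open>y\<close>, a signed permutation of \<open>w\<close>, makes
  \<open>\<kappa> w y\<close> its squared length. Projecting \<open>y\<close> into the complement
  keeps this value, because the earlier vectors are \<open>\<kappa>\<close>-orthogonal to
  \<open>w\<close>.\<close>

lemma kappa_positive_on_compl:
  assumes pf: "partial_frame p u \<nu>" and "p < m"
  obtains x y where "x \<in> unit_compl (2 * p) u" "y \<in> unit_compl (2 * p) u" "\<kappa> x y > 0"
proof -
  obtain w where w: "\<forall>a\<ge>2 * m. w a = 0" "\<exists>a<2 * m. w a \<noteq> 0"
    "\<And>r. r < 2 * p \<Longrightarrow> (\<Sum>a<2 * m. (\<Sum>b<2 * m. u r b * B b a) * w a) = 0"
    using underdetermined_solution[of "2 * p" "2 * m" "\<lambda>r a. \<Sum>b<2 * m. u r b * B b a"] \<open>p < m\<close> by auto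
  have "\<beta> (u r) w = 0" if "r < 2 * p" for r
    using w(3)[OF that] unfolding bil_def by (subst sum.swap) (simp add: sum_distrib_right)
  then have wc: "w \<in> compl (2 * p) u" using w(1) by (simp add: compl_def)
  define y where "y = (\<lambda>b. if b < 2 * m then \<Sum>a<2 * m. w a * jf a b else 0)"
  have y_eq: "y b = - ((-1) ^ b * w (partner b))" if "b < 2 * m" for b
  proof -
    have "y b = - (\<Sum>a<2 * m. jf b a * w a)"
      using that by (simp add: y_def jf_swap[of b] sum_negf[symmetric] mult.commute)
    then show ?thesis using that by (simp add: sum_jf_left)
  qed
  have ky: "\<kappa> w y = (\<Sum>b<2 * m. (y b)\<^sup>2)"
    unfolding bil_def by (subst sum.swap) (simp add: sum_distrib_right[symmetric] y_def power2_eq_square)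
  obtain a where a: "a < 2 * m" "w a \<noteq> 0" using w(2) by blast
  have pa: "partner a < 2 * m" using a(1) by (rule partner_less)
  have "y (partner a) \<noteq> 0" using y_eq[OF pa] a by simp
  then have "0 < (y (partner a))\<^sup>2" by simp
  also have "\<dots> \<le> (\<Sum>b<2 * m. (y b)\<^sup>2)" using pa by (intro member_le_sum) auto
  finally have kpos: "\<kappa> w y > 0" using ky by simp
  define z where "z = (\<lambda>a. y a - (\<Sum>r<2 * p. \<beta> (u r) y * u r a))"
  have zb: "\<beta> (u s) z = 0" if "s < 2 * p" for s
  proof -
    have "\<beta> (u s) z = \<beta> (u s) y - (\<Sum>r<2 * p. \<beta> (u r) y * \<beta> (u s) (u r))"
      unfolding z_def by (simp add: bil_diff_right bil_sum_right bil_scale_right)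
    also have "(\<Sum>r<2 * p. \<beta> (u r) y * \<beta> (u s) (u r)) = (\<Sum>r<2 * p. if r = s then \<beta> (u s) y else 0)"
      by (rule sum.cong) (use pf that in \<open>auto simp: partial_frame_def\<close>)
    finally show ?thesis using that by simp
  qed
  then have zc: "z \<in> compl (2 * p) u" using pf by (auto simp: compl_def z_def y_def partial_frame_def)
  have "\<kappa> w z = \<kappa> w y - (\<Sum>r<2 * p. \<beta> (u r) y * \<kappa> w (u r))"
    unfolding z_def by (simp add: bil_diff_right bil_sum_right bil_scale_right)
  also have "(\<Sum>r<2 * p. \<beta> (u r) y * \<kappa> w (u r)) = 0"
    using pf wc by (intro sum.neutral) (auto simp: partial_frame_def bil_jf_swap[of _ w])
  finally have kz: "\<kappa> w z > 0" using kpos by simp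
  have pos: "\<beta> w w > 0" "\<beta> z z > 0"
    using beta_zero[of w z] beta_zero[of z w] kz beta_nonneg[of w] beta_nonneg[of z] by fastforce+
  show ?thesis
  proof (rule that[OF unit_complI[OF wc pos(1)] unit_complI[OF zc pos(2)]])
    show "\<kappa> (\<lambda>a. 1 / sqrt (\<beta> w w) * w a) (\<lambda>a. 1 / sqrt (\<beta> z z) * z a) > 0"
      unfolding bil_scale_left bil_scale_right using kz pos by simp
  qed
qed

text \<open>By homogeneity, maximality on the unit sphere becomes the inequality \<open>le\<close>
  on the whole complement. It persists when one member of the pair moves along \<open>w\<close>, and
  \<open>tangent_line_zero\<close> extracts the first order condition.\<close>

lemma maximal_pair_orthogonal:
  assumes u: "u \<in> unit_compl k f" and v: "v \<in> unit_compl k f" and "\<kappa> u v > 0"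
    and max: "\<And>x y. x \<in> unit_compl k f \<Longrightarrow> y \<in> unit_compl k f \<Longrightarrow> \<kappa> x y \<le> \<kappa> u v"
    and w: "w \<in> compl k f"
  shows "\<beta> v w = 0 \<Longrightarrow> \<kappa> u w = 0" "\<beta> u w = 0 \<Longrightarrow> \<kappa> v w = 0"
proof -
  let ?\<nu> = "\<kappa> u v"
  have le: "(\<kappa> x y)\<^sup>2 \<le> ?\<nu>\<^sup>2 * (\<beta> x x * \<beta> y y)" if "x \<in> compl k f" "y \<in> compl k f" for x y
  proof (cases "\<beta> x x = 0 \<or> \<beta> y y = 0")
    case True then show ?thesis using beta_zero[of x y] beta_zero[of y x] by auto
  next
    case False
    then have pos: "\<beta> x x > 0" "\<beta> y y > 0" using beta_nonneg[of x] beta_nonneg[of y] by auto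
    let ?x = "\<lambda>a. 1 / sqrt (\<beta> x x) * x a" and ?y = "\<lambda>a. 1 / sqrt (\<beta> y y) * y a"
    have xy: "?x \<in> unit_compl k f" "?y \<in> unit_compl k f" using unit_complI that pos by auto
    have "\<kappa> ?x ?y \<le> ?\<nu>" "\<kappa> ?y ?x \<le> ?\<nu>" using max xy by auto
    then have "\<bar>\<kappa> ?x ?y\<bar> \<le> ?\<nu>" using bil_jf_swap[of "2 * m" ?x ?y] by linarith
    then have "(\<kappa> ?x ?y)\<^sup>2 \<le> ?\<nu>\<^sup>2" by (metis abs_ge_zero power2_abs power_mono)
    then show ?thesis unfolding bil_scale_left bil_scale_right using pos
      by (simp add: power_mult_distrib power_divide field_simps)
  qed
  have uc: "u \<in> compl k f" "v \<in> compl k f" "\<beta> u u = 1" "\<beta> v v = 1" using u v by (auto simp: unit_compl_def)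
  show "\<kappa> u w = 0" if vw: "\<beta> v w = 0"
  proof (rule tangent_line_zero)
    fix t
    have "(\<kappa> u (\<lambda>a. 1 * v a + t * w a))\<^sup>2 \<le> ?\<nu>\<^sup>2 * (\<beta> u u * \<beta> (\<lambda>a. 1 * v a + t * w a) (\<lambda>a. 1 * v a + t * w a))"
      using uc w by (intro le compl_combination) auto
    then show "(?\<nu> + t * \<kappa> u w)\<^sup>2 \<le> ?\<nu>\<^sup>2 * (1 + t\<^sup>2 * \<beta> w w)"
      unfolding bil_add_left bil_add_right bil_scale_left bil_scale_right
      using vw beta_sym[of w v] uc by (simp add: power2_eq_square mult.assoc)
  qed (use assms beta_nonneg in auto)
  show "\<kappa> v w = 0" if uw: "\<beta> u w = 0"
  proof (rule tangent_line_zero)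
    fix t
    \<comment> \<open>The motion starts at \<open>-u\<close> because \<open>\<kappa> v u\<close> is
      negative, while \<open>\<kappa> v (-u)\<close> is again the maximum.\<close>
    have "(\<kappa> v (\<lambda>a. (-1) * u a + t * w a))\<^sup>2 \<le> ?\<nu>\<^sup>2 * (\<beta> v v * \<beta> (\<lambda>a. (-1) * u a + t * w a) (\<lambda>a. (-1) * u a + t * w a))"
      using uc w by (intro le compl_combination) auto
    then show "(?\<nu> + t * \<kappa> v w)\<^sup>2 \<le> ?\<nu>\<^sup>2 * (1 + t\<^sup>2 * \<beta> w w)"
      unfolding bil_add_left bil_add_right bil_scale_left bil_scale_right
      using uw beta_sym[of w u] uc bil_jf_swap[of _ v u] by (simp add: power2_eq_square mult.assoc)
  qed (use assms beta_nonneg in auto)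
qed

lemma partial_frame_extend:
  assumes pf: "partial_frame p u \<nu>" and "p < m"
  obtains u' \<nu>' where "partial_frame (Suc p) u' \<nu>'"
proof -
  let ?S = "unit_compl (2 * p) u"
  obtain x0 y0 where x0: "x0 \<in> ?S" "y0 \<in> ?S" "\<kappa> x0 y0 > 0"
    using kappa_positive_on_compl[OF assms] by blast
  have "\<exists>z\<in>?S \<times> ?S. \<forall>z'\<in>?S \<times> ?S. \<kappa> (fst z') (snd z') \<le> \<kappa> (fst z) (snd z)"
  proof (rule continuous_attains_sup)
    show "compact (?S \<times> ?S)" by (intro compact_Times compact_unit_compl)
    show "continuous_on (?S \<times> ?S) (\<lambda>z. \<kappa> (fst z) (snd z))"
      using bil_continuous continuous_on_subset by blast
  qed (use x0 in auto)
  then obtain x y where xy: "x \<in> ?S" "y \<in> ?S" and max: "\<And>x' y'. x' \<in> ?S \<Longrightarrow> y' \<in> ?S \<Longrightarrow> \<kappa> x' y' \<le> \<kappa> x y"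
    by fastforce
  have pos: "\<kappa> x y > 0" using max[OF x0(1,2)] x0(3) by linarith
  have xc: "x \<in> compl (2 * p) u" "\<beta> x x = 1" and yc: "y \<in> compl (2 * p) u" "\<beta> y y = 1"
    using xy by (auto simp: unit_compl_def)
  have kself: "\<kappa> z z = 0" for z using bil_jf_swap[of "2 * m" z z] by simp
  \<comment> \<open>The part of \<open>x\<close> that is \<open>\<beta>\<close>-orthogonal to
    \<open>y\<close> is \<open>\<kappa>\<close>-orthogonal to \<open>x\<close>; as
    \<open>\<kappa> x x = 0\<close>, this leaves
    \<open>\<beta> x y * \<kappa> x y = 0\<close>.\<close>
  have xy0: "\<beta> x y = 0"
  proof -
    let ?w = "\<lambda>a. 1 * x a + (- \<beta> x y) * y a"
    have "?w \<in> compl (2 * p) u" by (intro compl_combination xc yc)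
    moreover have "\<beta> y ?w = 0" unfolding bil_add_right bil_scale_right using yc beta_sym[of x y] by simp
    ultimately have "\<kappa> x ?w = 0" using maximal_pair_orthogonal(1)[OF xy pos, of ?w] max by blast
    then show ?thesis unfolding bil_add_right bil_scale_right using pos kself[of x] by simp
  qed
  define u' where "u' = u(2 * p := x, Suc (2 * p) := y)"
  define \<nu>' where "\<nu>' = \<nu>(p := \<kappa> x y)"
  have u'_old: "u' r = u r" if "r < 2 * p" for r using that by (simp add: u'_def)
  have u'_new: "u' (2 * p) = x" "u' (Suc (2 * p)) = y" by (simp_all add: u'_def)
  have cases_r: "r < 2 * p \<or> r = 2 * p \<or> r = Suc (2 * p)" if "r < 2 * Suc p" for r using that by auto
  have sub: "w \<in> compl (2 * p) u \<and> \<beta> x w = 0 \<and> \<beta> y w = 0" if "w \<in> compl (2 * Suc p) u'" for w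
  proof -
    have *: "\<beta> (u' r) w = 0" if "r < 2 * Suc p" for r using \<open>w \<in> compl (2 * Suc p) u'\<close> that by (simp add: compl_def)
    have "\<beta> (u r) w = 0" if "r < 2 * p" for r using *[of r] that by (simp add: u'_old)
    then show ?thesis using *[of "2 * p"] *[of "Suc (2 * p)"] that by (simp add: u'_new compl_def)
  qed
  have subu: "unit_compl (2 * Suc p) u' \<subseteq> ?S" using sub by (auto simp: unit_compl_def)
  have beta_old: "\<beta> (u r) (u s) = (if r = s then 1 else 0)" if "r < 2 * p" "s < 2 * p" for r s
    using pf that by (simp add: partial_frame_def)
  have kappa_old: "\<kappa> (u r) (u s) = jf r s * \<nu> (r div 2)" if "r < 2 * p" "s < 2 * p" for r s
    using pf that by (simp add: partial_frame_def)
  have kappa_compl: "\<kappa> (u r) w = 0" if "r < 2 * p" "w \<in> compl (2 * p) u" for r w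
    using pf that by (simp add: partial_frame_def)
  have beta_new: "\<beta> (u r) x = 0" "\<beta> (u r) y = 0" "\<beta> x (u r) = 0" "\<beta> y (u r) = 0" if "r < 2 * p" for r
    using xc yc that beta_sym[of x "u r"] beta_sym[of y "u r"] by (auto simp: compl_def)
  have kappa_new: "\<kappa> (u r) x = 0" "\<kappa> (u r) y = 0" "\<kappa> x (u r) = 0" "\<kappa> y (u r) = 0" if "r < 2 * p" for r
    using kappa_compl[OF that xc(1)] kappa_compl[OF that yc(1)] bil_jf_swap[of _ x "u r"] bil_jf_swap[of _ y "u r"] by auto
  have jf0: "jf r (2 * p) = 0" "jf r (Suc (2 * p)) = 0" "jf (2 * p) r = 0" "jf (Suc (2 * p)) r = 0" if "r < 2 * p" for r
    using that by (auto simp: jf_def) presburger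
  have yx0: "\<beta> y x = 0" using xy0 beta_sym[of y x] by simp
  have kyx: "\<kappa> y x = - \<kappa> x y" by (rule bil_jf_swap)
  have "partial_frame (Suc p) u' \<nu>'"
    unfolding partial_frame_def
  proof (intro conjI allI impI ballI)
    fix r s assume rs: "r < 2 * Suc p" "s < 2 * Suc p"
    show "\<beta> (u' r) (u' s) = (if r = s then 1 else 0)"
      using cases_r[OF rs(1)] cases_r[OF rs(2)]
      by (elim disjE) (simp_all add: u'_old u'_new beta_old beta_new xy0 yx0 xc yc)
    show "\<kappa> (u' r) (u' s) = jf r s * \<nu>' (r div 2)"
      using cases_r[OF rs(1)] cases_r[OF rs(2)]
      by (elim disjE) (simp_all add: u'_old u'_new kappa_old kappa_new jf0 kself kyx \<nu>'_def, auto simp: jf_def)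
  next
    fix r a assume "r < 2 * Suc p" "2 * m \<le> a"
    with cases_r[of r] consider "r < 2 * p" | "r = 2 * p" | "r = Suc (2 * p)" by blast
    then show "u' r a = 0"
      using \<open>2 * m \<le> a\<close> xc yc pf by cases (auto simp: u'_old u'_new compl_def partial_frame_def)
  next
    fix r w assume r: "r < 2 * Suc p" and w: "w \<in> compl (2 * Suc p) u'"
    have 1: "\<kappa> x w = 0" by (rule maximal_pair_orthogonal(1)[OF xy pos max]) (use sub[OF w] in auto)
    have 2: "\<kappa> y w = 0" by (rule maximal_pair_orthogonal(2)[OF xy pos max]) (use sub[OF w] in auto)
    show "\<kappa> (u' r) w = 0"
      using cases_r[OF r] 1 2 sub[OF w] by (elim disjE) (auto simp: u'_old u'_new kappa_compl)
  next
    fix r assume "r < Suc p"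
    then show "\<nu>' r > 0" using pf pos by (auto simp: partial_frame_def \<nu>'_def less_Suc_eq)
  next
    fix r x' y' assume r: "r < Suc p" and "x' \<in> unit_compl (2 * Suc p) u'" "y' \<in> unit_compl (2 * Suc p) u'"
    then have "x' \<in> ?S" "y' \<in> ?S" using subu by auto
    then show "\<kappa> x' y' \<le> \<nu>' r" using max r pf by (auto simp: \<nu>'_def partial_frame_def less_Suc_eq)
  next
    fix r s assume "r < s" "s < Suc p"
    then show "\<nu>' s \<le> \<nu>' r" using xy pf by (auto simp: \<nu>'_def partial_frame_def less_Suc_eq)
  qed
  then show ?thesis by (rule that)
qed

lemma full_frame: obtains u \<nu> where "partial_frame m u \<nu>"
proof -
  have "\<exists>u \<nu>. partial_frame p u \<nu>" if "p \<le> m" for p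
    using that
  proof (induction p)
    case 0 show ?case by (auto simp: partial_frame_def)
  next
    case (Suc p) then show ?case using partial_frame_extend by (metis Suc_le_lessD less_or_eq_imp_le)
  qed
  then show ?thesis using that by blast
qed

end

text \<open>Frame vectors enter as rows and give \<open>M J M\<^sup>T = J\<close>, whereas
  \<open>symplectic\<close> asks for the transposed identity. Since \<open>J\<^sup>2 = -1\<close>,
  the former exhibits a right inverse of \<open>M\<close>, which for a square matrix is also a left
  inverse.\<close>

lemma symplectic_transpose:
  assumes M: "M \<in> carrier_mat (2 * m) (2 * m)" and MJ: "M * symp_form m * transpose_mat M = symp_form m"
  shows "transpose_mat M * symp_form m * M = symp_form m"
proof -
  let ?J = "symp_form m" and ?n = "2 * m"
  have J: "?J \<in> carrier_mat ?n ?n" by simp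
  have T: "transpose_mat M \<in> carrier_mat ?n ?n" using M by simp
  have JJ: "?J * ?J = - 1\<^sub>m ?n"
  proof (rule eq_matI)
    fix a b assume "a < dim_row (- 1\<^sub>m ?n :: real mat)" "b < dim_col (- 1\<^sub>m ?n :: real mat)"
    then have ab: "a < 2 * m" "b < 2 * m" by auto
    have "(?J * ?J) $$ (a, b) = (\<Sum>c<2 * m. jf a c * jf c b)"
      using ab J by (simp add: scalar_prod_def symp_form_index atLeast0LessThan)
    also have "\<dots> = (-1) ^ a * jf (partner a) b" using ab by (rule_tac sum_jf_left)
    also have "\<dots> = (- 1\<^sub>m ?n :: real mat) $$ (a, b)"
      using ab by (auto simp: jf_partner) (auto simp: partner_def)
    finally show "(?J * ?J) $$ (a, b) = (- 1\<^sub>m ?n) $$ (a, b)" .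
  qed (use J in auto)
  define K where "K = - ?J"
  have K: "K \<in> carrier_mat ?n ?n" using J by (simp add: K_def)
  have JK: "?J * K = 1\<^sub>m ?n" using J JJ by (simp add: K_def)
  have "M * (?J * transpose_mat M * K) = (M * ?J * transpose_mat M) * K"
    using M J T K mult_carrier_mat[OF J T] mult_carrier_mat[OF M J] by (simp add: assoc_mult_mat[of _ ?n ?n _ ?n _ ?n])
  also have "\<dots> = 1\<^sub>m ?n" unfolding MJ by (rule JK)
  finally have "(?J * transpose_mat M * K) * M = 1\<^sub>m ?n"
    by (rule mat_mult_left_right_inverse[OF M mult_carrier_mat[OF mult_carrier_mat[OF J T] K]])
  then have "?J = ?J * ((?J * transpose_mat M * K) * M)" using J by simp
  also have "(?J * transpose_mat M * K) * M = (?J * transpose_mat M) * (K * M)"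
    by (rule assoc_mult_mat[OF mult_carrier_mat[OF J T] K M])
  also have "\<dots> = ?J * (transpose_mat M * (K * M))"
    by (rule assoc_mult_mat[OF J T mult_carrier_mat[OF K M]])
  also have "?J * (?J * (transpose_mat M * (K * M))) = (?J * ?J) * (transpose_mat M * (K * M))"
    by (rule assoc_mult_mat[OF J J mult_carrier_mat[OF T mult_carrier_mat[OF K M]], symmetric])
  also have "\<dots> = transpose_mat M * (?J * M)"
    unfolding JJ K_def using M J T by simp
  also have "\<dots> = transpose_mat M * ?J * M"
    by (rule assoc_mult_mat[OF T J M, symmetric])
  finally show ?thesis by simp
qed

lemma triple_product_index:
  assumes "M \<in> carrier_mat n n" "B \<in> carrier_mat n n" "r < n" "s < n"
  shows "(M * B * transpose_mat M) $$ (r, s) = bil n (\<lambda>a b. B $$ (a, b)) (\<lambda>a. M $$ (r, a)) (\<lambda>b. M $$ (s, b))"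
  using assms by (simp add: scalar_prod_def bil_def sum_distrib_left atLeast0LessThan mult.assoc)

theorem williamson_exists:
  assumes B: "B \<in> carrier_mat (2 * m) (2 * m)" and cf: "coercive_form m (\<lambda>a b. B $$ (a, b)) c"
  obtains ds where "length ds = m" "williamson_form B ds"
proof -
  interpret coercive_form m "\<lambda>a b. B $$ (a, b)" c by (rule cf)
  obtain u \<nu> where pf: "partial_frame m u \<nu>" by (rule full_frame)
  have \<nu>: "\<nu> r > 0" if "r < m" for r using pf that by (simp add: partial_frame_def)
  define ds where "ds = map (\<lambda>r. 1 / \<nu> r) [0..<m]"
  \<comment> \<open>In the frame \<open>\<beta>\<close> is standard and \<open>\<kappa>\<close> is
    \<open>J\<close> scaled by \<open>\<nu>\<close>. Dividing both vectors of a pair by the root of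
    its \<open>\<nu>\<close> turns \<open>\<kappa>\<close> into \<open>J\<close> and
    \<open>\<beta>\<close> into a diagonal with entries \<open>1 / \<nu>\<close>.\<close>
  define M where "M = mat (2 * m) (2 * m) (\<lambda>(r, a). sqrt (1 / \<nu> (r div 2)) * u r a)"
  have M: "M \<in> carrier_mat (2 * m) (2 * m)" by (simp add: M_def)
  have len: "length ds = m" by (simp add: ds_def)
  have bilM: "bil (2 * m) C (\<lambda>a. M $$ (r, a)) (\<lambda>b. M $$ (s, b)) = sqrt (1 / \<nu> (r div 2)) * (sqrt (1 / \<nu> (s div 2)) * bil (2 * m) C (u r) (u s))"
    if "r < 2 * m" "s < 2 * m" for C r s
  proof -
    have "bil (2 * m) C (\<lambda>a. M $$ (r, a)) (\<lambda>b. M $$ (s, b)) = bil (2 * m) C (\<lambda>a. sqrt (1 / \<nu> (r div 2)) * u r a) (\<lambda>b. sqrt (1 / \<nu> (s div 2)) * u s b)"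
      unfolding bil_def using that by (intro sum.cong refl) (simp add: M_def)
    then show ?thesis by (simp only: bil_scale_left bil_scale_right)
  qed
  have sq: "sqrt (1 / \<nu> i) * (sqrt (1 / \<nu> i) * z) = z / \<nu> i" if "i < m" for i z
    using \<nu>[OF that] by (simp add: real_sqrt_divide field_simps)
  have "M * symp_form m * transpose_mat M = symp_form m"
  proof (rule eq_matI)
    fix r s assume "r < dim_row (symp_form m)" "s < dim_col (symp_form m)"
    then have rs: "r < 2 * m" "s < 2 * m" using symp_form_carrier[of m] by (metis carrier_matD)+
    have d: "r div 2 < m" using rs by auto
    have "(M * symp_form m * transpose_mat M) $$ (r, s) = bil (2 * m) (\<lambda>a b. symp_form m $$ (a, b)) (\<lambda>a. M $$ (r, a)) (\<lambda>b. M $$ (s, b))"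
      by (rule triple_product_index) (use M rs in auto)
    also have "\<dots> = \<kappa> (\<lambda>a. M $$ (r, a)) (\<lambda>b. M $$ (s, b))"
      unfolding bil_def by (intro sum.cong refl) (simp add: symp_form_index)
    also have "\<dots> = sqrt (1 / \<nu> (r div 2)) * (sqrt (1 / \<nu> (s div 2)) * (jf r s * \<nu> (r div 2)))"
      using bilM[OF rs] pf rs by (simp add: partial_frame_def)
    also have "\<dots> = jf r s"
    proof (cases "(jf r s :: real) = 0")
      case False
      then have "s div 2 = r div 2" using jf_nonzero_div by metis
      then show ?thesis using sq[OF d] \<nu>[OF d] by simp
    qed simp
    finally show "(M * symp_form m * transpose_mat M) $$ (r, s) = symp_form m $$ (r, s)"
      using rs by (simp add: symp_form_index)
  qed (use M symp_form_carrier[of m] in \<open>auto simp del: symp_form_carrier\<close>)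
  then have symp: "symplectic m M" using symplectic_transpose[OF M] M by (simp add: symplectic_def)
  have diag: "M * B * transpose_mat M = diag_block_mat (map (\<lambda>d. d \<cdot>\<^sub>m 1\<^sub>m 2) ds)"
  proof (rule eq_matI)
    have dims: "dim_row (diag_block_mat (map (\<lambda>d. d \<cdot>\<^sub>m 1\<^sub>m 2) ds)) = 2 * m" "dim_col (diag_block_mat (map (\<lambda>d. d \<cdot>\<^sub>m 1\<^sub>m 2) ds)) = 2 * m"
      using williamson_diag_carrier[of ds] len by auto
    fix r s assume "r < dim_row (diag_block_mat (map (\<lambda>d. d \<cdot>\<^sub>m 1\<^sub>m 2) ds))" "s < dim_col (diag_block_mat (map (\<lambda>d. d \<cdot>\<^sub>m 1\<^sub>m 2) ds))"
    then have rs: "r < 2 * m" "s < 2 * m" unfolding dims .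
    have d: "r div 2 < m" using rs by auto
    have "(M * B * transpose_mat M) $$ (r, s) = sqrt (1 / \<nu> (r div 2)) * (sqrt (1 / \<nu> (s div 2)) * (if r = s then 1 else 0))"
      using triple_product_index[OF M B rs] bilM[OF rs] pf rs by (simp add: partial_frame_def)
    also have "\<dots> = (if r = s then ds ! (r div 2) else 0)"
      using sq[OF d, of 1] d by (auto simp: ds_def)
    finally show "(M * B * transpose_mat M) $$ (r, s) = diag_block_mat (map (\<lambda>d. d \<cdot>\<^sub>m 1\<^sub>m 2) ds) $$ (r, s)"
      using rs len by (simp add: williamson_diag_index)
  qed (use M B williamson_diag_carrier[of ds] len in auto)
  have "sorted ds"
    unfolding sorted_iff_nth_mono_less
  proof (intro allI impI)
    fix i j assume "i < j" "j < length ds"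
    then have "\<nu> j \<le> \<nu> i" "\<nu> j > 0" "i < m" "j < m" using pf \<nu>[of j] len by (auto simp: partial_frame_def)
    then show "ds ! i \<le> ds ! j" by (simp add: ds_def frac_le)
  qed
  moreover have "\<forall>d\<in>set ds. 0 < d" using \<nu> by (auto simp: ds_def)
  ultimately have "williamson_form B ds"
    unfolding williamson_form_def len using B symp diag by blast
  then show ?thesis using that len by blast
qed

section \<open>Power sums of symplectic eigenvalues\<close>

lemma mpow_cong:
  assumes "\<And>a b. a < n \<Longrightarrow> b < n \<Longrightarrow> X a b = Y a b" "a < n"
  shows "mpow n X q a b = mpow n Y q a b"
  using assms(2) by (induction q arbitrary: a) (auto intro!: sum.cong simp: assms(1))

lemma mpow_of_real: "mpow n (\<lambda>a b. complex_of_real (X a b)) q a b = complex_of_real (mpow n X q a b)"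
  by (induction q arbitrary: a) auto

lemma mult_mat_index:
  assumes "A \<in> carrier_mat n n" "B \<in> carrier_mat n n" "r < n" "s < n"
  shows "(A * B) $$ (r, s) = (\<Sum>c<n. A $$ (r, c) * B $$ (c, s))"
  using assms by (simp add: scalar_prod_def atLeast0LessThan)

text \<open>\<open>N\<close> is invertible, so \<open>X\<close> and \<open>Y\<close> are similar,
  with the same similarity for all powers, and the trace is cyclic.\<close>

lemma mpow_intertwine:
  fixes X Y N L :: "real mat"
  assumes [simp]: "X \<in> carrier_mat n n" "Y \<in> carrier_mat n n" "N \<in> carrier_mat n n" "L \<in> carrier_mat n n"
    and XN: "X * N = N * Y" and NL: "N * L = 1\<^sub>m n"
  shows "(\<Sum>r<n. mpow n (\<lambda>a b. X $$ (a, b)) q r r) = (\<Sum>r<n. mpow n (\<lambda>a b. Y $$ (a, b)) q r r)"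
proof -
  define P where "P = (\<lambda>(Z::real mat) q. mat n n (\<lambda>(a, b). mpow n (\<lambda>a b. Z $$ (a, b)) q a b))"
  have P [simp]: "P Z q \<in> carrier_mat n n" for Z q by (simp add: P_def)
  have P0: "P Z 0 = 1\<^sub>m n" for Z by (auto simp: P_def)
  have PS: "P Z (Suc q) = Z * P Z q" if "Z \<in> carrier_mat n n" for Z q
    using that by (intro eq_matI) (auto simp: P_def scalar_prod_def atLeast0LessThan)
  have PN: "P X q * N = N * P Y q" for q
  proof (induction q)
    case (Suc q)
    have "P X (Suc q) * N = X * (P X q * N)" by (simp add: PS assoc_mult_mat[of _ n n _ n _ n])
    also have "\<dots> = (X * N) * P Y q" unfolding Suc by (simp add: assoc_mult_mat[of _ n n _ n _ n])
    also have "\<dots> = N * P Y (Suc q)" unfolding XN by (simp add: PS assoc_mult_mat[of _ n n _ n _ n])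
    finally show ?case .
  qed (simp add: P0 left_mult_one_mat[of _ n n] right_mult_one_mat[of _ n n])
  have LN: "L * N = 1\<^sub>m n" by (rule mat_mult_left_right_inverse[OF _ _ NL]) auto
  have "P X q = P X q * (N * L)" by (simp add: NL right_mult_one_mat[of _ n n])
  also have "\<dots> = (P X q * N) * L" by (simp add: assoc_mult_mat[of _ n n _ n _ n])
  also have "\<dots> = N * P Y q * L" unfolding PN ..
  finally have eq: "P X q = N * P Y q * L" .
  have "(\<Sum>r<n. mpow n (\<lambda>a b. X $$ (a, b)) q r r) = (\<Sum>r<n. P X q $$ (r, r))" by (simp add: P_def)
  also have "\<dots> = (\<Sum>r<n. \<Sum>s<n. (N * P Y q) $$ (r, s) * L $$ (s, r))"
    unfolding eq by (intro sum.cong refl mult_mat_index mult_carrier_mat[of _ n n]) auto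
  also have "\<dots> = (\<Sum>s<n. \<Sum>r<n. L $$ (s, r) * (N * P Y q) $$ (r, s))"
    by (subst sum.swap) (simp add: mult.commute)
  also have "\<dots> = (\<Sum>s<n. (L * (N * P Y q)) $$ (s, s))"
    by (intro sum.cong refl mult_mat_index[symmetric] mult_carrier_mat[of _ n n]) auto
  also have "L * (N * P Y q) = (L * N) * P Y q" by (simp add: assoc_mult_mat[of _ n n _ n _ n])
  also have "\<dots> = P Y q" by (simp add: LN left_mult_one_mat[of _ n n])
  finally show ?thesis by (simp add: P_def)
qed

definition jmul :: "nat \<Rightarrow> (nat \<Rightarrow> nat \<Rightarrow> 'a::comm_ring_1) \<Rightarrow> nat \<Rightarrow> nat \<Rightarrow> 'a" where
  "jmul n B a b = (\<Sum>c<n. jf a c * B c b)"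

text \<open>Inserting \<open>J = M\<^sup>T J M\<close> gives
  \<open>J B M\<^sup>T = M\<^sup>T (J D)\<close>, so \<open>J B\<close> is similar to
  \<open>J D\<close> with \<open>D\<close> the Williamson form. The square of \<open>J D\<close> is
  \<open>- D\<^sup>2\<close>, and every symplectic eigenvalue occurs twice on the diagonal of
  \<open>D\<close>.\<close>

lemma williamson_trace:
  assumes "williamson_form B ds"
  defines "n \<equiv> 2 * length ds"
  shows "(\<Sum>r<n. mpow n (jmul n (\<lambda>a b. B $$ (a, b))) (2 * q) r r) = 2 * (-1) ^ q * (\<Sum>d\<leftarrow>ds. d ^ (2 * q))"
proof -
  define m where "m = length ds"
  define J where "J = symp_form m"
  define D where "D = diag_block_mat (map (\<lambda>d. d \<cdot>\<^sub>m 1\<^sub>m 2) ds)"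
  define K where "K = - J"
  have nm: "n = 2 * m" by (simp add: n_def m_def)
  obtain M where M: "M \<in> carrier_mat n n" "transpose_mat M * J * M = J" "M * B * transpose_mat M = D"
    using assms by (auto simp: williamson_form_def symplectic_def n_def J_def D_def m_def)
  have B: "B \<in> carrier_mat n n" using assms by (simp add: williamson_form_def)
  have J: "J \<in> carrier_mat n n" by (simp add: J_def nm)
  have D: "D \<in> carrier_mat n n" using williamson_diag_carrier by (simp add: D_def n_def)
  have K: "K \<in> carrier_mat n n" using J by (simp add: K_def)
  have JK: "J * K = 1\<^sub>m n"
  proof (rule eq_matI)
    fix a b assume "a < dim_row (1\<^sub>m n :: real mat)" "b < dim_col (1\<^sub>m n :: real mat)"
    then have ab: "a < 2 * m" "b < 2 * m" by (auto simp: nm)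
    have "(J * K) $$ (a, b) = - (\<Sum>c<2 * m. jf a c * jf c b)"
      using ab by (simp add: K_def J_def scalar_prod_def symp_form_index atLeast0LessThan)
    also have "\<dots> = - ((-1) ^ a * jf (partner a) b)" using sum_jf_left[OF ab(1), of "\<lambda>c. jf c b"] by simp
    also have "\<dots> = (1\<^sub>m n) $$ (a, b)" using ab by (auto simp: jf_partner nm) (auto simp: partner_def)
    finally show "(J * K) $$ (a, b) = (1\<^sub>m n) $$ (a, b)" .
  qed (use J K in auto)
  let ?N = "transpose_mat M"
  have N: "?N \<in> carrier_mat n n" using M by simp
  note c = M(1) N B J D K mult_carrier_mat[OF J M(1)] mult_carrier_mat[OF N J] mult_carrier_mat[OF J B] mult_carrier_mat[OF M(1) B]
    mult_carrier_mat[OF B N] mult_carrier_mat[OF M(1) mult_carrier_mat[OF B N]] mult_carrier_mat[OF mult_carrier_mat[OF J M(1)] K]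
    mult_carrier_mat[OF M(1) K] mult_carrier_mat[OF J D]
  have "J * B * ?N = (?N * J * M) * B * ?N" by (simp add: M(2))
  also have "\<dots> = ?N * J * (M * B * ?N)" using c by (simp add: assoc_mult_mat[of _ n n _ n _ n])
  also have "\<dots> = ?N * (J * D)" unfolding M(3) using c by (simp add: assoc_mult_mat[of _ n n _ n _ n])
  finally have XN: "(J * B) * ?N = ?N * (J * D)" .
  have "?N * (J * M * K) = (?N * J * M) * K" using c by (simp add: assoc_mult_mat[of _ n n _ n _ n])
  then have NL: "?N * (J * M * K) = 1\<^sub>m n" by (simp add: M(2) JK)
  have "(\<Sum>r<n. mpow n (jmul n (\<lambda>a b. B $$ (a, b))) (2 * q) r r) = (\<Sum>r<n. mpow n (\<lambda>a b. (J * B) $$ (a, b)) (2 * q) r r)"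
    by (intro sum.cong refl mpow_cong)
      (use B in \<open>auto simp: jmul_def J_def nm symp_form_index scalar_prod_def atLeast0LessThan\<close>)
  also have "\<dots> = (\<Sum>r<n. mpow n (\<lambda>a b. (J * D) $$ (a, b)) (2 * q) r r)"
    by (rule mpow_intertwine[OF _ _ _ _ XN NL]) (use c in auto)
  also have "\<dots> = (\<Sum>r<n. mpow n (\<lambda>a b. jf a b * ds ! (b div 2)) (2 * q) r r)"
  proof (intro sum.cong refl mpow_cong)
    fix a b assume ab: "a < n" "b < n"
    have "(J * D) $$ (a, b) = (\<Sum>c<2 * m. jf a c * D $$ (c, b))"
      using ab D by (simp add: J_def nm scalar_prod_def symp_form_index atLeast0LessThan)
    also have "\<dots> = (\<Sum>c<2 * m. if c = b then jf a b * ds ! (b div 2) else 0)"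
      using ab by (intro sum.cong refl) (auto simp: D_def williamson_diag_index n_def m_def)
    finally show "(J * D) $$ (a, b) = jf a b * ds ! (b div 2)" using ab nm by simp
  qed auto
  also have "\<dots> = (\<Sum>r<n. (-1) ^ q * (ds ! (r div 2)) ^ (2 * q))"
  proof (rule sum.cong[OF refl])
    fix r assume r: "r \<in> {..<n}"
    let ?Y = "\<lambda>a b. jf a b * ds ! (b div 2)"
    \<comment> \<open>Row \<open>a\<close> of \<open>J D\<close> has one nonzero entry, so two
      factors lead from \<open>r\<close> to its partner and back. The two indices have opposite
      parity, hence one sign change per double step.\<close>
    have step: "(\<Sum>c<n. ?Y a c * f c) = (-1) ^ a * ds ! (a div 2) * f (partner a)" if "a < n" for a f
      using sum_jf_left[of a m "\<lambda>c. ds ! (c div 2) * f c"] that by (simp add: nm mult.assoc partner_div)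
    show "mpow n ?Y (2 * q) r r = (-1) ^ q * (ds ! (r div 2)) ^ (2 * q)"
    proof (induction q)
      case (Suc q)
      have pr: "partner r < n" using r partner_less nm by simp
      have "mpow n ?Y (2 * Suc q) r r = (\<Sum>c<n. ?Y r c * (\<Sum>e<n. ?Y c e * mpow n ?Y (2 * q) e r))" by simp
      also have "\<dots> = (-1) ^ r * ds ! (r div 2) * (\<Sum>e<n. ?Y (partner r) e * mpow n ?Y (2 * q) e r)"
        using r by (subst step) auto
      also have "\<dots> = (-1) ^ r * ds ! (r div 2) * ((-1) ^ partner r * ds ! (r div 2) * mpow n ?Y (2 * q) r r)"
        by (subst step[OF pr]) (simp add: partner_div)
      also have "\<dots> = ((-1) ^ r * (-1) ^ partner r) * (ds ! (r div 2))\<^sup>2 * mpow n ?Y (2 * q) r r"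
        by (simp add: power2_eq_square mult_ac)
      also have "(-1) ^ r * (-1) ^ partner r = (-1 :: real)" using even_partner[of r] by (cases "even r") auto
      finally show ?case unfolding Suc by (simp add: power2_eq_square mult_ac)
    qed simp
  qed
  also have "\<dots> = (-1) ^ q * (\<Sum>r<m * 2. (ds ! (r div 2)) ^ (2 * q))"
    by (simp add: sum_distrib_left nm mult.commute)
  also have "(\<Sum>r<m * 2. (ds ! (r div 2)) ^ (2 * q)) = (\<Sum>i<m. \<Sum>a<2. (ds ! ((i * 2 + a) div 2)) ^ (2 * q))"
    by (rule sum_blocks)
  also have "\<dots> = 2 * (\<Sum>i<m. (ds ! i) ^ (2 * q))"
  proof -
    have "(\<Sum>a<2. (ds ! ((i * 2 + a) div 2)) ^ (2 * q)) = (\<Sum>a<(2::nat). (ds ! i) ^ (2 * q))" for i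
      by (rule sum.cong) auto
    then show ?thesis by (simp add: sum_distrib_left)
  qed
  also have "(\<Sum>i<m. (ds ! i) ^ (2 * q)) = (\<Sum>d\<leftarrow>ds. d ^ (2 * q))"
    by (simp add: sum_list_sum_nth m_def atLeast0LessThan)
  finally show ?thesis by simp
qed

section \<open>Uniqueness of the symplectic eigenvalues\<close>

lemma sum_list_poly_even:
  "(\<Sum>d\<leftarrow>ds. poly g (d\<^sup>2)) = (\<Sum>i\<le>degree g. coeff g i * (\<Sum>d\<leftarrow>ds. d ^ (2 * i)))" for ds :: "real list"
proof -
  have "(\<Sum>d\<leftarrow>ds. poly g (d\<^sup>2)) = (\<Sum>d\<leftarrow>ds. \<Sum>i\<le>degree g. coeff g i * d ^ (2 * i))"
    by (simp add: poly_altdef power_mult)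
  also have "\<dots> = (\<Sum>i\<le>degree g. coeff g i * (\<Sum>d\<leftarrow>ds. d ^ (2 * i)))"
    by (induction ds) (auto simp: sum.distrib distrib_left)
  finally show ?thesis .
qed

lemma sum_list_single_value:
  fixes f :: "'a \<Rightarrow> real"
  assumes "\<And>d. d \<in> set ds \<Longrightarrow> d \<noteq> x \<Longrightarrow> f d = 0"
  shows "(\<Sum>d\<leftarrow>ds. f d) = count_list ds x * f x"
  using assms by (induction ds) (auto simp: algebra_simps)

text \<open>The moments fix the sum of \<open>poly g (d\<^sup>2)\<close> for every polynomial
  \<open>g\<close>. One that vanishes at the squares of all other values isolates the multiplicity
  of \<open>x\<close>; positivity keeps the squares of distinct values distinct.\<close>

lemma power_sums_determine:
  fixes ds es :: "real list"
  assumes "\<And>q. (\<Sum>d\<leftarrow>ds. d ^ (2 * q)) = (\<Sum>d\<leftarrow>es. d ^ (2 * q))"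
    and pos: "\<forall>d\<in>set ds. 0 < d" "\<forall>d\<in>set es. 0 < d" and sorted: "sorted ds" "sorted es"
  shows "ds = es"
proof -
  have "count_list ds x = count_list es x" for x
  proof (cases "x \<in> set ds \<union> set es")
    case False then show ?thesis by (simp add: count_list_0_iff)
  next
    case True
    define g where "g = (\<Prod>y\<in>(set ds \<union> set es) - {x}. [:- (y\<^sup>2), 1:])"
    have g: "poly g z = (\<Prod>y\<in>(set ds \<union> set es) - {x}. z - y\<^sup>2)" for z by (simp add: g_def poly_prod)
    have ge: "poly g (d\<^sup>2) = 0" if "d \<in> set ds \<union> set es" "d \<noteq> x" for d
      unfolding g using that by (intro prod_zero) auto
    have "x\<^sup>2 - y\<^sup>2 \<noteq> 0" if "y \<in> (set ds \<union> set es) - {x}" for y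
    proof -
      have "0 < x" "0 < y" "x \<noteq> y" using that True pos by auto
      then show ?thesis by (simp add: power2_eq_iff)
    qed
    then have gx: "poly g (x\<^sup>2) \<noteq> 0" unfolding g by (subst prod_zero_iff) (simp, blast)
    have "count_list ds x * poly g (x\<^sup>2) = count_list es x * poly g (x\<^sup>2)"
      using sum_list_single_value[of ds x "\<lambda>d. poly g (d\<^sup>2)"] sum_list_single_value[of es x "\<lambda>d. poly g (d\<^sup>2)"] ge
      by (simp add: sum_list_poly_even assms(1))
    then show ?thesis using gx by simp
  qed
  then have "mset ds = mset es" by (intro multiset_eqI) (simp add: count_mset)
  then show ?thesis using sorted by (metis properties_for_sort sorted_sort_id)
qed

lemma williamson_unique:
  assumes "williamson_form B ds" "williamson_form B es" shows "ds = es"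
proof -
  have l: "length ds = length es" using assms by (auto simp: williamson_form_def)
  show ?thesis
  proof (rule power_sums_determine)
    fix q
    have "2 * (-1) ^ q * (\<Sum>d\<leftarrow>ds. d ^ (2 * q)) = 2 * (-1) ^ q * (\<Sum>d\<leftarrow>es. d ^ (2 * q))"
      using williamson_trace[OF assms(1), of q] williamson_trace[OF assms(2), of q] l by simp
    then show "(\<Sum>d\<leftarrow>ds. d ^ (2 * q)) = (\<Sum>d\<leftarrow>es. d ^ (2 * q))" by simp
  qed (use assms in \<open>auto simp: williamson_form_def\<close>)
qed

text \<open>Uniqueness resolves the definite description, so any Williamson list evaluates
  it.\<close>

lemma symp_eig_eq: "williamson_form B ds \<Longrightarrow> symp_eig B j = ds ! (j - 1)"
  unfolding symp_eig_def by (metis the_equality williamson_unique)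

section \<open>Upper bound for the symplectic eigenvalues\<close>

lemma sum_partner: "(\<Sum>a<2 * m. f (partner a)) = (\<Sum>a<2 * m. f a)"
  by (rule sum.reindex_bij_witness[of _ partner partner]) (auto intro: partner_less)

lemma mpow_column_norm:
  fixes X :: "nat \<Rightarrow> nat \<Rightarrow> real"
  assumes "\<And>x. (\<Sum>a<n. (\<Sum>b<n. X a b * x b)\<^sup>2) \<le> C\<^sup>2 * (\<Sum>a<n. (x a)\<^sup>2)" "b < n"
  shows "(\<Sum>a<n. (mpow n X q a b)\<^sup>2) \<le> (C ^ q)\<^sup>2"
proof (induction q)
  case 0
  have "(\<Sum>a<n. (mpow n X 0 a b)\<^sup>2) = (\<Sum>a<n. if a = b then 1 else 0)" by (intro sum.cong) auto
  then show ?case using assms(2) by simp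
next
  case (Suc q)
  have "(\<Sum>a<n. (mpow n X (Suc q) a b)\<^sup>2) \<le> C\<^sup>2 * (\<Sum>a<n. (mpow n X q a b)\<^sup>2)"
    using assms(1)[of "\<lambda>a. mpow n X q a b"] by simp
  also have "\<dots> \<le> C\<^sup>2 * (C ^ q)\<^sup>2" using Suc by (intro mult_left_mono) auto
  finally show ?case by (simp add: power_mult_distrib)
qed

text \<open>A spectral radius argument without eigenvectors. \<open>J\<close> preserves length, so
  \<open>C\<close> also bounds \<open>J B\<close>, and the trace of its power \<open>2 * q\<close>
  is at most the dimension times \<open>C ^ (2 * q)\<close>. A single value \<open>d > C\<close>
  would outgrow this.\<close>

theorem williamson_bound:
  assumes w: "williamson_form B ds" and "C > 0"
    and bound: "\<And>x. (\<Sum>a<2 * length ds. (\<Sum>b<2 * length ds. B $$ (a, b) * x b)\<^sup>2) \<le> C\<^sup>2 * (\<Sum>a<2 * length ds. (x a)\<^sup>2)"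
    and d: "d \<in> set ds"
  shows "d \<le> C"
proof (rule ccontr)
  assume "\<not> d \<le> C"
  define n where "n = 2 * length ds"
  let ?X = "jmul n (\<lambda>a b. B $$ (a, b))"
  have X: "(\<Sum>a<n. (\<Sum>b<n. ?X a b * x b)\<^sup>2) \<le> C\<^sup>2 * (\<Sum>a<n. (x a)\<^sup>2)" for x
  proof -
    have "(\<Sum>b<n. ?X a b * x b) = (-1) ^ a * (\<Sum>b<n. B $$ (partner a, b) * x b)" if "a < n" for a
    proof -
      have "(\<Sum>b<n. ?X a b * x b) = (\<Sum>c<n. jf a c * (\<Sum>b<n. B $$ (c, b) * x b))"
        unfolding jmul_def sum_distrib_right sum_distrib_left by (subst sum.swap) (simp add: mult.assoc)
      then show ?thesis using that by (simp add: n_def sum_jf_left)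
    qed
    then have "(\<Sum>a<n. (\<Sum>b<n. ?X a b * x b)\<^sup>2) = (\<Sum>a<n. (\<Sum>b<n. B $$ (partner a, b) * x b)\<^sup>2)"
      by (simp add: power_mult_distrib flip: power_mult)
    also have "\<dots> = (\<Sum>a<n. (\<Sum>b<n. B $$ (a, b) * x b)\<^sup>2)"
      unfolding n_def by (rule sum_partner[of "\<lambda>a. (\<Sum>b<2 * length ds. B $$ (a, b) * x b)\<^sup>2"])
    finally show ?thesis using bound[of x] by (simp add: n_def)
  qed
  have diag: "\<bar>mpow n ?X q r r\<bar> \<le> C ^ q" if "r < n" for q r
  proof -
    have "(mpow n ?X q r r)\<^sup>2 \<le> (\<Sum>a<n. (mpow n ?X q a r)\<^sup>2)" using that by (intro member_le_sum) auto
    also have "\<dots> \<le> (C ^ q)\<^sup>2" by (rule mpow_column_norm[OF X that])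
    finally show ?thesis using \<open>C > 0\<close> by (simp add: power2_le_iff_abs_le)
  qed
  have sum_le: "(\<Sum>d\<leftarrow>ds. d ^ (2 * q)) \<le> length ds * C ^ (2 * q)" for q
  proof -
    have "2 * (\<Sum>d\<leftarrow>ds. d ^ (2 * q)) = \<bar>2 * (-1) ^ q * (\<Sum>d\<leftarrow>ds. d ^ (2 * q))\<bar>"
    proof -
      have "0 \<le> (\<Sum>d\<leftarrow>ds. d ^ (2 * q))" by (intro sum_list_nonneg) auto
      then show ?thesis by (simp add: abs_mult)
    qed
    also have "\<dots> = \<bar>\<Sum>r<n. mpow n ?X (2 * q) r r\<bar>"
      using williamson_trace[OF w, of q] by (simp add: n_def)
    also have "\<dots> \<le> (\<Sum>r<n. \<bar>mpow n ?X (2 * q) r r\<bar>)" by (rule sum_abs)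
    also have "\<dots> \<le> (\<Sum>r<n. C ^ (2 * q))" by (intro sum_mono diag) simp
    finally show ?thesis by (simp add: n_def)
  qed
  have "d > 0" using w d by (auto simp: williamson_form_def)
  have "((d / C)\<^sup>2) ^ q \<le> length ds" for q
  proof -
    have "d ^ (2 * q) \<le> (\<Sum>d\<leftarrow>ds. d ^ (2 * q))"
      using d by (intro member_le_sum_list) auto
    also note sum_le
    finally show ?thesis using \<open>C > 0\<close> by (simp add: power_divide field_simps flip: power_mult)
  qed
  moreover have "1 < (d / C)\<^sup>2" using \<open>\<not> d \<le> C\<close> \<open>C > 0\<close> by (intro one_less_power) auto
  ultimately show False using real_arch_pow[of "(d / C)\<^sup>2" "real (length ds)"] by (meson not_le)
qed

section \<open>From the block Toeplitz operator to its truncations\<close>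

lemma vec_norm2_sq: "(vec_norm2 v)\<^sup>2 = (\<Sum>i<dim_vec v. (cmod (v $ i))\<^sup>2)"
  by (simp add: vec_norm2_def sum_nonneg)

lemma cscalar_index: "dim_vec v = n \<Longrightarrow> dim_vec w = n \<Longrightarrow> v \<bullet>c w = (\<Sum>i<n. v $ i * cnj (w $ i))"
  by (simp add: scalar_prod_def atLeast0LessThan)

lemma re_mult_le:
  assumes "K > 0" shows "cmod (z * w) \<le> ((cmod z)\<^sup>2 / K + K * (cmod w)\<^sup>2) / 2"
proof -
  have "0 \<le> (cmod z - K * cmod w)\<^sup>2 / K" using assms by simp
  also have "\<dots> = (cmod z)\<^sup>2 / K + K * (cmod w)\<^sup>2 - 2 * (cmod z * cmod w)"
    using assms by (simp add: field_simps power2_eq_square)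
  finally show ?thesis by (simp add: norm_mult)
qed

lemma cscalar_le:
  assumes "K > 0" "dim_vec v = n" "dim_vec w = n"
  shows "cmod (v \<bullet>c w) \<le> ((vec_norm2 v)\<^sup>2 / K + K * (vec_norm2 w)\<^sup>2) / 2"
proof -
  have "cmod (v \<bullet>c w) \<le> (\<Sum>i<n. cmod (v $ i * cnj (w $ i)))"
    using assms by (simp only: cscalar_index) (rule norm_sum)
  also have "\<dots> \<le> (\<Sum>i<n. ((cmod (v $ i))\<^sup>2 / K + K * (cmod (w $ i))\<^sup>2) / 2)"
    using re_mult_le[OF assms(1), of "v $ _" "cnj (w $ _)"] by (intro sum_mono) simp
  also have "\<dots> = ((vec_norm2 v)\<^sup>2 / K + K * (vec_norm2 w)\<^sup>2) / 2"
    using assms by (simp add: vec_norm2_sq sum.distrib sum_divide_distrib sum_distrib_left add_divide_distrib)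
  finally show ?thesis .
qed

lemma l2_summable: "x \<in> l2 N \<Longrightarrow> summable (\<lambda>i. (vec_norm2 (x i))\<^sup>2)"
  by (simp add: l2_def)

lemma l2_dim: "x \<in> l2 N \<Longrightarrow> dim_vec (x i) = N"
  by (auto simp: l2_def)

lemma l2_inner_summable:
  assumes "x \<in> l2 N" "y \<in> l2 N" shows "summable (\<lambda>i. y i \<bullet>c x i)"
proof (rule summable_comparison_test)
  show "\<exists>n0. \<forall>n\<ge>n0. norm (y n \<bullet>c x n) \<le> ((vec_norm2 (y n))\<^sup>2 / 1 + 1 * (vec_norm2 (x n))\<^sup>2) / 2"
    using cscalar_le[of 1, OF _ l2_dim[OF assms(2)] l2_dim[OF assms(1)]] by simp
  show "summable (\<lambda>n. ((vec_norm2 (y n))\<^sup>2 / 1 + 1 * (vec_norm2 (x n))\<^sup>2) / 2)"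
    using assms by (intro summable_divide summable_add) (auto simp: l2_summable)
qed

lemma l2_norm_sq: "x \<in> l2 N \<Longrightarrow> (l2_norm x)\<^sup>2 = (\<Sum>i. (vec_norm2 (x i))\<^sup>2)"
  by (simp add: l2_norm_def l2_summable suminf_nonneg)

lemma l2_norm_nonneg: "x \<in> l2 N \<Longrightarrow> 0 \<le> l2_norm x"
  by (simp add: l2_norm_def l2_summable suminf_nonneg)

text \<open>A weighted AM-GM inequality summed over all entries; with the free weight
  \<open>K\<close> it does the work of Cauchy-Schwarz.\<close>

lemma l2_inner_le:
  assumes x: "x \<in> l2 N" and y: "y \<in> l2 N" and "K > 0"
  shows "Re (l2_inner x y) \<le> ((l2_norm y)\<^sup>2 / K + K * (l2_norm x)\<^sup>2) / 2"
proof -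
  have "Re (l2_inner x y) = (\<Sum>i. Re (y i \<bullet>c x i))"
    unfolding l2_inner_def by (rule Re_suminf[OF l2_inner_summable[OF x y]])
  also have "\<dots> \<le> (\<Sum>i. ((vec_norm2 (y i))\<^sup>2 / K + K * (vec_norm2 (x i))\<^sup>2) / 2)"
  proof (rule suminf_le)
    show "Re (y i \<bullet>c x i) \<le> ((vec_norm2 (y i))\<^sup>2 / K + K * (vec_norm2 (x i))\<^sup>2) / 2" for i
      using cscalar_le[OF \<open>K > 0\<close> l2_dim[OF y] l2_dim[OF x], of i i] complex_Re_le_cmod[of "y i \<bullet>c x i"] by linarith
    show "summable (\<lambda>i. Re (y i \<bullet>c x i))" by (rule summable_Re[OF l2_inner_summable[OF x y]])
    show "summable (\<lambda>i. ((vec_norm2 (y i))\<^sup>2 / K + K * (vec_norm2 (x i))\<^sup>2) / 2)"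
      using x y by (intro summable_divide summable_add summable_mult l2_summable)
  qed
  also have "\<dots> = ((l2_norm y)\<^sup>2 / K + K * (l2_norm x)\<^sup>2) / 2"
  proof -
    have "(\<Sum>i. ((vec_norm2 (y i))\<^sup>2 / K + K * (vec_norm2 (x i))\<^sup>2) / 2)
      = ((\<Sum>i. (vec_norm2 (y i))\<^sup>2 / K) + (\<Sum>i. K * (vec_norm2 (x i))\<^sup>2)) / 2"
      using x y by (subst suminf_divide, intro summable_divide summable_add summable_mult l2_summable)
        (simp_all add: suminf_add summable_divide summable_mult l2_summable)
    also have "(\<Sum>i. (vec_norm2 (y i))\<^sup>2 / K) = (l2_norm y)\<^sup>2 / K"
      using y by (simp add: suminf_divide l2_summable l2_norm_sq)
    also have "(\<Sum>i. K * (vec_norm2 (x i))\<^sup>2) = K * (l2_norm x)\<^sup>2"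
      using x by (simp add: suminf_mult l2_summable l2_norm_sq)
    finally show ?thesis .
  qed
  finally show ?thesis .
qed

lemma l2_add: assumes x: "x \<in> l2 N" and y: "y \<in> l2 N" shows "(\<lambda>i. x i + y i) \<in> l2 N"
proof -
  have "(vec_norm2 (x i + y i))\<^sup>2 \<le> 2 * (vec_norm2 (x i))\<^sup>2 + 2 * (vec_norm2 (y i))\<^sup>2" for i
  proof -
    show ?thesis
      using l2_dim[OF x, of i] l2_dim[OF y, of i]
      by (simp add: vec_norm2_sq sum_distrib_left sum.distrib[symmetric] cmod_add_sq_le sum_mono)
  qed
  moreover have "summable (\<lambda>i. 2 * (vec_norm2 (x i))\<^sup>2 + 2 * (vec_norm2 (y i))\<^sup>2)"
    using x y by (intro summable_add summable_mult l2_summable)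
  ultimately have "summable (\<lambda>i. (vec_norm2 (x i + y i))\<^sup>2)"
    by (intro summable_comparison_test[of "\<lambda>i. (vec_norm2 (x i + y i))\<^sup>2"]) auto
  then show ?thesis using x y by (auto simp: l2_def)
qed

lemma l2_smult: assumes x: "x \<in> l2 N" shows "(\<lambda>i. c \<cdot>\<^sub>v x i) \<in> l2 N"
proof -
  have "(vec_norm2 (c \<cdot>\<^sub>v x i))\<^sup>2 = (cmod c)\<^sup>2 * (vec_norm2 (x i))\<^sup>2" for i
    by (simp add: vec_norm2_sq norm_mult power_mult_distrib sum_distrib_left)
  then show ?thesis using x by (auto simp: l2_def intro!: summable_mult)
qed

lemma l2_inner_add_right:
  assumes "x \<in> l2 N" "y \<in> l2 N" "z \<in> l2 N"
  shows "l2_inner x (\<lambda>i. y i + z i) = l2_inner x y + l2_inner x z"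
proof -
  have "(y i + z i) \<bullet>c x i = y i \<bullet>c x i + z i \<bullet>c x i" for i
    using l2_dim[OF assms(1), of i] l2_dim[OF assms(2), of i] l2_dim[OF assms(3), of i]
    by (simp add: cscalar_index[of _ N] distrib_right sum.distrib)
  then show ?thesis using assms by (simp add: l2_inner_def l2_inner_summable suminf_add)
qed

lemma l2_inner_add_left:
  assumes "x \<in> l2 N" "y \<in> l2 N" "z \<in> l2 N"
  shows "l2_inner (\<lambda>i. y i + z i) x = l2_inner y x + l2_inner z x"
proof -
  have "x i \<bullet>c (y i + z i) = x i \<bullet>c y i + x i \<bullet>c z i" for i
    using l2_dim[OF assms(1), of i] l2_dim[OF assms(2), of i] l2_dim[OF assms(3), of i]
    by (simp add: cscalar_index[of _ N] distrib_left sum.distrib)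
  then show ?thesis using assms by (simp add: l2_inner_def l2_inner_summable suminf_add)
qed

lemma l2_inner_smult_right:
  assumes "x \<in> l2 N" "y \<in> l2 N" shows "l2_inner x (\<lambda>i. c \<cdot>\<^sub>v y i) = c * l2_inner x y"
proof -
  have "(c \<cdot>\<^sub>v y i) \<bullet>c x i = c * (y i \<bullet>c x i)" for i
    using l2_dim[OF assms(1), of i] l2_dim[OF assms(2), of i]
    by (simp add: cscalar_index[of _ N] sum_distrib_left mult.assoc)
  then show ?thesis using assms by (simp add: l2_inner_def l2_inner_summable suminf_mult)
qed

lemma l2_inner_smult_left:
  assumes "x \<in> l2 N" "y \<in> l2 N" shows "l2_inner (\<lambda>i. c \<cdot>\<^sub>v y i) x = cnj c * l2_inner y x"
proof -
  have "x i \<bullet>c (c \<cdot>\<^sub>v y i) = cnj c * (x i \<bullet>c y i)" for i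
    using l2_dim[OF assms(1), of i] l2_dim[OF assms(2), of i]
    by (simp add: cscalar_index[of _ N] sum_distrib_left mult_ac)
  then show ?thesis using assms by (simp add: l2_inner_def l2_inner_summable suminf_mult)
qed

lemma l2_inner_self:
  assumes "x \<in> l2 N" shows "l2_inner x x = complex_of_real ((l2_norm x)\<^sup>2)"
proof -
  have "x i \<bullet>c x i = complex_of_real ((vec_norm2 (x i))\<^sup>2)" for i
    by (simp add: cscalar_index[of _ "dim_vec (x i)"] vec_norm2_sq complex_norm_square del: of_real_power)
  then show ?thesis
    using assms by (simp only: l2_inner_def l2_norm_sq) (rule suminf_of_real[OF l2_summable, symmetric])
qed

text \<open>With \<open>y = T\<^sup>-\<^sup>1 x\<close> the positivity of \<open>T\<close> at \<open>y - K x\<close>, where \<open>K\<close> bounds the inverse, gives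
  a lower bound for the quadratic form without any spectral theory.\<close>

lemma positive_invertible_coercive:
  assumes T: "l2_bounded_op N T" and pos: "l2_positive_invertible N T"
  obtains c where "c > 0" "\<And>x. x \<in> l2 N \<Longrightarrow> c * (l2_norm x)\<^sup>2 \<le> Re (l2_inner x (T x))"
proof -
  obtain S where S: "l2_bounded_op N S" "\<And>x. x \<in> l2 N \<Longrightarrow> S (T x) = x \<and> T (S x) = x"
    using pos by (auto simp: l2_positive_invertible_def l2_invertible_def)
  obtain K0 where K0: "\<And>x. x \<in> l2 N \<Longrightarrow> l2_norm (S x) \<le> K0 * l2_norm x"
    using S(1) unfolding l2_bounded_op_def by blast
  define K where "K = max K0 1"
  have K: "K > 0" by (simp add: K_def)
  have SK: "(l2_norm (S x))\<^sup>2 \<le> K\<^sup>2 * (l2_norm x)\<^sup>2" if "x \<in> l2 N" for x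
  proof -
    have "S x \<in> l2 N" using S(1) that by (auto simp: l2_bounded_op_def)
    moreover have "l2_norm (S x) \<le> K * l2_norm x"
      using K0[OF that] mult_right_mono[of K0 K "l2_norm x"] l2_norm_nonneg[OF that] by (simp add: K_def)
    ultimately show ?thesis using power_mono[of "l2_norm (S x)" "K * l2_norm x" 2] l2_norm_nonneg by (simp add: power_mult_distrib)
  qed
  show ?thesis
  proof (rule that[of "1 / K"])
    fix x assume x: "x \<in> l2 N"
    define y where "y = S x"
    have y: "y \<in> l2 N" using S(1) x by (auto simp: l2_bounded_op_def y_def)
    have Ty: "T y = x" using S(2)[OF x] by (simp add: y_def)
    have Tx: "T x \<in> l2 N" using T x by (auto simp: l2_bounded_op_def)
    let ?k = "- complex_of_real K"
    have kx: "(\<lambda>i. ?k \<cdot>\<^sub>v x i) \<in> l2 N" by (rule l2_smult[OF x])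
    have kTx: "(\<lambda>i. ?k \<cdot>\<^sub>v T x i) \<in> l2 N" by (rule l2_smult[OF Tx])
    define z where "z = (\<lambda>i. y i + ?k \<cdot>\<^sub>v x i)"
    have z: "z \<in> l2 N" unfolding z_def by (rule l2_add[OF y kx])
    have "T z = (\<lambda>i. T y i + T (\<lambda>i. ?k \<cdot>\<^sub>v x i) i)" using T y kx by (auto simp: l2_bounded_op_def z_def)
    also have "T (\<lambda>i. ?k \<cdot>\<^sub>v x i) = (\<lambda>i. ?k \<cdot>\<^sub>v T x i)" using T x by (auto simp: l2_bounded_op_def)
    finally have Tz: "T z = (\<lambda>i. x i + ?k \<cdot>\<^sub>v T x i)" by (simp add: Ty)
    have "0 \<le> Re (l2_inner z (T z))"
    proof (cases "z = (\<lambda>_. 0\<^sub>v N)")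
      case True
      have "l2_inner z (T z) = 0"
        unfolding True l2_inner_def using l2_dim[of "T (\<lambda>_. 0\<^sub>v N)" N] T z True
        by (simp add: l2_bounded_op_def scalar_prod_right_zero[OF carrier_vecI])
      then show ?thesis by simp
    next
      case False then show ?thesis using pos z by (auto simp: l2_positive_invertible_def less_imp_le)
    qed
    also have "l2_inner z (T z) = l2_inner y x + ?k * l2_inner y (T x) + (?k * l2_inner x x + ?k * ?k * l2_inner x (T x))"
      unfolding Tz unfolding z_def
      using x y Tx kx kTx l2_add[OF x kTx]
      by (simp add: l2_inner_add_left[of _ N] l2_inner_add_right[of _ N] l2_inner_smult_left[of _ N] l2_inner_smult_right[of _ N] distrib_left)
    \<comment> \<open>\<open>T\<close> moves to the left factor, where
      \<open>T y = x\<close>.\<close>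
    also have "l2_inner y (T x) = l2_inner x x"
      using pos x y Ty by (auto simp: l2_positive_invertible_def l2_hermitian_def)
    also have "Re (l2_inner y x + ?k * l2_inner x x + (?k * l2_inner x x + ?k * ?k * l2_inner x (T x)))
      = Re (l2_inner y x) - 2 * K * (l2_norm x)\<^sup>2 + K\<^sup>2 * Re (l2_inner x (T x))"
      by (simp add: l2_inner_self[OF x] power2_eq_square)
    \<comment> \<open>The weight \<open>1 / K\<close> balances both halves, so the whole is at most
      \<open>K\<close> times the squared norm of \<open>x\<close>. This uses up only one of the two
      copies subtracted above.\<close>
    also have "Re (l2_inner y x) \<le> ((l2_norm x)\<^sup>2 / (1 / K) + (1 / K) * (l2_norm y)\<^sup>2) / 2"
      using K by (intro l2_inner_le[OF y x]) simp
    also have "\<dots> \<le> K * (l2_norm x)\<^sup>2"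
    proof -
      have "(1 / K) * (l2_norm y)\<^sup>2 \<le> (1 / K) * (K\<^sup>2 * (l2_norm x)\<^sup>2)"
        using SK[OF x] K unfolding y_def by (intro mult_left_mono) auto
      then show ?thesis using K by (simp add: power2_eq_square mult.commute)
    qed
    finally have "K * (l2_norm x)\<^sup>2 \<le> K * (K * Re (l2_inner x (T x)))" by (simp add: power2_eq_square)
    then have "(l2_norm x)\<^sup>2 \<le> K * Re (l2_inner x (T x))" using K by simp
    then show "1 / K * (l2_norm x)\<^sup>2 \<le> Re (l2_inner x (T x))" using K by (simp add: field_simps)
  qed (use K in simp)
qed

section \<open>Finitely supported block sequences as test vectors for the truncations\<close>

definition block_vec :: "nat \<Rightarrow> nat \<Rightarrow> (nat \<Rightarrow> complex) \<Rightarrow> nat \<Rightarrow> complex vec" where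
  "block_vec N n x = (\<lambda>i. if i < n then vec N (\<lambda>a. x (i * N + a)) else 0\<^sub>v N)"

lemma block_vec_dim [simp]: "dim_vec (block_vec N n x i) = N"
  by (simp add: block_vec_def)

lemma block_vec_sums:
  fixes f :: "nat \<Rightarrow> 'a::{comm_monoid_add,t2_space}"
  assumes "\<And>i. i \<ge> n \<Longrightarrow> f i = 0" "\<And>i. i < n \<Longrightarrow> f i = (\<Sum>a<N. g (i * N + a))"
  shows "f sums (\<Sum>r<n * N. g r)"
proof -
  have "f sums (\<Sum>i<n. f i)" using assms(1) by (intro sums_finite) auto
  then show ?thesis by (simp add: sum_blocks assms(2))
qed

lemma block_vec_norm_sums: "(\<lambda>i. (vec_norm2 (block_vec N n x i))\<^sup>2) sums (\<Sum>r<n * N. (cmod (x r))\<^sup>2)"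
  by (rule block_vec_sums) (auto simp: vec_norm2_sq block_vec_def)

lemma block_vec_l2: "block_vec N n x \<in> l2 N"
  using block_vec_norm_sums[of N n x] by (auto simp: l2_def sums_iff block_vec_def)

lemma l2_norm_block_vec: "(l2_norm (block_vec N n x))\<^sup>2 = (\<Sum>r<n * N. (cmod (x r))\<^sup>2)"
  using block_vec_norm_sums[of N n x] by (simp add: l2_norm_sq[OF block_vec_l2] sums_iff)

lemma l2_inner_block_vec_left:
  assumes "\<And>i. dim_vec (w i) = N"
  shows "l2_inner (block_vec N n x) w = (\<Sum>r<n * N. cnj (x r) * w (r div N) $ (r mod N))"
proof -
  have "(\<lambda>i. w i \<bullet>c block_vec N n x i) sums (\<Sum>r<n * N. cnj (x r) * w (r div N) $ (r mod N))"
    by (rule block_vec_sums) (auto simp: cscalar_index[of _ N] assms block_vec_def mult.commute scalar_prod_right_zero[OF carrier_vecI[OF assms]] intro!: sum.cong)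
  then show ?thesis by (simp add: l2_inner_def sums_iff)
qed

lemma l2_inner_block_vec_right:
  assumes "\<And>i. dim_vec (w i) = N"
  shows "l2_inner w (block_vec N n x) = (\<Sum>r<n * N. x r * cnj (w (r div N) $ (r mod N)))"
proof -
  have "(\<lambda>i. block_vec N n x i \<bullet>c w i) sums (\<Sum>r<n * N. x r * cnj (w (r div N) $ (r mod N)))"
    by (rule block_vec_sums) (auto simp: cscalar_index[of _ N] assms block_vec_def scalar_prod_right_zero[OF carrier_vecI[OF assms]] intro!: sum.cong)
  then show ?thesis by (simp add: l2_inner_def sums_iff)
qed

abbreviation entry :: "(real \<Rightarrow> complex mat) \<Rightarrow> nat \<Rightarrow> nat \<Rightarrow> real \<Rightarrow> complex" where
  "entry A a b \<equiv> (\<lambda>\<theta>. A \<theta> $$ (a, b))"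

lemma fourier_coeff_index:
  assumes "a < N" "b < N" shows "fourier_coeff N A n $$ (a, b) = coef (entry A a b) n"
  using assms
  by (simp add: fourier_coeff_def coef_def avg_def chr_def cis_cnj cis_conv_exp mult.assoc exp_cnj)

lemma toeplitz_mat_index:
  assumes "r < n * N" "s < n * N" shows "toeplitz_mat N A n $$ (r, s) = block_toeplitz N (entry A) r s"
proof -
  have "N > 0" using assms by (cases N) auto
  then show ?thesis using assms by (simp add: toeplitz_mat_def block_toeplitz_def fourier_coeff_index)
qed

lemma toeplitz_op_block_vec:
  assumes "a < N"
  shows "toeplitz_op N A (block_vec N n x) i $ a = (\<Sum>s<n * N. block_toeplitz N (entry A) (i * N + a) s * x s)"
proof -
  have "(\<lambda>j. (fourier_coeff N A (int i - int j) *\<^sub>v block_vec N n x j) $ a) sums (\<Sum>s<n * N. block_toeplitz N (entry A) (i * N + a) s * x s)"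
  proof (rule block_vec_sums)
    have d: "dim_row (fourier_coeff N A l) = N" "dim_col (fourier_coeff N A l) = N" for l by (simp_all add: fourier_coeff_def)
    fix j
    have eq: "(fourier_coeff N A (int i - int j) *\<^sub>v block_vec N n x j) $ a = (\<Sum>b<N. coef (entry A a b) (int i - int j) * block_vec N n x j $ b)"
      using assms by (simp add: d scalar_prod_def fourier_coeff_index atLeast0LessThan)
    show "n \<le> j \<Longrightarrow> (fourier_coeff N A (int i - int j) *\<^sub>v block_vec N n x j) $ a = 0"
      unfolding eq by (simp add: block_vec_def)
    show "j < n \<Longrightarrow> (fourier_coeff N A (int i - int j) *\<^sub>v block_vec N n x j) $ a = (\<Sum>b<N. block_toeplitz N (entry A) (i * N + a) (j * N + b) * x (j * N + b))"
      unfolding eq using assms by (intro sum.cong refl) (simp add: block_vec_def block_toeplitz_index)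
  qed
  then show ?thesis using assms by (simp add: toeplitz_op_def sums_iff)
qed

lemma toeplitz_op_dim [simp]: "dim_vec (toeplitz_op N A x i) = N"
  by (simp add: toeplitz_op_def)

lemma toeplitz_op_block_vec_flat:
  assumes "N > 0"
  shows "toeplitz_op N A (block_vec N n x) (r div N) $ (r mod N) = (\<Sum>s<n * N. block_toeplitz N (entry A) r s * x s)"
  using toeplitz_op_block_vec[of "r mod N" N A n x "r div N"] assms by simp

text \<open>On sequences supported in the first \<open>n\<close> blocks the quadratic form of the
  operator is that of the truncation, so \<open>c\<close> does not depend on
  \<open>n\<close>.\<close>

lemma truncation_coercive:
  assumes "N > 0" "l2_bounded_op N (toeplitz_op N A)" "l2_positive_invertible N (toeplitz_op N A)"
  obtains c where "c > 0"
    "\<And>n x. c * (\<Sum>r<n * N. (cmod (x r))\<^sup>2) \<le> Re (\<Sum>r<n * N. cnj (x r) * (\<Sum>s<n * N. block_toeplitz N (entry A) r s * x s))"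
proof -
  obtain c where c: "c > 0" "\<And>x. x \<in> l2 N \<Longrightarrow> c * (l2_norm x)\<^sup>2 \<le> Re (l2_inner x (toeplitz_op N A x))"
    using positive_invertible_coercive[OF assms(2,3)] by blast
  show ?thesis
  proof (rule that[OF c(1)])
    fix n x
    show "c * (\<Sum>r<n * N. (cmod (x r))\<^sup>2) \<le> Re (\<Sum>r<n * N. cnj (x r) * (\<Sum>s<n * N. block_toeplitz N (entry A) r s * x s))"
      using c(2)[OF block_vec_l2[of N n x]] toeplitz_op_block_vec_flat[OF \<open>N > 0\<close>, of A n x]
      by (simp add: l2_norm_block_vec l2_inner_block_vec_left)
  qed
qed

lemma truncation_bounded:
  assumes "N > 0" "l2_bounded_op N (toeplitz_op N A)"
  obtains C where "C > 0"
    "\<And>n x. (\<Sum>r<n * N. (cmod (\<Sum>s<n * N. block_toeplitz N (entry A) r s * x s))\<^sup>2) \<le> C\<^sup>2 * (\<Sum>r<n * N. (cmod (x r))\<^sup>2)"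
proof -
  obtain C0 where C0: "\<And>x. x \<in> l2 N \<Longrightarrow> l2_norm (toeplitz_op N A x) \<le> C0 * l2_norm x"
    using assms(2) unfolding l2_bounded_op_def by blast
  define C where "C = max C0 1"
  show ?thesis
  proof (rule that[of C])
    fix n x
    let ?x = "block_vec N n x" and ?T = "toeplitz_op N A (block_vec N n x)"
    have T: "?T \<in> l2 N" using assms(2) block_vec_l2 by (auto simp: l2_bounded_op_def)
    have "l2_norm ?T \<le> C * l2_norm ?x"
      using C0[OF block_vec_l2, of n x] mult_right_mono[of C0 C "l2_norm ?x"] l2_norm_nonneg[OF block_vec_l2, of N n x] by (simp add: C_def)
    then have le: "(l2_norm ?T)\<^sup>2 \<le> C\<^sup>2 * (l2_norm ?x)\<^sup>2"
      using power_mono[of "l2_norm ?T" "C * l2_norm ?x" 2] l2_norm_nonneg[OF T] by (simp add: power_mult_distrib)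
    have "(\<Sum>r<n * N. (cmod (\<Sum>s<n * N. block_toeplitz N (entry A) r s * x s))\<^sup>2) = (\<Sum>i<n. (vec_norm2 (?T i))\<^sup>2)"
      unfolding vec_norm2_sq toeplitz_op_dim
      by (subst sum_blocks) (intro sum.cong refl, simp add: toeplitz_op_block_vec)
    \<comment> \<open>The truncation keeps the first \<open>n\<close> blocks of the image; leaving
      out the others only decreases the norm.\<close>
    also have "\<dots> \<le> (\<Sum>i. (vec_norm2 (?T i))\<^sup>2)"
      by (rule sum_le_suminf[OF l2_summable[OF T]]) auto
    also have "\<dots> = (l2_norm ?T)\<^sup>2" by (rule l2_norm_sq[OF T, symmetric])
    also note le
    also have "(l2_norm ?x)\<^sup>2 = (\<Sum>r<n * N. (cmod (x r))\<^sup>2)" by (rule l2_norm_block_vec)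
    finally show "(\<Sum>r<n * N. (cmod (\<Sum>s<n * N. block_toeplitz N (entry A) r s * x s))\<^sup>2) \<le> C\<^sup>2 * (\<Sum>r<n * N. (cmod (x r))\<^sup>2)" .
  qed (simp add: C_def)
qed

lemma truncation_hermitian:
  assumes "N > 0" "l2_hermitian N (toeplitz_op N A)"
  shows "block_toeplitz N (entry A) r s = cnj (block_toeplitz N (entry A) s r)"
proof -
  \<comment> \<open>Any truncation that contains both indices will do; unit vectors then read off
    the entries.\<close>
  define n where "n = Suc (r + s)"
  have "n * 1 \<le> n * N" using assms(1) by (intro mult_le_mono2) simp
  then have "r < n * N" "s < n * N" by (simp_all add: n_def)
  let ?e = "\<lambda>t u. if u = t then 1 else 0 :: complex"
  let ?r = "block_vec N n (?e r)" and ?s = "block_vec N n (?e s)"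
  have "l2_inner ?r (toeplitz_op N A ?s) = l2_inner (toeplitz_op N A ?r) ?s"
    using assms(2) block_vec_l2 by (auto simp: l2_hermitian_def)
  then have "(\<Sum>u<n * N. cnj (?e r u) * (\<Sum>v<n * N. block_toeplitz N (entry A) u v * ?e s v))
    = (\<Sum>u<n * N. ?e s u * cnj (\<Sum>v<n * N. block_toeplitz N (entry A) u v * ?e r v))"
    by (simp add: l2_inner_block_vec_left l2_inner_block_vec_right toeplitz_op_block_vec_flat[OF assms(1)])
  then show ?thesis
    using \<open>r < n * N\<close> \<open>s < n * N\<close> by (simp add: if_distrib[of cnj] if_distrib[of "\<lambda>z. _ * z"] if_distrib[of "\<lambda>z. z * _"] cong: if_cong)
qed

lemma partially_symmetric_coef:
  assumes "partially_symmetric N A" "a < N" "b < N"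
  shows "coef (entry A a b) l \<in> \<real>" "coef (entry A a b) (- l) = coef (entry A a b) l"
proof -
  have *: "coef (entry A a b) (- int n) = coef (entry A a b) (int n)" for n
    using assms fourier_coeff_index[of a N b] unfolding partially_symmetric_def by metis
  show "coef (entry A a b) l \<in> \<real>"
    using assms fourier_coeff_index[of a N b A l] unfolding partially_symmetric_def by metis
  show "coef (entry A a b) (- l) = coef (entry A a b) l"
    using *[of "nat l"] *[of "nat (- l)"] by (cases "l \<ge> 0") auto
qed

text \<open>Self-adjointness transposes, conjugates and negates the index; reality undoes the
  conjugation and evenness the negation. Via \<open>coef_eq_AE\<close> this makes the symbol
  symmetric almost everywhere.\<close>

lemma coef_transpose:
  assumes "N > 0" "partially_symmetric N A" "l2_hermitian N (toeplitz_op N A)" "a < N" "b < N"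
  shows "coef (entry A b a) l = coef (entry A a b) l"
proof -
  have *: "coef (entry A a b) (int i - int j) = coef (entry A b a) (int i - int j)" for i j
  proof -
    have "coef (entry A a b) (int i - int j) = block_toeplitz N (entry A) (i * N + a) (j * N + b)"
      using assms by (simp add: block_toeplitz_index)
    also have "\<dots> = cnj (block_toeplitz N (entry A) (j * N + b) (i * N + a))"
      by (rule truncation_hermitian[OF assms(1,3)])
    also have "\<dots> = coef (entry A b a) (- (int i - int j))"
      using assms partially_symmetric_coef(1)[OF assms(2), of b a] by (simp add: block_toeplitz_index Reals_cnj_iff)
    also have "\<dots> = coef (entry A b a) (int i - int j)" using assms by (intro partially_symmetric_coef(2)) auto
    finally show ?thesis .
  qed
  show ?thesis using *[of "nat l" "nat (- l)"] by (cases "l \<ge> 0") auto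
qed

section \<open>The symbol is almost everywhere real, symmetric and positive definite\<close>

text \<open>With all Fourier coefficients zero every projection vanishes, so
  \<open>mean_defect f n\<close> stays at \<open>sqn f\<close> for \<open>n > 0\<close>; but it also
  tends to 0.\<close>

lemma coef_zero_AE:
  assumes f: "bounded_fun f" and "\<And>l. coef f l = 0"
  shows "AE \<theta> in circle_measure. f \<theta> = 0"
proof -
  have md: "mean_defect f n = sqn f" if "n > 0" for n
  proof -
    have "proj n (\<lambda>\<theta>. f \<theta> * chr (int i) \<theta>) \<theta> = 0" for i \<theta> by (simp add: proj_def coef_shift assms(2))
    then show ?thesis using that by (simp add: mean_defect_def sqn_chr_mult)
  qed
  have "\<forall>\<^sub>F n in sequentially. mean_defect f n = sqn f" by (rule eventually_mono[OF eventually_gt_at_top[of 0] md])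
  then have "mean_defect f \<longlonglongrightarrow> sqn f" by (rule tendsto_eventually)
  then have "sqn f = 0" using mean_defect_tendsto_0[OF f] LIMSEQ_unique by blast
  then have "(LINT \<theta>|circle_measure. (cmod (f \<theta>))\<^sup>2) = 0" by (simp add: sqn_def)
  then have "AE \<theta> in circle_measure. (cmod (f \<theta>))\<^sup>2 = 0"
    by (subst (asm) integral_nonneg_eq_0_iff_AE[OF bounded_fun_cmod_sq[OF f]]) auto
  then show ?thesis by eventually_elim simp
qed

lemma coef_cnj: "coef (\<lambda>\<theta>. cnj (f \<theta>)) l = cnj (coef f (- l))"
  unfolding coef_def avg_cnj[symmetric] by (simp add: cnj_chr)

lemma coef_eq_AE:
  assumes "bounded_fun f" "bounded_fun g" "\<And>l. coef f l = coef g l"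
  shows "AE \<theta> in circle_measure. f \<theta> = g \<theta>"
  using coef_zero_AE[OF bounded_fun_diff[OF assms(1,2)]] assms by (simp add: coef_diff)

text \<open>Block sequences see only frequencies from 0 on, so a test polynomial has to be shifted
  there; multiplication by a character does not change its modulus.\<close>

lemma trig_poly_shift_proj:
  assumes "trig_poly p"
  shows "\<exists>L n. proj n (\<lambda>\<theta>. p \<theta> * chr L \<theta>) = (\<lambda>\<theta>. p \<theta> * chr L \<theta>)"
proof -
  \<comment> \<open>Strengthened to all large \<open>L\<close> and \<open>n\<close>, so that the
    thresholds of two summands can be combined.\<close>
  have "\<exists>m. \<forall>L\<ge>m. \<exists>n0. \<forall>n\<ge>n0. proj n (\<lambda>\<theta>. p \<theta> * chr L \<theta>) = (\<lambda>\<theta>. p \<theta> * chr L \<theta>)"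
    using assms
  proof (induction rule: trig_poly.induct)
    case (trig_poly_chr l)
    show ?case
    proof (intro exI allI impI)
      fix L n assume L: "L \<ge> - l" and n: "n \<ge> nat (l + L) + 1"
      have "proj n (chr (l + L)) \<theta> = (\<Sum>i<n. if i = nat (l + L) then chr (l + L) \<theta> else 0)" for \<theta>
        unfolding proj_def by (rule sum.cong) (use L in \<open>auto simp: coef_chr\<close>)
      then have "proj n (chr (l + L)) = chr (l + L)" using n by auto
      then show "proj n (\<lambda>\<theta>. chr l \<theta> * chr L \<theta>) = (\<lambda>\<theta>. chr l \<theta> * chr L \<theta>)" by (simp add: chr_mult)
    qed
  next
    case (trig_poly_cmult f c)
    have "proj n (\<lambda>\<theta>. c * f \<theta> * chr L \<theta>) = (\<lambda>\<theta>. c * f \<theta> * chr L \<theta>)"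
      if "proj n (\<lambda>\<theta>. f \<theta> * chr L \<theta>) = (\<lambda>\<theta>. f \<theta> * chr L \<theta>)" for n L
    proof
      fix \<theta>
      have "proj n (\<lambda>\<theta>. c * (f \<theta> * chr L \<theta>)) \<theta> = c * proj n (\<lambda>\<theta>. f \<theta> * chr L \<theta>) \<theta>" by (rule proj_cmult)
      then show "proj n (\<lambda>\<theta>. c * f \<theta> * chr L \<theta>) \<theta> = c * f \<theta> * chr L \<theta>" unfolding that by (simp add: mult.assoc)
    qed
    then show ?case using trig_poly_cmult.IH by meson
  next
    case (trig_poly_add f g)
    have add: "proj n (\<lambda>\<theta>. (f \<theta> + g \<theta>) * chr L \<theta>) = (\<lambda>\<theta>. (f \<theta> + g \<theta>) * chr L \<theta>)"
      if "proj n (\<lambda>\<theta>. f \<theta> * chr L \<theta>) = (\<lambda>\<theta>. f \<theta> * chr L \<theta>)" "proj n (\<lambda>\<theta>. g \<theta> * chr L \<theta>) = (\<lambda>\<theta>. g \<theta> * chr L \<theta>)" for n L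
    proof
      fix \<theta>
      have b: "bounded_fun (\<lambda>\<theta>. f \<theta> * chr L \<theta>)" "bounded_fun (\<lambda>\<theta>. g \<theta> * chr L \<theta>)"
        using trig_poly_add.hyps trig_poly_bounded by auto
      show "proj n (\<lambda>\<theta>. (f \<theta> + g \<theta>) * chr L \<theta>) \<theta> = (f \<theta> + g \<theta>) * chr L \<theta>"
        unfolding distrib_right proj_add[OF b] that ..
    qed
    from trig_poly_add.IH obtain m1 m2 where
      m: "\<And>L. L \<ge> m1 \<Longrightarrow> \<exists>n0. \<forall>n\<ge>n0. proj n (\<lambda>\<theta>. f \<theta> * chr L \<theta>) = (\<lambda>\<theta>. f \<theta> * chr L \<theta>)"
        "\<And>L. L \<ge> m2 \<Longrightarrow> \<exists>n0. \<forall>n\<ge>n0. proj n (\<lambda>\<theta>. g \<theta> * chr L \<theta>) = (\<lambda>\<theta>. g \<theta> * chr L \<theta>)" by blast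
    show ?case
    proof (intro exI[of _ "max m1 m2"] allI impI)
      fix L assume L: "max m1 m2 \<le> L"
      then obtain n1 n2 where "\<forall>n\<ge>n1. proj n (\<lambda>\<theta>. f \<theta> * chr L \<theta>) = (\<lambda>\<theta>. f \<theta> * chr L \<theta>)"
        "\<forall>n\<ge>n2. proj n (\<lambda>\<theta>. g \<theta> * chr L \<theta>) = (\<lambda>\<theta>. g \<theta> * chr L \<theta>)"
        using m(1)[of L] m(2)[of L] by auto
      then show "\<exists>n0. \<forall>n\<ge>n0. proj n (\<lambda>\<theta>. (f \<theta> + g \<theta>) * chr L \<theta>) = (\<lambda>\<theta>. (f \<theta> + g \<theta>) * chr L \<theta>)"
        by (intro exI[of _ "max n1 n2"] allI impI add) auto
    qed
  qed
  then show ?thesis by blast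
qed

text \<open>Trigonometric polynomials approximate the indicator \<open>h\<close> of the set where
  \<open>w\<close> is negative. In the limit the integral of \<open>w\<close> over this set is
  nonnegative, so the set is null.\<close>

lemma AE_nonneg_from_trig_polys:
  fixes w :: "real \<Rightarrow> real"
  assumes w: "bounded_fun (\<lambda>\<theta>. complex_of_real (w \<theta>))"
    and nonneg: "\<And>p. trig_poly p \<Longrightarrow> 0 \<le> (LINT \<theta>|circle_measure. w \<theta> * (cmod (p \<theta>))\<^sup>2)"
  shows "AE \<theta> in circle_measure. 0 \<le> w \<theta>"
proof -
  obtain W where W: "W > 0" "AE \<theta> in circle_measure. cmod (complex_of_real (w \<theta>)) \<le> W"
    using w by (rule bounded_funE)
  have wm: "w \<in> borel_measurable circle_measure"
    using measurable_compose[OF bounded_fun_meas[OF w] borel_measurable_Re] by simp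
  define h where "h = (\<lambda>\<theta>. if w \<theta> < 0 then 1 else 0 :: complex)"
  have h: "bounded_fun h"
    unfolding bounded_fun_def h_def using wm by (auto intro!: exI[of _ 1])
  have int: "integrable circle_measure (\<lambda>\<theta>. w \<theta> * (cmod (f \<theta>))\<^sup>2)" if "bounded_fun f" for f
  proof -
    have "integrable circle_measure (\<lambda>\<theta>. complex_of_real (w \<theta>) * (f \<theta> * cnj (f \<theta>)))"
      using w that by (intro bounded_fun_integrable bounded_fun_mult bounded_fun_cnj)
    then have "integrable circle_measure (\<lambda>\<theta>. Re (complex_of_real (w \<theta>) * (f \<theta> * cnj (f \<theta>))))" by (rule integrable_Re)
    then show ?thesis by (simp add: complex_norm_square[symmetric] flip: of_real_power)
  qed
  let ?q = "LINT \<theta>|circle_measure. w \<theta> * (cmod (h \<theta>))\<^sup>2"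
  have q: "0 \<le> ?q + W * (2 * pi) * (e * (sqn h + 1))" if "e > 0" for e
  proof -
    \<comment> \<open>The tolerance cancels the factor \<open>1 / e + 1\<close> that the weighted
      AM-GM bound for the difference of squares produces below.\<close>
    have "0 < e / (1 / e + 1)" using that by (intro divide_pos_pos add_pos_pos) auto
    from trig_poly_dense[OF h this]
    obtain p where p: "trig_poly p" "sqn (\<lambda>\<theta>. h \<theta> - p \<theta>) < e / (1 / e + 1)" by blast
    have bp: "bounded_fun p" using p(1) by (rule trig_poly_bounded)
    have bd: "bounded_fun (\<lambda>\<theta>. h \<theta> - p \<theta>)" using h bp by auto
    have "0 \<le> (LINT \<theta>|circle_measure. w \<theta> * (cmod (p \<theta>))\<^sup>2)" by (rule nonneg[OF p(1)])
    also have "\<dots> \<le> (LINT \<theta>|circle_measure. w \<theta> * (cmod (h \<theta>))\<^sup>2 + W * (e * (cmod (h \<theta>))\<^sup>2 + (1 / e + 1) * (cmod (h \<theta> - p \<theta>))\<^sup>2))"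
    proof (rule integral_mono_AE)
      show "integrable circle_measure (\<lambda>\<theta>. w \<theta> * (cmod (h \<theta>))\<^sup>2 + W * (e * (cmod (h \<theta>))\<^sup>2 + (1 / e + 1) * (cmod (h \<theta> - p \<theta>))\<^sup>2))"
        using int[OF h] bounded_fun_cmod_sq[OF h] bounded_fun_cmod_sq[OF bd]
        by (intro Bochner_Integration.integrable_add integrable_mult_right) auto
      show "AE \<theta> in circle_measure. w \<theta> * (cmod (p \<theta>))\<^sup>2 \<le> w \<theta> * (cmod (h \<theta>))\<^sup>2 + W * (e * (cmod (h \<theta>))\<^sup>2 + (1 / e + 1) * (cmod (h \<theta> - p \<theta>))\<^sup>2)"
        using W(2)
      proof eventually_elim
        case (elim \<theta>)
        let ?x = "cmod (h \<theta>)" and ?y = "cmod (p \<theta>)" and ?d = "cmod (h \<theta> - p \<theta>)"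
        have d: "\<bar>?y - ?x\<bar> \<le> ?d" by (metis norm_minus_commute norm_triangle_ineq3)
        have "\<bar>?y\<^sup>2 - ?x\<^sup>2\<bar> \<le> 2 * ?x * ?d + ?d\<^sup>2"
        proof -
          have "?y\<^sup>2 - ?x\<^sup>2 = 2 * ?x * (?y - ?x) + (?y - ?x)\<^sup>2" by (simp add: power2_eq_square algebra_simps)
          then have "\<bar>?y\<^sup>2 - ?x\<^sup>2\<bar> \<le> \<bar>2 * ?x * (?y - ?x)\<bar> + \<bar>(?y - ?x)\<^sup>2\<bar>" by (simp only: abs_triangle_ineq)
          also have "\<dots> = 2 * ?x * \<bar>?y - ?x\<bar> + \<bar>?y - ?x\<bar>\<^sup>2" by (simp add: abs_mult)
          also have "\<dots> \<le> 2 * ?x * ?d + ?d\<^sup>2" using d by (intro add_mono mult_left_mono power_mono) auto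
          finally show ?thesis .
        qed
        also have "2 * ?x * ?d \<le> e * ?x\<^sup>2 + 1 / e * ?d\<^sup>2"
        proof -
          have "0 \<le> (e * ?x - ?d)\<^sup>2 / e" using that by simp
          also have "\<dots> = e * ?x\<^sup>2 + 1 / e * ?d\<^sup>2 - 2 * ?x * ?d" using that by (simp add: field_simps power2_eq_square)
          finally show ?thesis by simp
        qed
        finally have "\<bar>?y\<^sup>2 - ?x\<^sup>2\<bar> \<le> e * ?x\<^sup>2 + (1 / e + 1) * ?d\<^sup>2" by (simp add: distrib_right)
        then have "\<bar>w \<theta>\<bar> * \<bar>?y\<^sup>2 - ?x\<^sup>2\<bar> \<le> W * (e * ?x\<^sup>2 + (1 / e + 1) * ?d\<^sup>2)"
          using elim W(1) by (intro mult_mono) auto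
        then have "w \<theta> * (?y\<^sup>2 - ?x\<^sup>2) \<le> W * (e * ?x\<^sup>2 + (1 / e + 1) * ?d\<^sup>2)"
          by (metis abs_le_D1 abs_mult)
        then show ?case by (simp only: right_diff_distrib)
      qed
    qed (rule int[OF bp])
    also have "\<dots> = ?q + W * (e * (LINT \<theta>|circle_measure. (cmod (h \<theta>))\<^sup>2) + (1 / e + 1) * (LINT \<theta>|circle_measure. (cmod (h \<theta> - p \<theta>))\<^sup>2))"
      using int[OF h] bounded_fun_cmod_sq[OF h] bounded_fun_cmod_sq[OF bd] by simp
    also have "\<dots> = ?q + W * (2 * pi) * (e * sqn h + (1 / e + 1) * sqn (\<lambda>\<theta>. h \<theta> - p \<theta>))"
      by (simp add: sqn_def field_simps)
    also have "\<dots> \<le> ?q + W * (2 * pi) * (e * sqn h + e)"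
    proof -
      have "(1 / e + 1) * sqn (\<lambda>\<theta>. h \<theta> - p \<theta>) \<le> e" using p(2) that by (simp add: field_simps add_pos_pos)
      then show ?thesis using W(1) by (intro add_left_mono mult_left_mono) auto
    qed
    finally show ?thesis by (simp add: distrib_left)
  qed
  have "0 \<le> ?q"
  proof (rule ccontr)
    assume neg: "\<not> 0 \<le> ?q"
    define Z where "Z = W * (2 * pi) * (sqn h + 1)"
    have Z: "Z > 0" using W(1) by (simp add: Z_def add_nonneg_pos)
    have eq: "W * (2 * pi) * (e * (sqn h + 1)) = Z * e" for e by (simp only: Z_def mult_ac)
    \<comment> \<open>The error is \<open>Z * e\<close>; this \<open>e\<close> makes it half of
      \<open>- ?q\<close> and leaves the negative value \<open>?q / 2\<close>.\<close>
    have "- ?q / (2 * Z) > 0" using neg Z by (intro divide_pos_pos) auto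
    from q[OF this] have "0 \<le> ?q + Z * (- ?q / (2 * Z))" unfolding eq .
    also have "\<dots> = ?q / 2" using Z by simp
    finally show False using neg by simp
  qed
  moreover have "w \<theta> * (cmod (h \<theta>))\<^sup>2 = - (if w \<theta> < 0 then - w \<theta> else 0)" for \<theta> by (simp add: h_def)
  ultimately have "(LINT \<theta>|circle_measure. (if w \<theta> < 0 then - w \<theta> else 0)) \<le> 0" by simp
  moreover have "(LINT \<theta>|circle_measure. (if w \<theta> < 0 then - w \<theta> else 0)) \<ge> 0" by (rule integral_nonneg_AE) auto
  ultimately have "(LINT \<theta>|circle_measure. (if w \<theta> < 0 then - w \<theta> else 0)) = 0" by simp
  moreover have "integrable circle_measure (\<lambda>\<theta>. if w \<theta> < 0 then - w \<theta> else 0)"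
  proof -
    have "(\<lambda>\<theta>. if w \<theta> < 0 then - w \<theta> else 0) = (\<lambda>\<theta>. - (w \<theta> * (cmod (h \<theta>))\<^sup>2))" by (auto simp: h_def)
    then show ?thesis using int[OF h] by simp
  qed
  ultimately have "AE \<theta> in circle_measure. (if w \<theta> < 0 then - w \<theta> else 0) = 0"
    by (subst (asm) integral_nonneg_eq_0_iff_AE) auto
  then show ?thesis by eventually_elim (auto split: if_splits)
qed

text \<open>The truncation is tested on the vector polynomial \<open>g \<theta>\<close> times
  \<open>v\<close>, with \<open>g\<close> a shift of \<open>p\<close>. Its form is the mean of the
  form of the symbol at \<open>v\<close>, weighted by the squared modulus of \<open>p\<close>, so
  coercivity holds in the mean against all such weights and therefore almost everywhere.\<close>

lemma symbol_quadratic_form: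
  fixes v :: "nat \<Rightarrow> real"
  assumes S: "\<And>a b. a < N \<Longrightarrow> b < N \<Longrightarrow> bounded_fun (S a b)"
    and c: "\<And>n x. c * (\<Sum>r<n * N. (cmod (x r))\<^sup>2) \<le> Re (\<Sum>r<n * N. cnj (x r) * (\<Sum>s<n * N. block_toeplitz N S r s * x s))"
  shows "AE \<theta> in circle_measure. c * (\<Sum>a<N. (v a)\<^sup>2) \<le> bil N (\<lambda>a b. Re (S a b \<theta>)) v v"
proof -
  define s where "s = (\<lambda>\<theta>. \<Sum>a<N. \<Sum>b<N. complex_of_real (v a * v b) * S a b \<theta>)"
  define V where "V = (\<Sum>a<N. (v a)\<^sup>2)"
  define w where "w = (\<lambda>\<theta>. Re (s \<theta>) - c * V)"
  have bs: "bounded_fun s" unfolding s_def using S by (intro bounded_fun_sum bounded_fun_mult) auto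
  have Re_s: "Re (s \<theta>) = bil N (\<lambda>a b. Re (S a b \<theta>)) v v" for \<theta>
    by (simp add: s_def bil_def mult_ac)
  have bw: "bounded_fun (\<lambda>\<theta>. complex_of_real (w \<theta>))"
  proof -
    have "(\<lambda>\<theta>. complex_of_real (w \<theta>)) = (\<lambda>\<theta>. (1 / 2) * (s \<theta> + cnj (s \<theta>)) - complex_of_real (c * V))"
      by (simp add: w_def complex_add_cnj)
    then show ?thesis
      using bs by (simp only:) (intro bounded_fun_diff bounded_fun_mult bounded_fun_add bounded_fun_cnj bounded_fun_const)
  qed
  have coef_s: "coef s l = (\<Sum>a<N. \<Sum>b<N. complex_of_real (v a * v b) * coef (S a b) l)" for l
  proof -
    have "coef s l = (\<Sum>a<N. coef (\<lambda>\<theta>. \<Sum>b<N. complex_of_real (v a * v b) * S a b \<theta>) l)"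
      unfolding s_def using S by (intro coef_sum bounded_fun_sum bounded_fun_mult) auto
    also have "\<dots> = (\<Sum>a<N. \<Sum>b<N. coef (\<lambda>\<theta>. complex_of_real (v a * v b) * S a b \<theta>) l)"
      using S by (intro sum.cong refl coef_sum bounded_fun_mult) auto
    finally show ?thesis by (simp only: coef_cmult)
  qed
  have "AE \<theta> in circle_measure. 0 \<le> w \<theta>"
  proof (rule AE_nonneg_from_trig_polys[OF bw])
    fix p assume p: "trig_poly p"
    have bp: "bounded_fun p" using p by (rule trig_poly_bounded)
    obtain L n where g: "proj n (\<lambda>\<theta>. p \<theta> * chr L \<theta>) = (\<lambda>\<theta>. p \<theta> * chr L \<theta>)"
      using trig_poly_shift_proj[OF p] by blast
    define g where "g = (\<lambda>\<theta>. p \<theta> * chr L \<theta>)"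
    have bg: "bounded_fun g" using bp by (auto simp: g_def)
    have pg: "proj n g = g" using g by (simp add: g_def)
    have sqn_g: "sqn g = (\<Sum>l<n. (cmod (coef g (int l)))\<^sup>2)" using sqn_proj[of n g] pg by simp
    define x where "x = (\<lambda>r. coef g (int (r div N)) * complex_of_real (v (r mod N)))"
    have x: "x (l * N + a) = coef g (int l) * complex_of_real (v a)" if "a < N" for l a
      using that by (simp add: x_def)
    have norm_x: "(\<Sum>r<n * N. (cmod (x r))\<^sup>2) = V * sqn g"
      by (simp add: sum_blocks x norm_mult power_mult_distrib sqn_g V_def sum_distrib_left sum_distrib_right)
        (simp add: mult.commute)
    have coef_sg: "coef (\<lambda>\<theta>. s \<theta> * g \<theta>) (int l) = (\<Sum>m<n. coef g (int m) * coef s (int l - int m))" for l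
    proof -
      have "(\<lambda>\<theta>. s \<theta> * g \<theta>) = (\<lambda>\<theta>. s \<theta> * proj n g \<theta>)" by (simp add: pg)
      also have "\<dots> = (\<lambda>\<theta>. \<Sum>m<n. coef g (int m) * (s \<theta> * chr (int m) \<theta>))"
        by (simp add: proj_def sum_distrib_left mult.left_commute)
      finally have "coef (\<lambda>\<theta>. s \<theta> * g \<theta>) (int l) = coef (\<lambda>\<theta>. \<Sum>m<n. coef g (int m) * (s \<theta> * chr (int m) \<theta>)) (int l)" by simp
      also have "\<dots> = (\<Sum>m<n. coef (\<lambda>\<theta>. coef g (int m) * (s \<theta> * chr (int m) \<theta>)) (int l))"
        using bs by (intro coef_sum bounded_fun_mult) auto
      finally show ?thesis by (simp add: coef_cmult coef_shift)
    qed
    have "avg (\<lambda>\<theta>. s \<theta> * g \<theta> * cnj (g \<theta>)) = avg (\<lambda>\<theta>. s \<theta> * g \<theta> * cnj (proj n g \<theta>))" by (simp add: pg)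
    also have "\<dots> = (\<Sum>l<n. coef (\<lambda>\<theta>. s \<theta> * g \<theta>) (int l) * cnj (coef g (int l)))"
      using bs bg by (intro avg_mult_cnj_proj) auto
    also have "\<dots> = (\<Sum>l<n. \<Sum>a<N. cnj (x (l * N + a)) * (\<Sum>m<n. \<Sum>b<N. coef (S a b) (int l - int m) * x (m * N + b)))"
    proof (rule sum.cong[OF refl])
      fix l
      have "(\<Sum>a<N. cnj (x (l * N + a)) * (\<Sum>m<n. \<Sum>b<N. coef (S a b) (int l - int m) * x (m * N + b)))
        = (\<Sum>a<N. \<Sum>m<n. \<Sum>b<N. cnj (coef g (int l)) * (coef g (int m) * (complex_of_real (v a * v b) * coef (S a b) (int l - int m))))"
        unfolding sum_distrib_left by (intro sum.cong refl) (simp add: x)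
      also have "\<dots> = (\<Sum>m<n. \<Sum>a<N. \<Sum>b<N. cnj (coef g (int l)) * (coef g (int m) * (complex_of_real (v a * v b) * coef (S a b) (int l - int m))))"
        by (rule sum.swap)
      also have "\<dots> = coef (\<lambda>\<theta>. s \<theta> * g \<theta>) (int l) * cnj (coef g (int l))"
        unfolding coef_sg coef_s sum_distrib_left sum_distrib_right by (simp only: mult_ac)
      finally show "coef (\<lambda>\<theta>. s \<theta> * g \<theta>) (int l) * cnj (coef g (int l))
        = (\<Sum>a<N. cnj (x (l * N + a)) * (\<Sum>m<n. \<Sum>b<N. coef (S a b) (int l - int m) * x (m * N + b)))" by simp
    qed
    also have "\<dots> = (\<Sum>r<n * N. cnj (x r) * (\<Sum>s<n * N. block_toeplitz N S r s * x s))"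
      by (simp add: sum_blocks block_toeplitz_index)
    finally have quad: "c * (V * sqn g) \<le> Re (avg (\<lambda>\<theta>. s \<theta> * g \<theta> * cnj (g \<theta>)))"
      using c[where x = x and n = n] by (simp add: norm_x)
    have sg: "s \<theta> * g \<theta> * cnj (g \<theta>) = s \<theta> * complex_of_real ((cmod (p \<theta>))\<^sup>2)" for \<theta>
    proof -
      have "g \<theta> * cnj (g \<theta>) = complex_of_real ((cmod (g \<theta>))\<^sup>2)" by (rule complex_norm_square[symmetric])
      then show ?thesis by (simp add: mult.assoc g_def norm_mult)
    qed
    have "bounded_fun (\<lambda>\<theta>. s \<theta> * complex_of_real ((cmod (p \<theta>))\<^sup>2))"
      using bs bp unfolding complex_norm_square by (intro bounded_fun_mult bounded_fun_cnj)
    then have int: "integrable circle_measure (\<lambda>\<theta>. s \<theta> * complex_of_real ((cmod (p \<theta>))\<^sup>2))" by (rule bounded_fun_integrable)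
    have "Re (avg (\<lambda>\<theta>. s \<theta> * g \<theta> * cnj (g \<theta>))) = 1 / (2 * pi) * (LINT \<theta>|circle_measure. Re (s \<theta> * complex_of_real ((cmod (p \<theta>))\<^sup>2)))"
      unfolding sg avg_def using int by (subst integral_Re[OF int]) (simp add: Re_divide_of_real)
    also have "\<dots> = 1 / (2 * pi) * (LINT \<theta>|circle_measure. Re (s \<theta>) * (cmod (p \<theta>))\<^sup>2)" by simp
    finally have 1: "Re (avg (\<lambda>\<theta>. s \<theta> * g \<theta> * cnj (g \<theta>))) = 1 / (2 * pi) * (LINT \<theta>|circle_measure. Re (s \<theta>) * (cmod (p \<theta>))\<^sup>2)" .
    have 2: "sqn g = 1 / (2 * pi) * (LINT \<theta>|circle_measure. (cmod (p \<theta>))\<^sup>2)" by (simp add: sqn_def g_def norm_mult)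
    have "integrable circle_measure (\<lambda>\<theta>. Re (s \<theta> * complex_of_real ((cmod (p \<theta>))\<^sup>2)))" by (rule integrable_Re[OF int])
    then have int': "integrable circle_measure (\<lambda>\<theta>. Re (s \<theta>) * (cmod (p \<theta>))\<^sup>2)" by simp
    have "(LINT \<theta>|circle_measure. w \<theta> * (cmod (p \<theta>))\<^sup>2) = (LINT \<theta>|circle_measure. Re (s \<theta>) * (cmod (p \<theta>))\<^sup>2) - c * V * (LINT \<theta>|circle_measure. (cmod (p \<theta>))\<^sup>2)"
      unfolding w_def left_diff_distrib using int' bounded_fun_cmod_sq[OF bp] by simp
    also have "\<dots> = 2 * pi * (Re (avg (\<lambda>\<theta>. s \<theta> * g \<theta> * cnj (g \<theta>))) - c * (V * sqn g))"
      unfolding 1 2 by (simp add: field_simps)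
    finally show "0 \<le> (LINT \<theta>|circle_measure. w \<theta> * (cmod (p \<theta>))\<^sup>2)" using quad by simp
  qed
  then show ?thesis by eventually_elim (simp add: w_def Re_s V_def)
qed

text \<open>\<open>PiE\<close> fixes the values outside the index range; otherwise the set of
  rational vectors would not be countable.\<close>

lemma rational_approximation:
  fixes x :: "nat \<Rightarrow> real"
  obtains v where "\<And>m::nat. v m \<in> PiE {..<N} (\<lambda>_. \<rat>)" "\<And>a. a < N \<Longrightarrow> (\<lambda>m. v m a) \<longlonglongrightarrow> x a"
proof -
  have "\<forall>m a. \<exists>q\<in>\<rat>. x a < q \<and> q < x a + inverse (real (Suc m))"
    by (intro allI Rats_dense_in_real) simp
  then obtain q where q: "\<And>m a. q m a \<in> \<rat>" "\<And>m a. x a < q m a" "\<And>m a. q m a < x a + inverse (real (Suc m))"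
    by metis
  show ?thesis
  proof (rule that[of "\<lambda>m. restrict (q m) {..<N}"])
    show "restrict (q m) {..<N} \<in> PiE {..<N} (\<lambda>_. \<rat>)" for m using q(1) by auto
    fix a assume a: "a < N"
    have "(\<lambda>m. x a + inverse (real (Suc m))) \<longlonglongrightarrow> x a + 0" by (intro tendsto_intros LIMSEQ_inverse_real_of_nat)
    then have lim: "(\<lambda>m. x a + inverse (real (Suc m))) \<longlonglongrightarrow> x a" by simp
    have "(\<lambda>m. q m a) \<longlonglongrightarrow> x a"
      by (rule tendsto_sandwich[OF _ _ tendsto_const lim]) (use q(2,3) in \<open>auto intro!: always_eventually less_imp_le\<close>)
    then show "(\<lambda>m. restrict (q m) {..<N} a) \<longlonglongrightarrow> x a" using a by simp
  qed
qed

text \<open>The exceptional null set of \<open>symbol_quadratic_form\<close> depends on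
  \<open>v\<close>. The countably many rational \<open>v\<close> share one, and both sides are
  continuous in \<open>v\<close>.\<close>

lemma symbol_coercive:
  assumes S: "\<And>a b. a < N \<Longrightarrow> b < N \<Longrightarrow> bounded_fun (S a b)"
    and c: "\<And>n x. c * (\<Sum>r<n * N. (cmod (x r))\<^sup>2) \<le> Re (\<Sum>r<n * N. cnj (x r) * (\<Sum>s<n * N. block_toeplitz N S r s * x s))"
  shows "AE \<theta> in circle_measure. \<forall>v. c * (\<Sum>a<N. (v a)\<^sup>2) \<le> bil N (\<lambda>a b. Re (S a b \<theta>)) v v"
proof -
  let ?Q = "PiE {..<N} (\<lambda>_::nat. \<rat>) :: (nat \<Rightarrow> real) set"
  have "countable ?Q" by (intro countable_PiE) (auto simp: countable_rat)
  then have "AE \<theta> in circle_measure. \<forall>v\<in>?Q. c * (\<Sum>a<N. (v a)\<^sup>2) \<le> bil N (\<lambda>a b. Re (S a b \<theta>)) v v"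
    by (subst AE_ball_countable) (auto intro: symbol_quadratic_form[OF S c])
  then show ?thesis
  proof eventually_elim
    case (elim \<theta>)
    show ?case
    proof
      fix x :: "nat \<Rightarrow> real"
      obtain v where v: "\<And>m::nat. v m \<in> ?Q" "\<And>a. a < N \<Longrightarrow> (\<lambda>m. v m a) \<longlonglongrightarrow> x a"
        using rational_approximation[of N x] by blast
      have 1: "(\<lambda>m. c * (\<Sum>a<N. (v m a)\<^sup>2)) \<longlonglongrightarrow> c * (\<Sum>a<N. (x a)\<^sup>2)"
        by (intro tendsto_intros v) auto
      have 2: "(\<lambda>m. bil N (\<lambda>a b. Re (S a b \<theta>)) (v m) (v m)) \<longlonglongrightarrow> bil N (\<lambda>a b. Re (S a b \<theta>)) x x"
        unfolding bil_def by (intro tendsto_intros v) auto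
      show "c * (\<Sum>a<N. (x a)\<^sup>2) \<le> bil N (\<lambda>a b. Re (S a b \<theta>)) x x"
        by (rule LIMSEQ_le[OF 1 2]) (use elim v(1) in blast)
    qed
  qed
qed

section \<open>From moments to the limit distribution\<close>

text \<open>The analytic part, with the matrices gone. Order and bounds hold at every
  \<open>\<theta>\<close>, so \<open>e\<close> stands for the symbol eigenvalues corrected on a null
  set. Measurability is assumed only for the power sums, which is what the traces provide.\<close>

locale moment_limit =
  fixes k :: nat and C :: real and e :: "nat \<Rightarrow> real \<Rightarrow> real"
  fixes T :: "nat \<Rightarrow> nat \<Rightarrow> real"
  assumes C_pos: "C > 0"
    and e_range: "\<And>j \<theta>. j \<in> {1..k} \<Longrightarrow> 0 < e j \<theta> \<and> e j \<theta> \<le> C"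
    and e_mono: "\<And>i j \<theta>. 1 \<le> i \<Longrightarrow> i \<le> j \<Longrightarrow> j \<le> k \<Longrightarrow> e i \<theta> \<le> e j \<theta>"
    and T_range: "\<And>n j. j \<in> {1..n * k} \<Longrightarrow> 0 < T n j \<and> T n j \<le> C"
    and moment_meas: "\<And>q. (\<lambda>\<theta>. \<Sum>j\<in>{1..k}. e j \<theta> ^ (2 * q)) \<in> borel_measurable circle_measure"
    and moment_lim: "\<And>q. (\<lambda>n. (\<Sum>j\<in>{1..n * k}. T n j ^ (2 * q)) / real n)
      \<longlonglongrightarrow> 1 / (2 * pi) * (LINT \<theta>|circle_measure. (\<Sum>j\<in>{1..k}. e j \<theta> ^ (2 * q)))"
begin

definition symbol_sum :: "(real \<Rightarrow> real) \<Rightarrow> real \<Rightarrow> real" where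
  "symbol_sum h \<theta> = (\<Sum>j\<in>{1..k}. h (e j \<theta>))"

definition trunc_mean :: "(real \<Rightarrow> real) \<Rightarrow> nat \<Rightarrow> real" where
  "trunc_mean h n = (\<Sum>j\<in>{1..n * k}. h (T n j)) / real n"

definition symbol_mean :: "(real \<Rightarrow> real) \<Rightarrow> real" where
  "symbol_mean h = 1 / (2 * pi) * (LINT \<theta>|circle_measure. symbol_sum h \<theta>)"

lemma symbol_sum_bound:
  assumes "\<And>d. 0 \<le> d \<Longrightarrow> d \<le> C \<Longrightarrow> \<bar>h d\<bar> \<le> B" shows "\<bar>symbol_sum h \<theta>\<bar> \<le> real k * B"
proof -
  have "\<bar>symbol_sum h \<theta>\<bar> \<le> (\<Sum>j\<in>{1..k}. \<bar>h (e j \<theta>)\<bar>)" unfolding symbol_sum_def by (rule sum_abs)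
  also have "\<dots> \<le> (\<Sum>j\<in>{1..k}. B)" using e_range assms by (intro sum_mono) (auto intro: less_imp_le)
  finally show ?thesis by simp
qed

lemma trunc_mean_bound:
  assumes "\<And>d. 0 \<le> d \<Longrightarrow> d \<le> C \<Longrightarrow> \<bar>h d\<bar> \<le> B" shows "\<bar>trunc_mean h n\<bar> \<le> real k * B"
proof (cases "n = 0")
  case True
  have "0 \<le> B" using assms[of C] C_pos by (smt (verit))
  then show ?thesis using True by (simp add: trunc_mean_def)
next
  case False
  have "\<bar>\<Sum>j\<in>{1..n * k}. h (T n j)\<bar> \<le> (\<Sum>j\<in>{1..n * k}. \<bar>h (T n j)\<bar>)" by (rule sum_abs)
  also have "\<dots> \<le> (\<Sum>j\<in>{1..n * k}. B)" using T_range assms by (intro sum_mono) (auto intro: less_imp_le)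
  finally show ?thesis using False by (simp add: trunc_mean_def field_simps)
qed

lemma symbol_sum_integrable:
  assumes "symbol_sum h \<in> borel_measurable circle_measure" "\<And>d. 0 \<le> d \<Longrightarrow> d \<le> C \<Longrightarrow> \<bar>h d\<bar> \<le> B"
  shows "integrable circle_measure (symbol_sum h)"
  using symbol_sum_bound[OF assms(2)]
  by (intro finite_measure.integrable_const_bound[OF circle_finite_measure _ assms(1), of "real k * B"]) auto

lemma symbol_mean_bound:
  assumes "symbol_sum h \<in> borel_measurable circle_measure" "\<And>d. 0 \<le> d \<Longrightarrow> d \<le> C \<Longrightarrow> \<bar>h d\<bar> \<le> B"
  shows "\<bar>symbol_mean h\<bar> \<le> real k * B"
proof -
  have "\<bar>LINT \<theta>|circle_measure. symbol_sum h \<theta>\<bar> \<le> (LINT \<theta>|circle_measure. real k * B)"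
    using symbol_sum_bound[OF assms(2)] finite_measure.integrable_const[OF circle_finite_measure]
    by (intro order_trans[OF integral_abs_bound] integral_mono integrable_abs symbol_sum_integrable[OF assms]) auto
  also have "\<dots> = 2 * pi * (real k * B)" using circle_measure_total by simp
  finally show ?thesis by (simp add: symbol_mean_def abs_mult field_simps)
qed

text \<open>Measurability belongs to the predicate, so that uniform approximation transports it
  together with the limit.\<close>

definition distributed_fun :: "(real \<Rightarrow> real) \<Rightarrow> bool" where
  "distributed_fun h \<longleftrightarrow> symbol_sum h \<in> borel_measurable circle_measure \<and> trunc_mean h \<longlonglongrightarrow> symbol_mean h"

lemma distributed_power: "distributed_fun (\<lambda>d. d ^ (2 * q))"
  using moment_meas moment_lim
  by (simp add: distributed_fun_def symbol_sum_def[abs_def] trunc_mean_def[abs_def] symbol_mean_def)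

lemma distributed_poly: "distributed_fun (\<lambda>d. \<Sum>i\<le>m. a i * (d\<^sup>2) ^ i)"
proof -
  have pow: "(d\<^sup>2) ^ i = d ^ (2 * i)" for d :: real and i by (simp add: power_mult)
  have s: "symbol_sum (\<lambda>d. \<Sum>i\<le>m. a i * (d\<^sup>2) ^ i) = (\<lambda>\<theta>. \<Sum>i\<le>m. a i * symbol_sum (\<lambda>d. d ^ (2 * i)) \<theta>)"
    unfolding symbol_sum_def[abs_def] pow sum_distrib_left by (intro ext) (rule sum.swap)
  have t: "trunc_mean (\<lambda>d. \<Sum>i\<le>m. a i * (d\<^sup>2) ^ i) = (\<lambda>n. \<Sum>i\<le>m. a i * trunc_mean (\<lambda>d. d ^ (2 * i)) n)"
    unfolding trunc_mean_def[abs_def] pow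
    by (intro ext) (simp add: sum_distrib_left sum_divide_distrib sum.swap[of _ "{..m}"])
  have int: "integrable circle_measure (symbol_sum (\<lambda>d. d ^ (2 * i)))" for i
    using distributed_power[of i]
    by (intro symbol_sum_integrable[of _ "C ^ (2 * i)"]) (auto simp: distributed_fun_def intro!: power_mono)
  have m: "symbol_mean (\<lambda>d. \<Sum>i\<le>m. a i * (d\<^sup>2) ^ i) = (\<Sum>i\<le>m. a i * symbol_mean (\<lambda>d. d ^ (2 * i)))"
    unfolding symbol_mean_def s using int by (simp add: sum_distrib_left sum_divide_distrib)
  show ?thesis
    unfolding distributed_fun_def m t s using distributed_power
    by (auto simp: distributed_fun_def intro!: tendsto_sum tendsto_mult_left borel_measurable_sum borel_measurable_times)
qed

lemma distributed_approx:
  assumes "\<And>\<epsilon>. \<epsilon> > 0 \<Longrightarrow> \<exists>p. distributed_fun p \<and> (\<forall>d. 0 \<le> d \<longrightarrow> d \<le> C \<longrightarrow> \<bar>h d - p d\<bar> \<le> \<epsilon>)"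
  shows "distributed_fun h"
proof -
  have sdiff: "symbol_sum (\<lambda>d. h d - p d) = (\<lambda>\<theta>. symbol_sum h \<theta> - symbol_sum p \<theta>)" for p
    by (intro ext) (simp add: symbol_sum_def sum_subtractf)
  have tdiff: "trunc_mean (\<lambda>d. h d - p d) n = trunc_mean h n - trunc_mean p n" for p n
    by (simp add: trunc_mean_def sum_subtractf diff_divide_distrib)
  have "\<forall>m::nat. \<exists>p. distributed_fun p \<and> (\<forall>d. 0 \<le> d \<longrightarrow> d \<le> C \<longrightarrow> \<bar>h d - p d\<bar> \<le> inverse (Suc m))"
    using assms by simp
  then obtain p where p: "\<And>m. distributed_fun (p m)" "\<And>m d. 0 \<le> d \<Longrightarrow> d \<le> C \<Longrightarrow> \<bar>h d - p m d\<bar> \<le> inverse (Suc m)"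
    by metis
  have sb: "\<bar>symbol_sum (\<lambda>d. h d - p m d) \<theta>\<bar> \<le> real k * inverse (real (Suc m))" for m \<theta>
    by (rule symbol_sum_bound) (rule p(2))
  have tb: "\<bar>trunc_mean (\<lambda>d. h d - p m d) n\<bar> \<le> real k * inverse (real (Suc m))" for m n
    by (rule trunc_mean_bound) (rule p(2))
  have lim0: "(\<lambda>m. k * inverse (real (Suc m))) \<longlonglongrightarrow> 0"
    using tendsto_mult_left[OF LIMSEQ_inverse_real_of_nat, of "real k"] by simp
  have meas: "symbol_sum h \<in> borel_measurable circle_measure"
  proof (rule borel_measurable_LIMSEQ_real)
    show "symbol_sum (p m) \<in> borel_measurable circle_measure" for m using p(1) by (simp add: distributed_fun_def)
    fix \<theta>
    have "norm (symbol_sum (p m) \<theta> - symbol_sum h \<theta>) \<le> k * inverse (real (Suc m))" for m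
      using sb[of m \<theta>] by (simp add: sdiff abs_minus_commute)
    then have "(\<lambda>m. symbol_sum (p m) \<theta> - symbol_sum h \<theta>) \<longlonglongrightarrow> 0"
      by (intro Lim_null_comparison[OF _ lim0]) simp
    then show "(\<lambda>m. symbol_sum (p m) \<theta>) \<longlonglongrightarrow> symbol_sum h \<theta>" by (rule LIM_zero_cancel)
  qed
  have "trunc_mean h \<longlonglongrightarrow> symbol_mean h"
  proof (rule LIMSEQ_I)
    fix r :: real assume "r > 0"
    then obtain m where m: "k * inverse (real (Suc m)) < r / 3"
      using order_tendstoD(2)[OF lim0, of "r / 3"] by (auto simp: eventually_sequentially)
    have pm: "symbol_sum (p m) \<in> borel_measurable circle_measure" "trunc_mean (p m) \<longlonglongrightarrow> symbol_mean (p m)"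
      using p(1) by (simp_all add: distributed_fun_def)
    from LIMSEQ_D[OF pm(2), of "r / 3"] \<open>r > 0\<close> obtain n0 where n0: "\<And>n. n \<ge> n0 \<Longrightarrow> \<bar>trunc_mean (p m) n - symbol_mean (p m)\<bar> < r / 3"
      by auto
    have dm: "symbol_sum (\<lambda>d. h d - p m d) \<in> borel_measurable circle_measure" using meas pm(1) by (simp add: sdiff)
    have idiff: "integrable circle_measure (symbol_sum (\<lambda>d. h d - p m d))"
      by (rule symbol_sum_integrable[OF dm p(2)])
    have a: "\<bar>symbol_mean h - symbol_mean (p m)\<bar> \<le> k * inverse (real (Suc m))"
    \<comment> \<open>\<open>distributed_fun\<close> does not assert integrability. Since the
      difference is integrable, \<open>p m\<close> and \<open>h\<close> are so together; otherwise
      both integrals are 0 by default.\<close>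
    proof (cases "integrable circle_measure (symbol_sum (p m))")
      case True
      have "integrable circle_measure (symbol_sum h)"
        using Bochner_Integration.integrable_add[OF idiff True] by (simp add: sdiff)
      then have "symbol_mean h - symbol_mean (p m) = symbol_mean (\<lambda>d. h d - p m d)"
        using True by (simp add: symbol_mean_def sdiff right_diff_distrib diff_divide_distrib)
      then show ?thesis using symbol_mean_bound[OF dm p(2)] by simp
    next
      case False
      then have "\<not> integrable circle_measure (symbol_sum h)"
        using Bochner_Integration.integrable_diff[OF _ idiff, of "symbol_sum h"] by (auto simp: sdiff)
      then show ?thesis using False by (simp add: symbol_mean_def not_integrable_integral_eq)
    qed
    have b: "\<bar>trunc_mean h n - trunc_mean (p m) n\<bar> \<le> k * inverse (real (Suc m))" for n
      using tb[of m n] by (simp add: tdiff)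
    have "norm (trunc_mean h n - symbol_mean h) < r" if "n \<ge> n0" for n
      using a b[of n] n0[OF that] m unfolding real_norm_def by linarith
    then show "\<exists>n0. \<forall>n\<ge>n0. norm (trunc_mean h n - symbol_mean h) < r" by blast
  qed
  with meas show ?thesis by (simp add: distributed_fun_def)
qed

theorem distributed_continuous:
  assumes h: "continuous_on UNIV h" shows "distributed_fun h"
proof (rule distributed_approx)
  fix \<epsilon> :: real assume "\<epsilon> > 0"
  \<comment> \<open>A polynomial close to \<open>h (sqrt x)\<close>, taken at
    \<open>x = d\<^sup>2\<close>, is even in \<open>d\<close>, so the moments apply;
    \<open>sqrt (d\<^sup>2) = d\<close> because \<open>d\<close> is nonnegative.\<close>
  have "continuous_on {0..C\<^sup>2} (\<lambda>x. h (sqrt x))"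
    by (rule continuous_on_compose2[OF h]) (auto intro!: continuous_intros)
  from Stone_Weierstrass_real_polynomial_function[OF compact_Icc this \<open>\<epsilon> > 0\<close>]
  obtain p where p: "real_polynomial_function p" "\<And>x. x \<in> {0..C\<^sup>2} \<Longrightarrow> \<bar>h (sqrt x) - p x\<bar> < \<epsilon>" by blast
  obtain a m where pa: "p = (\<lambda>x. \<Sum>i\<le>m. a i * x ^ i)" using p(1) real_polynomial_function_iff_sum by blast
  have "\<bar>h d - p (d\<^sup>2)\<bar> \<le> \<epsilon>" if "0 \<le> d" "d \<le> C" for d
    using p(2)[of "d\<^sup>2"] that by (auto intro!: power_mono less_imp_le)
  moreover have "distributed_fun (\<lambda>d. p (d\<^sup>2))" unfolding pa by (rule distributed_poly)
  ultimately show "\<exists>p. distributed_fun p \<and> (\<forall>d. 0 \<le> d \<longrightarrow> d \<le> C \<longrightarrow> \<bar>h d - p d\<bar> \<le> \<epsilon>)" by blast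
qed

text \<open>\<open>e j \<theta> > s\<close> says that at least \<open>k + 1 - j\<close> of the sorted values exceed \<open>s\<close>, and their number
  is a limit of sums of continuous functions of the values.\<close>

lemma e_measurable:
  assumes j: "j \<in> {1..k}" shows "e j \<in> borel_measurable circle_measure"
  unfolding borel_measurable_iff_greater
proof
  fix s :: real
  define cnt where "cnt = symbol_sum (\<lambda>d. if d > s then 1 else 0)"
  have cnt_meas: "cnt \<in> borel_measurable circle_measure"
  proof (rule borel_measurable_LIMSEQ_real)
    fix m :: nat
    have "continuous_on UNIV (\<lambda>d. max 0 (min 1 (real m * (d - s))))" by (intro continuous_intros)
    then show "symbol_sum (\<lambda>d. max 0 (min 1 (real m * (d - s)))) \<in> borel_measurable circle_measure"
      using distributed_continuous by (auto simp: distributed_fun_def)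
  next
    fix \<theta>
    have "(\<lambda>m. max 0 (min 1 (real m * (d - s)))) \<longlonglongrightarrow> (if d > s then 1 else 0)" for d
    proof (cases "d > s")
      case True
      then obtain m0 where m0: "real m0 * (d - s) > 1" using reals_Archimedean3[of "d - s"] by auto
      have "max 0 (min 1 (real m * (d - s))) = 1" if "m \<ge> m0" for m
      proof -
        have "real m * (d - s) \<ge> real m0 * (d - s)" using that True by (intro mult_right_mono) auto
        then show ?thesis using m0 by simp
      qed
      then have "\<forall>\<^sub>F m in sequentially. max 0 (min 1 (real m * (d - s))) = 1" by (auto simp: eventually_sequentially)
      then show ?thesis using True by (simp add: tendsto_eventually)
    next
      case False
      then have "real m * (d - s) \<le> 0" for m by (simp add: mult_nonneg_nonpos)
      then have "max 0 (min 1 (real m * (d - s))) = 0" for m by (meson max_absorb1 min.coboundedI2)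
      then show ?thesis using False by simp
    qed
    then show "(\<lambda>m. symbol_sum (\<lambda>d. max 0 (min 1 (real m * (d - s)))) \<theta>) \<longlonglongrightarrow> cnt \<theta>"
      unfolding cnt_def symbol_sum_def by (intro tendsto_sum)
  qed
  \<comment> \<open>The bound \<open>k - j\<close> is the size of \<open>{Suc j..k}\<close>, one
    less than that of \<open>{j..k}\<close>; the strict inequality separates the two cases.\<close>
  have "s < e j \<theta> \<longleftrightarrow> real (k - j) < cnt \<theta>" for \<theta>
  proof -
    have cnt: "cnt \<theta> = card {i \<in> {1..k}. s < e i \<theta>}"
      unfolding cnt_def symbol_sum_def by (simp add: sum.If_cases Int_def)
    show ?thesis
    proof (cases "s < e j \<theta>")
      case True
      then have "{j..k} \<subseteq> {i \<in> {1..k}. s < e i \<theta>}" using j e_mono[of j _ \<theta>] by (auto intro: less_le_trans)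
      then have "card {j..k} \<le> card {i \<in> {1..k}. s < e i \<theta>}" by (intro card_mono) auto
      then show ?thesis using True j by (simp add: cnt)
    next
      case False
      then have "{i \<in> {1..k}. s < e i \<theta>} \<subseteq> {Suc j..k}"
        using j e_mono[of _ j \<theta>] by (auto simp: not_less Suc_le_eq) (meson le_less_trans not_le less_le_trans)
      then have "card {i \<in> {1..k}. s < e i \<theta>} \<le> card {Suc j..k}" by (intro card_mono) auto
      then show ?thesis unfolding cnt of_nat_less_iff using False by simp
    qed
  qed
  then have "{\<theta> \<in> space circle_measure. s < e j \<theta>} = {\<theta> \<in> space circle_measure. real (k - j) < cnt \<theta>}" by blast
  also have "\<dots> \<in> sets circle_measure" using cnt_meas by measurable
  finally show "{\<theta> \<in> space circle_measure. s < e j \<theta>} \<in> sets circle_measure" .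
qed

end

section \<open>Essential ranges\<close>

lemma circle_null_iff:
  assumes "{t \<in> {-pi..pi}. P t} \<in> sets circle_measure"
  shows "emeasure lebesgue {t \<in> {-pi..pi}. P t} = 0 \<longleftrightarrow> (AE t in circle_measure. \<not> P t)"
proof -
  have "emeasure circle_measure {t \<in> {-pi..pi}. P t} = emeasure lebesgue {t \<in> {-pi..pi}. P t}"
    by (rule emeasure_restrict_space) auto
  moreover have "(AE t in circle_measure. \<not> P t) \<longleftrightarrow> emeasure circle_measure {t \<in> {-pi..pi}. P t} = 0"
    using assms by (subst AE_iff_measurable[of "{t \<in> {-pi..pi}. P t}"]) auto
  ultimately show ?thesis by simp
qed

text \<open>A value outside the essential range lies in a rational interval with null preimage.
  There are countably many such intervals, so almost every point avoids them all.\<close>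

lemma AE_in_essential_range:
  assumes e: "e \<in> borel_measurable circle_measure"
  shows "AE \<theta> in circle_measure. e \<theta> \<in> essential_range e"
proof -
  define Z where "Z = {(p, q). p \<in> \<rat> \<and> q \<in> \<rat> \<and> (AE \<theta> in circle_measure. \<not> (p < e \<theta> \<and> e \<theta> < q))}"
  have "countable (\<rat> \<times> \<rat> :: (real \<times> real) set)" by (simp add: countable_rat)
  then have "countable Z" by (rule countable_subset[rotated]) (auto simp: Z_def)
  then have "AE \<theta> in circle_measure. \<forall>z\<in>Z. \<not> (fst z < e \<theta> \<and> e \<theta> < snd z)"
    by (subst AE_ball_countable) (auto simp: Z_def)
  then show ?thesis
  proof eventually_elim
    case (elim \<theta>)
    show ?case
    proof (rule ccontr)
      assume "e \<theta> \<notin> essential_range e"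
      then obtain \<epsilon> where eps: "\<epsilon> > 0" "\<not> 0 < emeasure lebesgue {t \<in> {-pi..pi}. \<bar>e t - e \<theta>\<bar> < \<epsilon>}"
        unfolding essential_range_def by blast
      then have null: "emeasure lebesgue {t \<in> {-pi..pi}. \<bar>e t - e \<theta>\<bar> < \<epsilon>} = 0" by (simp only: not_gr_zero)
      have "{t \<in> space circle_measure. \<bar>e t - e \<theta>\<bar> < \<epsilon>} \<in> sets circle_measure" using e by measurable
      then have ae: "AE t in circle_measure. \<not> \<bar>e t - e \<theta>\<bar> < \<epsilon>" using null by (subst circle_null_iff[symmetric]) auto
      obtain p q where pq: "p \<in> \<rat>" "e \<theta> - \<epsilon> < p" "p < e \<theta>" "q \<in> \<rat>" "e \<theta> < q" "q < e \<theta> + \<epsilon>"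
        using Rats_dense_in_real[of "e \<theta> - \<epsilon>" "e \<theta>"] Rats_dense_in_real[of "e \<theta>" "e \<theta> + \<epsilon>"] eps by auto
      from ae have "AE t in circle_measure. \<not> (p < e t \<and> e t < q)" by eventually_elim (use pq in auto)
      then have "(p, q) \<in> Z" using pq by (simp add: Z_def)
      then show False using elim pq by force
    qed
  qed
qed

text \<open>\<open>g\<close> is not known to be measurable, and a nonmeasurable set has
  \<open>emeasure\<close> 0 by default. Completeness of Lebesgue measure helps: the sets for
  \<open>g\<close> and for \<open>e\<close> differ only inside the null set
  \<open>M\<close>.\<close>

lemma essential_range_cong:
  assumes e: "e \<in> borel_measurable circle_measure" and "negligible M"
    and eq: "\<And>\<theta>. \<theta> \<in> {-pi..pi} \<Longrightarrow> \<theta> \<notin> M \<Longrightarrow> g \<theta> = e \<theta>"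
  shows "essential_range g = essential_range e"
proof -
  have "emeasure lebesgue {t \<in> {-pi..pi}. \<bar>g t - x\<bar> < \<epsilon>} = emeasure lebesgue {t \<in> {-pi..pi}. \<bar>e t - x\<bar> < \<epsilon>}" for x \<epsilon>
  proof -
    let ?G = "{t \<in> {-pi..pi}. \<bar>g t - x\<bar> < \<epsilon>}" and ?E = "{t \<in> {-pi..pi}. \<bar>e t - x\<bar> < \<epsilon>}"
    have "{t \<in> space circle_measure. \<bar>e t - x\<bar> < \<epsilon>} \<in> sets circle_measure" using e by measurable
    then have "?E \<in> sets circle_measure" by simp
    then have E: "?E \<in> sets lebesgue" by (auto simp: sets_restrict_space intro!: sets.Int)
    have G: "?G \<in> sets lebesgue"
    proof (rule sets_negligible_symdiff[OF E])
      show "negligible ((?E - ?G) \<union> (?G - ?E))"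
        by (rule negligible_subset[OF \<open>negligible M\<close>]) (use eq in auto)
    qed
    have "AE t in lebesgue. t \<notin> M" using \<open>negligible M\<close> by (simp add: negligible_iff_null_sets AE_not_in)
    then have "AE t in lebesgue. t \<in> ?G \<longleftrightarrow> t \<in> ?E" by eventually_elim (use eq in auto)
    then show ?thesis by (rule emeasure_eq_AE[OF _ G E])
  qed
  then show ?thesis by (simp add: essential_range_def)
qed

context moment_limit
begin

lemma essential_range_near_trunc:
  assumes j: "j \<in> {1..k}" and x: "x \<in> essential_range (e j)" and "\<epsilon> > 0"
  obtains n i where "n \<ge> 1" "i \<in> {1..n * k}" "\<bar>T n i - x\<bar> < \<epsilon>"
proof -
  \<comment> \<open>Positive exactly on the open interval of radius \<open>\<epsilon>\<close> around
    \<open>x\<close>, so a positive mean of \<open>h\<close> over a truncation forces an eigenvalue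
    into it.\<close>
  define h where "h = (\<lambda>d. max 0 (1 - \<bar>d - x\<bar> / \<epsilon>))"
  have h0: "h d \<ge> 0" for d by (simp add: h_def)
  have "continuous_on UNIV h" unfolding h_def using \<open>\<epsilon> > 0\<close> by (intro continuous_intros) auto
  then have dist: "distributed_fun h" by (rule distributed_continuous)
  then have meas: "symbol_sum h \<in> borel_measurable circle_measure" by (simp add: distributed_fun_def)
  have s0: "symbol_sum h \<theta> \<ge> 0" for \<theta> unfolding symbol_sum_def using h0 by (intro sum_nonneg)
  have "\<bar>h d\<bar> \<le> 1" for d using \<open>\<epsilon> > 0\<close> by (simp add: h_def)
  then have int: "integrable circle_measure (symbol_sum h)" by (intro symbol_sum_integrable[OF meas, of 1])
  have "(LINT \<theta>|circle_measure. symbol_sum h \<theta>) \<noteq> 0"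
  proof
    assume "(LINT \<theta>|circle_measure. symbol_sum h \<theta>) = 0"
    then have "AE \<theta> in circle_measure. symbol_sum h \<theta> = 0"
      using integral_nonneg_eq_0_iff_AE[OF int] s0 by simp
    then have "AE \<theta> in circle_measure. \<not> \<bar>e j \<theta> - x\<bar> < \<epsilon>"
    proof eventually_elim
      case (elim \<theta>)
      then have "h (e j \<theta>) = 0" unfolding symbol_sum_def using j h0 by (subst (asm) sum_nonneg_eq_0_iff) auto
      then show ?case using \<open>\<epsilon> > 0\<close> by (auto simp: h_def max_def field_simps split: if_splits)
    qed
    moreover have "{t \<in> space circle_measure. \<bar>e j t - x\<bar> < \<epsilon>} \<in> sets circle_measure"
      using e_measurable[OF j] by measurable
    ultimately have "emeasure lebesgue {t \<in> {-pi..pi}. \<bar>e j t - x\<bar> < \<epsilon>} = 0" by (subst circle_null_iff) auto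
    moreover have "emeasure lebesgue {t \<in> {-pi..pi}. \<bar>e j t - x\<bar> < \<epsilon>} > 0"
      using x \<open>\<epsilon> > 0\<close> unfolding essential_range_def by blast
    ultimately show False by (metis less_irrefl)
  qed
  moreover have "(LINT \<theta>|circle_measure. symbol_sum h \<theta>) \<ge> 0" using s0 by (intro integral_nonneg_AE) auto
  ultimately have "symbol_mean h > 0" by (simp add: symbol_mean_def)
  moreover have "trunc_mean h \<longlonglongrightarrow> symbol_mean h" using dist by (simp add: distributed_fun_def)
  ultimately have "\<forall>\<^sub>F n in sequentially. trunc_mean h n > 0" by (rule order_tendstoD(1)[rotated])
  then obtain n0 where n0: "\<And>n. n \<ge> n0 \<Longrightarrow> trunc_mean h n > 0" by (auto simp: eventually_sequentially)
  define n where "n = max n0 1"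
  have n: "n \<ge> 1" "trunc_mean h n > 0" using n0[of n] by (simp_all add: n_def)
  have "\<exists>i\<in>{1..n * k}. h (T n i) > 0"
  proof (rule ccontr)
    assume "\<not> (\<exists>i\<in>{1..n * k}. h (T n i) > 0)"
    then have "(\<Sum>i\<in>{1..n * k}. h (T n i)) \<le> 0" by (intro sum_nonpos) (simp add: not_less)
    then show False using n by (simp add: trunc_mean_def zero_less_divide_iff)
  qed
  then obtain i where i: "i \<in> {1..n * k}" "h (T n i) > 0" by blast
  have "\<bar>T n i - x\<bar> < \<epsilon>" using i(2) \<open>\<epsilon> > 0\<close> by (auto simp: h_def max_def field_simps split: if_splits)
  then show ?thesis using that n(1) i(1) by blast
qed

lemma outliers_negligible:
  fixes X :: "real set"
  assumes "k \<ge> 1" "\<delta> > 0" and X: "\<And>d s. d \<in> X \<Longrightarrow> s \<in> (\<Union>j\<in>{1..k}. essential_range (e j)) \<Longrightarrow> \<bar>d - s\<bar> \<ge> \<delta>"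
  shows "(\<lambda>n. real (card {j \<in> {1..n * k}. T n j \<in> X}) / real n) \<longlonglongrightarrow> 0"
proof -
  define R where "R = (\<Union>j\<in>{1..k}. essential_range (e j))"
  \<comment> \<open>Zero on \<open>R\<close>, so its limiting mean vanishes, and 1 at distance at
    least \<open>\<delta>\<close> from \<open>R\<close>, so its mean over a truncation dominates the
    proportion of values in \<open>X\<close>.\<close>
  define h where "h = (\<lambda>d. min 1 (infdist d R / \<delta>))"
  have AE_R: "AE \<theta> in circle_measure. \<forall>j\<in>{1..k}. e j \<theta> \<in> R"
  proof -
    have "AE \<theta> in circle_measure. \<forall>j\<in>{1..k}. e j \<theta> \<in> essential_range (e j)"
      by (subst AE_ball_countable) (simp, intro ballI AE_in_essential_range e_measurable)
    then show ?thesis by eventually_elim (auto simp: R_def)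
  qed
  \<comment> \<open>\<open>infdist\<close> to the empty set is 0 by default, which would break
    \<open>h1\<close>.\<close>
  have "R \<noteq> {}"
  proof
    assume "R = {}"
    from AE_R have "AE \<theta> in circle_measure. False"
      by eventually_elim (use \<open>R = {}\<close> \<open>k \<ge> 1\<close> in auto)
    then have "emeasure circle_measure (space circle_measure) = 0"
      by (intro iffD1[OF AE_iff_measurable[where P = "\<lambda>_. False"]]) auto
    then show False using circle_measure_total by (simp add: measure_def)
  qed
  have h0: "h d \<ge> 0" for d using \<open>\<delta> > 0\<close> by (simp add: h_def infdist_nonneg)
  have h1: "h d = 1" if "d \<in> X" for d
  proof -
    have "\<delta> \<le> infdist d R"
      unfolding infdist_notempty[OF \<open>R \<noteq> {}\<close>]
      using X[OF that] \<open>R \<noteq> {}\<close> by (intro cINF_greatest) (auto simp: R_def dist_real_def)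
    then show ?thesis using \<open>\<delta> > 0\<close> by (simp add: h_def)
  qed
  have "continuous_on UNIV h" unfolding h_def using \<open>\<delta> > 0\<close> by (intro continuous_intros) auto
  then have "distributed_fun h" by (rule distributed_continuous)
  then have lim: "trunc_mean h \<longlonglongrightarrow> symbol_mean h" by (simp add: distributed_fun_def)
  have "(LINT \<theta>|circle_measure. symbol_sum h \<theta>) = 0"
  proof (rule integral_eq_zero_AE)
    show "AE \<theta> in circle_measure. symbol_sum h \<theta> = 0"
      using AE_R by eventually_elim (simp add: symbol_sum_def h_def)
  qed
  then have lim0: "trunc_mean h \<longlonglongrightarrow> 0" using lim by (simp add: symbol_mean_def)
  show ?thesis
  proof (rule tendsto_sandwich[OF _ _ tendsto_const lim0])
    have "real (card {j \<in> {1..n * k}. T n j \<in> X}) / real n \<le> trunc_mean h n" for n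
    proof -
      have "real (card {j \<in> {1..n * k}. T n j \<in> X}) = (\<Sum>j | j \<in> {1..n * k} \<and> T n j \<in> X. h (T n j))"
        using h1 by simp
      also have "\<dots> \<le> (\<Sum>j\<in>{1..n * k}. h (T n j))" using h0 by (intro sum_mono2) auto
      finally show ?thesis by (simp add: trunc_mean_def divide_right_mono)
    qed
    then show "\<forall>\<^sub>F n in sequentially. real (card {j \<in> {1..n * k}. T n j \<in> X}) / real n \<le> trunc_mean h n" by simp
  qed simp
qed

end

section \<open>Application to block Toeplitz matrices\<close>

text \<open>The symbol \<open>J A\<close>: row \<open>a\<close> of \<open>J\<close> has the single
  entry \<open>(-1) ^ a\<close>, in column \<open>partner a\<close>.\<close>

definition skew_entry :: "(real \<Rightarrow> complex mat) \<Rightarrow> nat \<Rightarrow> nat \<Rightarrow> real \<Rightarrow> complex" where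
  "skew_entry A a b \<theta> = (-1) ^ a * entry A (partner a) b \<theta>"

lemma jmul_index: "a < 2 * m \<Longrightarrow> jmul (2 * m) B a b = (-1) ^ a * B (partner a) b"
  unfolding jmul_def by (rule sum_jf_left)

lemma of_real_jmul:
  "a < 2 * m \<Longrightarrow> complex_of_real (jmul (2 * m) B a b) = (-1) ^ a * complex_of_real (B (partner a) b)"
  by (simp add: jmul_index)

text \<open>The block length \<open>2 * k\<close> is even, so no index pair straddles two blocks and
  parity within a block is parity in the whole matrix. Thus the large \<open>J\<close> times the
  Toeplitz matrix of \<open>A\<close> is the Toeplitz matrix of \<open>J A\<close>.\<close>

lemma block_toeplitz_skew:
  assumes "k \<ge> 1"
  shows "block_toeplitz (2 * k) (skew_entry A) r s = (-1) ^ r * block_toeplitz (2 * k) (entry A) (partner r) s"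
proof -
  define l a where "l = r div (2 * k)" and "a = r mod (2 * k)"
  have r: "r = l * (2 * k) + a" by (simp only: l_def a_def div_mult_mod_eq)
  have a: "a < 2 * k" using assms by (simp add: a_def)
  have ev: "even r \<longleftrightarrow> even a" by (simp add: r)
  have pr: "partner r = l * (2 * k) + partner a"
    unfolding partner_def ev using a by (cases "a = 0") (auto simp: r)
  have pa: "partner a < 2 * k" by (rule partner_less[OF a])
  have sgn: "(-1) ^ r = ((-1) ^ a :: complex)" using ev by (cases "even a") auto
  have d: "r div (2 * k) = l" "r mod (2 * k) = a" "partner r div (2 * k) = l" "partner r mod (2 * k) = partner a"
    using a pa by (simp_all add: l_def a_def pr)
  show ?thesis
    unfolding block_toeplitz_def d sgn skew_entry_def[abs_def] coef_cmult ..
qed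

locale positive_toeplitz =
  fixes k :: nat and A :: "real \<Rightarrow> complex mat"
  assumes k: "k \<ge> 1"
    and Linf: "A \<in> Linf_mat (2 * k)"
    and psym: "partially_symmetric (2 * k) A"
    and bop: "l2_bounded_op (2 * k) (toeplitz_op (2 * k) A)"
    and pinv: "l2_positive_invertible (2 * k) (toeplitz_op (2 * k) A)"
begin

abbreviation "N \<equiv> 2 * k"
abbreviation "trunc n \<equiv> re_mat (toeplitz_mat N A n)"

lemma N_pos: "N > 0" using k by simp

lemma herm: "l2_hermitian N (toeplitz_op N A)" using pinv by (simp add: l2_positive_invertible_def)

lemma bounded_entry: "a < N \<Longrightarrow> b < N \<Longrightarrow> bounded_fun (entry A a b)"
  using Linf unfolding Linf_mat_def bounded_fun_def by blast

lemma bounded_skew: "a < N \<Longrightarrow> b < N \<Longrightarrow> bounded_fun (skew_entry A a b)"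
  unfolding skew_entry_def[abs_def] by (intro bounded_fun_mult bounded_fun_const bounded_entry partner_less)

lemma block_toeplitz_real: "block_toeplitz N (entry A) r s \<in> \<real>"
  unfolding block_toeplitz_def by (rule partially_symmetric_coef(1)[OF psym]) (use N_pos in auto)

lemma trunc_carrier: "trunc n \<in> carrier_mat (2 * (n * k)) (2 * (n * k))"
  by (simp add: toeplitz_mat_def mult.left_commute)

lemma trunc_index:
  "r < 2 * (n * k) \<Longrightarrow> s < 2 * (n * k) \<Longrightarrow> trunc n $$ (r, s) = Re (block_toeplitz N (entry A) r s)"
proof -
  assume rs: "r < 2 * (n * k)" "s < 2 * (n * k)"
  then have rs': "r < n * N" "s < n * N" by (simp_all add: mult.left_commute)
  then have "trunc n $$ (r, s) = Re (toeplitz_mat N A n $$ (r, s))" by (simp add: toeplitz_mat_def)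
  then show ?thesis by (simp add: toeplitz_mat_index[OF rs'])
qed

text \<open>Coercivity and the norm bound are inherited from the operator on the whole sequence
  space, which is why one \<open>C\<close> serves all \<open>n\<close>.\<close>

lemma trunc_williamson:
  obtains C where "C > 0"
    "\<And>n. \<exists>ds. length ds = n * k \<and> williamson_form (trunc n) ds \<and> (\<forall>d\<in>set ds. d \<le> C)"
proof -
  let ?T = "block_toeplitz N (entry A)"
  obtain c where c: "c > 0" "\<And>n x. c * (\<Sum>r<n * N. (cmod (x r))\<^sup>2) \<le> Re (\<Sum>r<n * N. cnj (x r) * (\<Sum>s<n * N. ?T r s * x s))"
    using truncation_coercive[OF N_pos bop pinv] by blast
  obtain C where C: "C > 0" "\<And>n x. (\<Sum>r<n * N. (cmod (\<Sum>s<n * N. ?T r s * x s))\<^sup>2) \<le> C\<^sup>2 * (\<Sum>r<n * N. (cmod (x r))\<^sup>2)"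
    using truncation_bounded[OF N_pos bop] by blast
  have "\<exists>ds. length ds = n * k \<and> williamson_form (trunc n) ds \<and> (\<forall>d\<in>set ds. d \<le> C)" for n
  proof -
    have nN: "n * N = 2 * (n * k)" by simp
    have "coercive_form (n * k) (\<lambda>a b. trunc n $$ (a, b)) c"
    proof
      fix a b assume "a < 2 * (n * k)" "b < 2 * (n * k)"
      then show "trunc n $$ (a, b) = trunc n $$ (b, a)"
        using truncation_hermitian[OF N_pos herm, of a b] by (simp add: trunc_index)
    next
      fix x :: "nat \<Rightarrow> real"
      have "c * (\<Sum>r<n * N. (cmod (complex_of_real (x r)))\<^sup>2)
        \<le> Re (\<Sum>r<n * N. cnj (complex_of_real (x r)) * (\<Sum>s<n * N. ?T r s * complex_of_real (x s)))" by (rule c(2))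
      also have "\<dots> = bil (2 * (n * k)) (\<lambda>a b. trunc n $$ (a, b)) x x"
        unfolding bil_def nN by (simp add: trunc_index sum_distrib_left mult.assoc)
      finally show "c * (\<Sum>a<2 * (n * k). (x a)\<^sup>2) \<le> bil (2 * (n * k)) (\<lambda>a b. trunc n $$ (a, b)) x x"
        unfolding nN by simp
    qed (rule c(1))
    from williamson_exists[OF trunc_carrier this] obtain ds where ds: "length ds = n * k" "williamson_form (trunc n) ds"
      by blast
    have "d \<le> C" if "d \<in> set ds" for d
    proof (rule williamson_bound[OF ds(2) C(1) _ that])
      fix x :: "nat \<Rightarrow> real"
      have "(\<Sum>a<2 * (n * k). (\<Sum>b<2 * (n * k). trunc n $$ (a, b) * x b)\<^sup>2)
        = (\<Sum>a<n * N. (Re (\<Sum>b<n * N. ?T a b * complex_of_real (x b)))\<^sup>2)"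
        unfolding nN by (simp add: trunc_index)
      also have "\<dots> \<le> (\<Sum>a<n * N. (cmod (\<Sum>b<n * N. ?T a b * complex_of_real (x b)))\<^sup>2)"
        by (intro sum_mono) (simp only: cmod_power2 le_add_same_cancel1 zero_le_power2)
      also have "\<dots> \<le> C\<^sup>2 * (\<Sum>r<n * N. (cmod (complex_of_real (x r)))\<^sup>2)" by (rule C(2))
      finally show "(\<Sum>a<2 * length ds. (\<Sum>b<2 * length ds. trunc n $$ (a, b) * x b)\<^sup>2) \<le> C\<^sup>2 * (\<Sum>a<2 * length ds. (x a)\<^sup>2)"
        unfolding nN ds(1) by simp
    qed
    then show ?thesis using ds by blast
  qed
  then show ?thesis using that C(1) by blast
qed

lemma trunc_moment:
  assumes w: "williamson_form (trunc n) ds" and l: "length ds = n * k"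
  shows "complex_of_real (2 * (-1) ^ q * (\<Sum>d\<leftarrow>ds. d ^ (2 * q)))
    = (\<Sum>r<n * N. mpow (n * N) (block_toeplitz N (skew_entry A)) (2 * q) r r)"
proof -
  have nN: "n * N = 2 * (n * k)" by simp
  let ?X = "jmul (2 * (n * k)) (\<lambda>a b. trunc n $$ (a, b))"
  have "complex_of_real (2 * (-1) ^ q * (\<Sum>d\<leftarrow>ds. d ^ (2 * q))) = (\<Sum>r<2 * (n * k). complex_of_real (mpow (2 * (n * k)) ?X (2 * q) r r))"
    by (simp only: of_real_sum[symmetric] williamson_trace[OF w, of q, unfolded l])
  also have "\<dots> = (\<Sum>r<n * N. mpow (n * N) (block_toeplitz N (skew_entry A)) (2 * q) r r)"
    unfolding nN mpow_of_real[symmetric]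
  proof (intro sum.cong refl mpow_cong)
    fix a b assume ab: "a < 2 * (n * k)" "b < 2 * (n * k)"
    have "complex_of_real (trunc n $$ (partner a, b)) = block_toeplitz N (entry A) (partner a) b"
      using block_toeplitz_real partner_less[OF ab(1)] ab(2) by (simp add: trunc_index)
    then show "complex_of_real (?X a b) = block_toeplitz N (skew_entry A) a b"
      using ab by (simp add: of_real_jmul block_toeplitz_skew[OF k])
  qed auto
  finally show ?thesis .
qed

lemma symbol_moment:
  assumes w: "williamson_form (re_mat (A \<theta>)) ds" and l: "length ds = k"
    and car: "A \<theta> \<in> carrier_mat N N" and real: "\<And>a b. a < N \<Longrightarrow> b < N \<Longrightarrow> A \<theta> $$ (a, b) \<in> \<real>"
  shows "complex_of_real (2 * (-1) ^ q * (\<Sum>d\<leftarrow>ds. d ^ (2 * q)))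
    = (\<Sum>b<N. mpow N (\<lambda>a b. skew_entry A a b \<theta>) (2 * q) b b)"
proof -
  let ?X = "jmul N (\<lambda>a b. re_mat (A \<theta>) $$ (a, b))"
  have "complex_of_real (2 * (-1) ^ q * (\<Sum>d\<leftarrow>ds. d ^ (2 * q))) = (\<Sum>r<N. complex_of_real (mpow N ?X (2 * q) r r))"
    by (simp only: of_real_sum[symmetric] williamson_trace[OF w, of q, unfolded l])
  also have "\<dots> = (\<Sum>r<N. mpow N (\<lambda>a b. skew_entry A a b \<theta>) (2 * q) r r)"
    unfolding mpow_of_real[symmetric]
  proof (intro sum.cong refl mpow_cong)
    fix a b assume ab: "a < N" "b < N"
    have "complex_of_real (re_mat (A \<theta>) $$ (partner a, b)) = A \<theta> $$ (partner a, b)"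
      using real[OF partner_less[OF ab(1)] ab(2)] partner_less[OF ab(1)] ab(2) car by simp
    then show "complex_of_real (?X a b) = skew_entry A a b \<theta>"
      using ab by (simp only: of_real_jmul skew_entry_def)
  qed auto
  finally show ?thesis .
qed

lemma symbol_williamson:
  obtains C where "C > 0"
    "AE \<theta> in circle_measure. A \<theta> \<in> carrier_mat N N \<and> (\<forall>a<N. \<forall>b<N. A \<theta> $$ (a, b) \<in> \<real>) \<and>
      (\<exists>ds. length ds = k \<and> williamson_form (re_mat (A \<theta>)) ds \<and> (\<forall>d\<in>set ds. d \<le> C))"
proof -
  obtain c where c: "c > 0" "\<And>n x. c * (\<Sum>r<n * N. (cmod (x r))\<^sup>2) \<le> Re (\<Sum>r<n * N. cnj (x r) * (\<Sum>s<n * N. block_toeplitz N (entry A) r s * x s))"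
    using truncation_coercive[OF N_pos bop pinv] by blast
  have "\<forall>a b. \<exists>K. a < N \<longrightarrow> b < N \<longrightarrow> (AE \<theta> in circle_measure. cmod (A \<theta> $$ (a, b)) \<le> K)"
    using bounded_entry unfolding bounded_fun_def by blast
  then obtain K0 where K0: "\<And>a b. a < N \<Longrightarrow> b < N \<Longrightarrow> AE \<theta> in circle_measure. cmod (A \<theta> $$ (a, b)) \<le> K0 a b" by metis
  \<comment> \<open>Gathers the finitely many essential bounds of the entries into one positive
    constant.\<close>
  define K where "K = 1 + (\<Sum>a<N. \<Sum>b<N. \<bar>K0 a b\<bar>)"
  have K: "K > 0" unfolding K_def by (intro add_pos_nonneg sum_nonneg) auto
  have K0K: "K0 a b \<le> K" if "a < N" "b < N" for a b
  proof -
    have "\<bar>K0 a b\<bar> \<le> (\<Sum>b<N. \<bar>K0 a b\<bar>)" using that by (intro member_le_sum) auto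
    also have "\<dots> \<le> (\<Sum>a<N. \<Sum>b<N. \<bar>K0 a b\<bar>)"
      using that by (intro member_le_sum[of a _ "\<lambda>a. \<Sum>b<N. \<bar>K0 a b\<bar>"]) (auto intro!: sum_nonneg)
    finally show ?thesis by (simp add: K_def)
  qed
  have all: "(AE \<theta> in circle_measure. \<forall>a<N. \<forall>b<N. P a b \<theta>) \<longleftrightarrow> (\<forall>a<N. \<forall>b<N. AE \<theta> in circle_measure. P a b \<theta>)" for P
  proof -
    have "(AE \<theta> in circle_measure. \<forall>a\<in>{..<N}. \<forall>b\<in>{..<N}. P a b \<theta>) \<longleftrightarrow> (\<forall>a\<in>{..<N}. \<forall>b\<in>{..<N}. AE \<theta> in circle_measure. P a b \<theta>)"
      by (simp only: AE_ball_countable countable_finite finite_lessThan)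
    then show ?thesis by (simp add: Ball_def)
  qed
  have bound: "AE \<theta> in circle_measure. \<forall>a<N. \<forall>b<N. cmod (A \<theta> $$ (a, b)) \<le> K"
    unfolding all
  proof (intro allI impI)
    fix a b assume ab: "a < N" "b < N"
    from K0[OF ab] show "AE \<theta> in circle_measure. cmod (A \<theta> $$ (a, b)) \<le> K"
      by eventually_elim (use K0K[OF ab] in linarith)
  qed
  \<comment> \<open>An entry and its conjugate have the same Fourier coefficients, because these are
    real and even.\<close>
  have real: "AE \<theta> in circle_measure. \<forall>a<N. \<forall>b<N. A \<theta> $$ (a, b) = cnj (A \<theta> $$ (a, b))"
    unfolding all
  proof (intro allI impI)
    fix a b assume ab: "a < N" "b < N"
    show "AE \<theta> in circle_measure. A \<theta> $$ (a, b) = cnj (A \<theta> $$ (a, b))"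
      by (rule coef_eq_AE)
        (use bounded_entry[OF ab] partially_symmetric_coef[OF psym ab] in \<open>auto simp: coef_cnj Reals_cnj_iff\<close>)
  qed
  have sym: "AE \<theta> in circle_measure. \<forall>a<N. \<forall>b<N. A \<theta> $$ (a, b) = A \<theta> $$ (b, a)"
    unfolding all
  proof (intro allI impI)
    fix a b assume ab: "a < N" "b < N"
    show "AE \<theta> in circle_measure. A \<theta> $$ (a, b) = A \<theta> $$ (b, a)"
      by (rule coef_eq_AE[OF bounded_entry[OF ab] bounded_entry[OF ab(2,1)]])
        (rule coef_transpose[OF N_pos psym herm ab(2,1)])
  qed
  have coer: "AE \<theta> in circle_measure. \<forall>v. c * (\<Sum>a<N. (v a)\<^sup>2) \<le> bil N (\<lambda>a b. Re (A \<theta> $$ (a, b))) v v"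
    by (rule symbol_coercive[OF bounded_entry c(2)])
  have space: "AE \<theta> in circle_measure. \<theta> \<in> {-pi..pi}" by (rule AE_I2) simp
  show ?thesis
  \<comment> \<open>A matrix of size \<open>N\<close> with entries of modulus at most
    \<open>K\<close> has operator norm at most \<open>N * K\<close>, by Cauchy-Schwarz in each
    row.\<close>
  proof (rule that[of "N * K"])
    show "N * K > 0" using K N_pos by simp
    from bound real sym coer space
    show "AE \<theta> in circle_measure. A \<theta> \<in> carrier_mat N N \<and> (\<forall>a<N. \<forall>b<N. A \<theta> $$ (a, b) \<in> \<real>) \<and>
      (\<exists>ds. length ds = k \<and> williamson_form (re_mat (A \<theta>)) ds \<and> (\<forall>d\<in>set ds. d \<le> N * K))"
    proof eventually_elim
      case (elim \<theta>)
      have car: "A \<theta> \<in> carrier_mat N N" using Linf elim by (auto simp: Linf_mat_def)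
      then have carR: "re_mat (A \<theta>) \<in> carrier_mat (2 * k) (2 * k)" by simp
      have idx: "re_mat (A \<theta>) $$ (a, b) = Re (A \<theta> $$ (a, b))" if "a < N" "b < N" for a b
        using that car by simp
      have re: "A \<theta> $$ (a, b) \<in> \<real>" if "a < N" "b < N" for a b
      proof -
        have "A \<theta> $$ (a, b) = cnj (A \<theta> $$ (a, b))" using elim that by blast
        then show ?thesis by (simp add: Reals_cnj_iff)
      qed
      have "coercive_form k (\<lambda>a b. re_mat (A \<theta>) $$ (a, b)) c"
      proof
        fix a b assume ab: "a < 2 * k" "b < 2 * k"
        then have "A \<theta> $$ (a, b) = A \<theta> $$ (b, a)" using elim by blast
        then show "re_mat (A \<theta>) $$ (a, b) = re_mat (A \<theta>) $$ (b, a)" using ab by (simp only: idx)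
      next
        fix x :: "nat \<Rightarrow> real"
        have "bil (2 * k) (\<lambda>a b. re_mat (A \<theta>) $$ (a, b)) x x = bil N (\<lambda>a b. Re (A \<theta> $$ (a, b))) x x"
          unfolding bil_def by (intro sum.cong refl) (simp only: idx lessThan_iff)
        then show "c * (\<Sum>a<2 * k. (x a)\<^sup>2) \<le> bil (2 * k) (\<lambda>a b. re_mat (A \<theta>) $$ (a, b)) x x" using elim by simp
      qed (rule c(1))
      from williamson_exists[OF carR this] obtain ds where ds: "length ds = k" "williamson_form (re_mat (A \<theta>)) ds" by blast
      have "d \<le> N * K" if "d \<in> set ds" for d
      proof (rule williamson_bound[OF ds(2) _ _ that])
        show "N * K > 0" using K N_pos by simp
        fix x :: "nat \<Rightarrow> real"
        have row: "(\<Sum>b<N. re_mat (A \<theta>) $$ (a, b) * x b)\<^sup>2 \<le> N * K\<^sup>2 * (\<Sum>b<N. (x b)\<^sup>2)" if a: "a < N" for a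
        proof -
          have "(\<Sum>b<N. re_mat (A \<theta>) $$ (a, b) * x b)\<^sup>2 \<le> (\<Sum>b<N. (re_mat (A \<theta>) $$ (a, b) * x b)\<^sup>2) * real (card {..<N})"
            by (rule sum_squared_le_sum_of_squares)
          also have "(\<Sum>b<N. (re_mat (A \<theta>) $$ (a, b) * x b)\<^sup>2) \<le> (\<Sum>b<N. K\<^sup>2 * (x b)\<^sup>2)"
          proof (rule sum_mono)
            fix b assume "b \<in> {..<N}"
            then have b: "b < N" by simp
            have "cmod (A \<theta> $$ (a, b)) \<le> K" using elim a b by blast
            then have "\<bar>re_mat (A \<theta>) $$ (a, b)\<bar> \<le> K" unfolding idx[OF a b] using abs_Re_le_cmod order_trans by blast
            then have "(re_mat (A \<theta>) $$ (a, b))\<^sup>2 \<le> K\<^sup>2" by (metis abs_ge_zero power2_abs power_mono)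
            then show "(re_mat (A \<theta>) $$ (a, b) * x b)\<^sup>2 \<le> K\<^sup>2 * (x b)\<^sup>2"
              unfolding power_mult_distrib by (rule mult_right_mono) simp
          qed
          finally show ?thesis by (simp add: sum_distrib_left[symmetric] mult_ac mult_right_mono)
        qed
        have "(\<Sum>a<N. (\<Sum>b<N. re_mat (A \<theta>) $$ (a, b) * x b)\<^sup>2) \<le> (\<Sum>a<N. N * K\<^sup>2 * (\<Sum>b<N. (x b)\<^sup>2))"
          by (intro sum_mono row) simp
        also have "\<dots> = (N * K)\<^sup>2 * (\<Sum>b<N. (x b)\<^sup>2)" by (simp add: power2_eq_square mult_ac)
        finally show "(\<Sum>a<2 * length ds. (\<Sum>b<2 * length ds. re_mat (A \<theta>) $$ (a, b) * x b)\<^sup>2) \<le> (N * K)\<^sup>2 * (\<Sum>a<2 * length ds. (x a)\<^sup>2)"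
          unfolding ds(1) .
      qed
      then show ?case using car re ds by blast
    qed
  qed
qed

lemma sum_list_nth_shift: "(\<Sum>j\<in>{1..length ds}. f (ds ! (j - 1))) = (\<Sum>d\<leftarrow>ds. f d)" for f :: "real \<Rightarrow> real"
proof -
  have "(\<Sum>j\<in>{1..length ds}. f (ds ! (j - 1))) = (\<Sum>i<length ds. f (ds ! i))"
    by (rule sum.reindex_bij_witness[of _ Suc "\<lambda>j. j - 1"]) auto
  then show ?thesis by (simp add: sum_list_sum_nth atLeast0LessThan)
qed

lemma eigenvalue_distribution:
  obtains C e M where "moment_limit k C e (trunc_eig k A)" "negligible M"
    "\<And>j \<theta>. j \<in> {1..k} \<Longrightarrow> \<theta> \<in> {-pi..pi} \<Longrightarrow> \<theta> \<notin> M \<Longrightarrow> symbol_eig A j \<theta> = e j \<theta>"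
proof -
  obtain C1 where C1: "C1 > 0" "\<And>n. \<exists>ds. length ds = n * k \<and> williamson_form (trunc n) ds \<and> (\<forall>d\<in>set ds. d \<le> C1)"
    using trunc_williamson by blast
  obtain C2 where C2: "C2 > 0" "AE \<theta> in circle_measure. A \<theta> \<in> carrier_mat N N \<and> (\<forall>a<N. \<forall>b<N. A \<theta> $$ (a, b) \<in> \<real>) \<and>
      (\<exists>ds. length ds = k \<and> williamson_form (re_mat (A \<theta>)) ds \<and> (\<forall>d\<in>set ds. d \<le> C2))"
    using symbol_williamson by blast
  define C where "C = max C1 C2"
  from C1(2) obtain tds where tds: "\<And>n. length (tds n) = n * k" "\<And>n. williamson_form (trunc n) (tds n)" "\<And>n d. d \<in> set (tds n) \<Longrightarrow> d \<le> C1"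
    by metis
  from AE_E[OF C2(2)] obtain M where M: "{\<theta> \<in> space circle_measure. \<not> (A \<theta> \<in> carrier_mat N N \<and> (\<forall>a<N. \<forall>b<N. A \<theta> $$ (a, b) \<in> \<real>) \<and>
      (\<exists>ds. length ds = k \<and> williamson_form (re_mat (A \<theta>)) ds \<and> (\<forall>d\<in>set ds. d \<le> C2)))} \<subseteq> M"
    "emeasure circle_measure M = 0" "M \<in> sets circle_measure" by blast
  have negl: "negligible M"
  proof -
    have "M \<subseteq> {-pi..pi}" "M \<in> sets lebesgue" using M(3) by (auto simp: sets_restrict_space intro!: sets.Int)
    moreover have "emeasure lebesgue M = 0"
      using M(2) calculation by (simp add: emeasure_restrict_space)
    ultimately show ?thesis by (simp add: negligible_iff_null_sets null_sets_def)
  qed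
  have good: "A \<theta> \<in> carrier_mat N N \<and> (\<forall>a<N. \<forall>b<N. A \<theta> $$ (a, b) \<in> \<real>) \<and>
      (\<exists>ds. length ds = k \<and> williamson_form (re_mat (A \<theta>)) ds \<and> (\<forall>d\<in>set ds. d \<le> C2))"
    if "\<theta> \<in> {-pi..pi}" "\<theta> \<notin> M" for \<theta> using M(1) that by auto
  \<comment> \<open>Off the null set \<open>M\<close> a Williamson list is chosen; elsewhere a
    constant list fills in, so that order and bounds hold at every \<open>\<theta>\<close>, as
    \<open>moment_limit\<close> demands.\<close>
  define es where "es = (\<lambda>\<theta>. if \<theta> \<in> {-pi..pi} - M
    then (SOME ds. length ds = k \<and> williamson_form (re_mat (A \<theta>)) ds \<and> (\<forall>d\<in>set ds. d \<le> C2)) else replicate k C)"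
  have es_good: "length (es \<theta>) = k" "williamson_form (re_mat (A \<theta>)) (es \<theta>)" "\<forall>d\<in>set (es \<theta>). d \<le> C2"
    if "\<theta> \<in> {-pi..pi} - M" for \<theta>
  proof -
    have "\<exists>ds. length ds = k \<and> williamson_form (re_mat (A \<theta>)) ds \<and> (\<forall>d\<in>set ds. d \<le> C2)" using good that by blast
    from someI_ex[OF this] show "length (es \<theta>) = k" "williamson_form (re_mat (A \<theta>)) (es \<theta>)" "\<forall>d\<in>set (es \<theta>). d \<le> C2"
      using that by (auto simp: es_def)
  qed
  have es_all: "length (es \<theta>) = k \<and> sorted (es \<theta>) \<and> (\<forall>d\<in>set (es \<theta>). 0 < d \<and> d \<le> C)" for \<theta>
  proof (cases "\<theta> \<in> {-pi..pi} - M")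
    case True
    then show ?thesis using es_good[OF True] by (auto simp: williamson_form_def C_def)
  next
    case False
    then have "es \<theta> = replicate k C" by (simp only: es_def if_False)
    then show ?thesis using C1(1) by (auto simp: sorted_replicate C_def)
  qed
  define e where "e = (\<lambda>j \<theta>. es \<theta> ! (j - 1))"
  have e_sum: "(\<Sum>j\<in>{1..k}. e j \<theta> ^ (2 * q)) = (\<Sum>d\<leftarrow>es \<theta>. d ^ (2 * q))" for q \<theta>
    using sum_list_nth_shift[of "\<lambda>d. d ^ (2 * q)" "es \<theta>"] es_all[of \<theta>] by (simp add: e_def)
  have t_eq: "trunc_eig k A n j = tds n ! (j - 1)" for n j
    unfolding trunc_eig_def by (rule symp_eig_eq[OF tds(2)])
  have t_sum: "(\<Sum>j\<in>{1..n * k}. trunc_eig k A n j ^ (2 * q)) = (\<Sum>d\<leftarrow>tds n. d ^ (2 * q))" for q n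
    using sum_list_nth_shift[of "\<lambda>d. d ^ (2 * q)" "tds n"] tds(1)[of n] by (simp add: t_eq)
  define \<mu> where "\<mu> = (\<lambda>q \<theta>. \<Sum>b<N. mpow N (\<lambda>a b. skew_entry A a b \<theta>) (2 * q) b b)"
  have b\<mu>: "bounded_fun (\<mu> q)" for q
    unfolding \<mu>_def by (intro bounded_fun_sum bounded_fun_mpow bounded_skew) auto
  have \<mu>_eq: "\<mu> q \<theta> = complex_of_real (2 * (-1) ^ q * (\<Sum>j\<in>{1..k}. e j \<theta> ^ (2 * q)))" if "\<theta> \<in> {-pi..pi} - M" for q \<theta>
    unfolding \<mu>_def e_sum using good[of \<theta>] that by (intro symbol_moment[symmetric] es_good) auto
  have sgn: "(-1) ^ q * ((-1) ^ q * x) = (x :: real)" for q x by (simp flip: mult.assoc power_mult_distrib)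
  have Re_\<mu>: "(\<Sum>j\<in>{1..k}. e j \<theta> ^ (2 * q)) = (-1) ^ q / 2 * Re (\<mu> q \<theta>)" if "\<theta> \<in> {-pi..pi} - M" for q \<theta>
    unfolding \<mu>_eq[OF that] Re_complex_of_real using sgn[of q] by simp
  have off_M: "AE \<theta> in circle_measure. \<theta> \<in> {-pi..pi} - M"
  proof -
    have "AE \<theta> in circle_measure. \<theta> \<in> {-pi..pi}" by (rule AE_I2) simp
    with circle_AE_negligible[OF negl] show ?thesis by eventually_elim simp
  qed
  have meas: "(\<lambda>\<theta>. \<Sum>j\<in>{1..k}. e j \<theta> ^ (2 * q)) \<in> borel_measurable circle_measure" for q
  proof -
    \<comment> \<open>The trace is measurable but is tied to the moment only off \<open>M\<close>;
      on \<open>M\<close> the filler list contributes the constant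
      \<open>k * C ^ (2 * q)\<close>.\<close>
    have "(\<lambda>\<theta>. if \<theta> \<in> M then k * C ^ (2 * q) else (-1) ^ q / 2 * Re (\<mu> q \<theta>)) \<in> borel_measurable circle_measure"
      using M(3) bounded_fun_meas[OF b\<mu>[of q]] by (intro measurable_If_set borel_measurable_times) auto
    also have "?this \<longleftrightarrow> ?thesis"
    proof (rule measurable_cong)
      fix \<theta> assume t: "\<theta> \<in> space circle_measure"
      show "(if \<theta> \<in> M then k * C ^ (2 * q) else (-1) ^ q / 2 * Re (\<mu> q \<theta>)) = (\<Sum>j\<in>{1..k}. e j \<theta> ^ (2 * q))"
      proof (cases "\<theta> \<in> M")
        case True
        then have "es \<theta> = replicate k C" by (simp add: es_def)
        then show ?thesis unfolding e_sum using True by (simp add: sum_list_replicate)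
      next
        case False then show ?thesis using t Re_\<mu>[of \<theta> q] by simp
      qed
    qed
    finally show ?thesis .
  qed
  have lim: "(\<lambda>n. (\<Sum>j\<in>{1..n * k}. trunc_eig k A n j ^ (2 * q)) / real n)
      \<longlonglongrightarrow> 1 / (2 * pi) * (LINT \<theta>|circle_measure. (\<Sum>j\<in>{1..k}. e j \<theta> ^ (2 * q)))" for q
  proof -
    let ?t = "\<lambda>n. \<Sum>j\<in>{1..n * k}. trunc_eig k A n j ^ (2 * q)"
    let ?I = "1 / (2 * pi) * (LINT \<theta>|circle_measure. (\<Sum>j\<in>{1..k}. e j \<theta> ^ (2 * q)))"
    have tr: "(\<Sum>r<n * N. mpow (n * N) (block_toeplitz N (skew_entry A)) (2 * q) r r) / of_nat n
      = complex_of_real (2 * (-1) ^ q * (?t n / real n))" for n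
      unfolding t_sum trunc_moment[OF tds(2,1), of q n, symmetric] by simp
    have "(\<lambda>n. (\<Sum>r<n * N. mpow (n * N) (block_toeplitz N (skew_entry A)) (2 * q) r r) / of_nat n) \<longlonglongrightarrow> avg (\<mu> q)"
      unfolding \<mu>_def by (rule block_toeplitz_moment) (rule bounded_skew)
    moreover have "avg (\<mu> q) = complex_of_real (2 * (-1) ^ q * ?I)"
    proof -
      have "(LINT \<theta>|circle_measure. \<mu> q \<theta>) = (LINT \<theta>|circle_measure. complex_of_real (2 * (-1) ^ q * (\<Sum>j\<in>{1..k}. e j \<theta> ^ (2 * q))))"
      proof (rule integral_cong_AE)
        show "AE \<theta> in circle_measure. \<mu> q \<theta> = complex_of_real (2 * (-1) ^ q * (\<Sum>j\<in>{1..k}. e j \<theta> ^ (2 * q)))"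
          using off_M by eventually_elim (rule \<mu>_eq)
        show "(\<lambda>\<theta>. complex_of_real (2 * (-1) ^ q * (\<Sum>j\<in>{1..k}. e j \<theta> ^ (2 * q)))) \<in> borel_measurable circle_measure"
          using meas[of q] by measurable
      qed (rule bounded_fun_meas[OF b\<mu>])
      also have "\<dots> = complex_of_real (2 * (-1) ^ q * (LINT \<theta>|circle_measure. (\<Sum>j\<in>{1..k}. e j \<theta> ^ (2 * q))))"
        by (simp only: integral_complex_of_real integral_mult_right_zero)
      finally show ?thesis by (simp add: avg_def)
    qed
    ultimately have "(\<lambda>n. complex_of_real (2 * (-1) ^ q * (?t n / real n))) \<longlonglongrightarrow> complex_of_real (2 * (-1) ^ q * ?I)"
      by (simp only: tr)
    then have "(\<lambda>n. 2 * (-1) ^ q * (?t n / real n)) \<longlonglongrightarrow> 2 * (-1) ^ q * ?I"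
      by (simp only: tendsto_of_real_iff)
    \<comment> \<open>Removes the sign and the factor 2 of the trace identity.\<close>
    from tendsto_mult_left[OF this, of "(-1) ^ q / 2"] show ?thesis
      using sgn[of q] by (simp add: mult.assoc)
  qed
  have "moment_limit k C e (trunc_eig k A)"
  proof
    show "C > 0" using C1(1) by (simp add: C_def)
    show "0 < e j \<theta> \<and> e j \<theta> \<le> C" if "j \<in> {1..k}" for j \<theta>
    proof -
      have "e j \<theta> \<in> set (es \<theta>)" unfolding e_def using that es_all[of \<theta>] by (intro nth_mem) auto
      then show ?thesis using es_all[of \<theta>] by blast
    qed
    show "e i \<theta> \<le> e j \<theta>" if "1 \<le> i" "i \<le> j" "j \<le> k" for i j \<theta>
      unfolding e_def using es_all[of \<theta>] that by (intro sorted_nth_mono) auto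
    show "0 < trunc_eig k A n j \<and> trunc_eig k A n j \<le> C" if "j \<in> {1..n * k}" for n j
    proof -
      have "tds n ! (j - 1) \<in> set (tds n)" using that tds(1)[of n] by (intro nth_mem) auto
      then show ?thesis using tds(2)[of n] tds(3)[of _ n] unfolding t_eq williamson_form_def C_def by fastforce
    qed
  qed (rule meas lim)+
  moreover have "symbol_eig A j \<theta> = e j \<theta>" if "\<theta> \<in> {-pi..pi}" "\<theta> \<notin> M" for j \<theta>
    unfolding symbol_eig_def e_def using that by (intro symp_eig_eq es_good) auto
  ultimately show ?thesis using that negl by blast
qed

end

theorem theorem4p6:
  fixes k :: nat and A :: "real \<Rightarrow> complex mat"
  assumes "k \<ge> 1"
    and "A \<in> Linf_mat (2 * k)"
    and "partially_symmetric (2 * k) A"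
    and "l2_bounded_op (2 * k) (toeplitz_op (2 * k) A)"
    and "l2_positive_invertible (2 * k) (toeplitz_op (2 * k) A)"
  shows "symbol_range k A \<subseteq> closure (trunc_spectrum k A) \<and>
    (\<forall>\<delta>>0. (\<lambda>n. real (outlier_count k A n (outlier_set k A \<delta>)) / real n) \<longlonglongrightarrow> 0)"
proof -
  interpret positive_toeplitz k A by standard (rule assms)+
  obtain C e M where ml: "moment_limit k C e (trunc_eig k A)" and M: "negligible M"
    "\<And>j \<theta>. j \<in> {1..k} \<Longrightarrow> \<theta> \<in> {-pi..pi} \<Longrightarrow> \<theta> \<notin> M \<Longrightarrow> symbol_eig A j \<theta> = e j \<theta>"
    using eigenvalue_distribution by blast
  interpret moment_limit k C e "trunc_eig k A" by (rule ml)
  \<comment> \<open>\<open>symbol_eig\<close> is known to agree with the measurable \<open>e\<close>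
    only off \<open>M\<close>; essential ranges ignore the difference.\<close>
  have range: "symbol_range k A = (\<Union>j\<in>{1..k}. essential_range (e j))"
    unfolding symbol_range_def
    by (intro SUP_cong refl essential_range_cong[OF e_measurable M(1)] M(2))
  show ?thesis
  proof (intro conjI allI impI subsetI)
    fix x assume "x \<in> symbol_range k A"
    then obtain j where j: "j \<in> {1..k}" "x \<in> essential_range (e j)" unfolding range by blast
    show "x \<in> closure (trunc_spectrum k A)"
      unfolding closure_approachable
    proof (intro allI impI)
      fix \<epsilon> :: real assume "\<epsilon> > 0"
      from essential_range_near_trunc[OF j this] obtain n i
        where ni: "n \<ge> 1" "i \<in> {1..n * k}" "\<bar>trunc_eig k A n i - x\<bar> < \<epsilon>" by blast
      then have "trunc_eig k A n i \<in> trunc_spectrum k A" unfolding trunc_spectrum_def by blast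
      then show "\<exists>y\<in>trunc_spectrum k A. dist y x < \<epsilon>" using ni(3) by (auto simp: dist_real_def)
    qed
  next
    fix \<delta> :: real assume \<delta>: "\<delta> > 0"
    show "(\<lambda>n. real (outlier_count k A n (outlier_set k A \<delta>)) / real n) \<longlonglongrightarrow> 0"
      unfolding outlier_count_def
    proof (rule outliers_negligible[OF assms(1) \<delta>])
      fix d s assume "d \<in> outlier_set k A \<delta>" "s \<in> (\<Union>j\<in>{1..k}. essential_range (e j))"
      then show "\<bar>d - s\<bar> \<ge> \<delta>"
        unfolding range[symmetric] by (auto simp: outlier_set_def open_nbhd_def not_less)
    qed
  qed
qed

end
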